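(* Consider the interval model $Y_t={\bf Z}_t'{\boldsymbol\theta}^0+u_t$, $t=1,\dots,T$, described in the context, with fixed dimension $p$. Write ${\boldsymbol\theta}^0=({\boldsymbol\theta}_1^{0\prime},{\boldsymbol\theta}_2^{0\prime})'$, where (after relabeling the coordinates) ${\boldsymbol\theta}_1^0\in\mathbb{R}^{k_0}$ has all entries nonzero and ${\boldsymbol\theta}_2^0={\bf 0}\in\mathbb{R}^{p-k_0}$; write correspondingly $\hat{\boldsymbol\theta}_T=(\hat{\boldsymbol\theta}_{1T}',\hat{\boldsymbol\theta}_{2T}')'$ and let ${\bf Z}_{1t}$ be the vector of the first $k_0$ components of ${\bf Z}_t$. Suppose: (A1) $\{Y_t,X_{1,t},\dots,X_{J,t}\}$ are strictly stationary and ergodic interval stochastic processes with $\mathbb{E}\|Y_t\|_K^4<\infty$, $\mathbb{E}\|X_{j,t}\|_K^4<\infty$ for all $j$; $\mathbb{E}(u_t\mid\mathcal{I}_{t-1})=[0,0]$ a.s. and $\mathbb{E}(\|u_t\|_K^2\mid\mathcal{I}_{t-1})=\sigma^2$; (A2) the parameter space $\Theta$ is a compact subset of $\mathbb{R}^p$ and ${\boldsymbol\theta}^0$ is an interior point of $\Theta$; (A3) $\mathbb{E}[\langle s_{{\bf Z}_t},s'_{{\bf Z}_t}\rangle_K]$ and $\mathbb{E}[\langle s_{{\bf Z}_t},s_{u_t({\boldsymbol\theta})}\rangle_K\langle s_{u_t({\boldsymbol\theta})},s'_{{\bf Z}_t}\rangle_K]$, with $u_t({\boldsymbol\theta})=Y_t-{\bf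 Z}_t'{\boldsymbol\theta}$, are positive definite for all ${\boldsymbol\theta}$ in a small neighborhood of ${\boldsymbol\theta}^0$; (A4) $\lambda_T/\sqrt T\to0$ and $\lambda_T T^{(\gamma-1)/2}\to\infty$ as $T\to\infty$. Then: (i) $\lim_{T\to\infty}P(\hat{\boldsymbol\theta}_{2T}={\bf 0})=1$; (ii) as $T\to\infty$, $\sqrt{T}(\hat{\boldsymbol\theta}_{1T}-{\boldsymbol\theta}_1^0)\xrightarrow{d}N\big({\bf 0},\,C_{11}^{-1}\mathbb{E}[\langle s_{{\bf Z}_{1t}},s_{u_t}\rangle_K\langle s_{u_t},s'_{{\bf Z}_{1t}}\rangle_K]C_{11}^{-1}\big)$, where $C_{11}$ is the upper-left $k_0\times k_0$ block of $\mathbb{E}[\langle s_{{\bf Z}_t},s'_{{\bf Z}_t}\rangle_K]$.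
   Context: Intervals: an (extended) interval is an ordered pair $A=[A_L,A_R]$ of real numbers, where $A_R<A_L$ is allowed. Operations: $A+B=[A_L+B_L,A_R+B_R]$, $A-B=[A_L-B_L,A_R-B_R]$, $cA=[cA_L,cA_R]$ for $c\in\mathbb{R}$. The support function of $A$ on $\{-1,1\}$ is $s_A(1)=A_R$, $s_A(-1)=-A_L$. Fix a symmetric positive definite kernel $K:\{-1,1\}^2\to\mathbb{R}$: $K(1,-1)=K(-1,1)$, $K(1,1)>0$, $K(1,1)K(-1,-1)>K(1,-1)^2$. Define $\langle s_A,s_B\rangle_K=\sum_{u,v\in\{-1,1\}}K(u,v)s_A(u)s_B(v)$ and $\|A\|_K^2=\langle s_A,s_A\rangle_K$. For a column vector of intervals ${\bf A}=(A_1,\dots,A_p)'$ and an interval $C$: $\langle s_{\bf A},s'_{\bf A}\rangle_K$ is the $p\times p$ matrix with entries $\langle s_{A_i},s_{A_j}\rangle_K$, $\langle s_{\bf A},s_C\rangle_K$ is the $p$-vector with entries $\langle s_{A_i},s_C\rangle_K$, $\langle s_C,s'_{\bf A}\rangle_K$ its transpose; ${\bf A}'{\boldsymbol\theta}=\sum_j\theta_jA_j$ for ${\boldsymbol\theta}\in\mathbb R^p$. Model: $Y_t$, $X_{1,t},\dots,X_{J,t}$ interval-valued time series; $I_0=[-1/2,1/2]$; ${\bf X}_t=(X_{1,t},\dots,X_{J,t})'$; ${\bf Z}_t=([1,1],I_0,Y_{t-1},\dots,Y_{t-q},{\bf X}_t',\dots,{\bf X}_{t-s}')'$ (a vector of $p$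 intervals); $Y_t={\bf Z}_t'{\boldsymbol\theta}^0+u_t$ with true ${\boldsymbol\theta}^0\in\mathbb{R}^p$ and interval innovation $u_t$; $\mathcal{I}_{t-1}$ is the information set at time $t-1$. Estimators: $\tilde{\boldsymbol\theta}_T=(\tilde\theta_1,\dots,\tilde\theta_p)'=\arg\min_{\boldsymbol\theta}\sum_{t=1}^T\|Y_t-{\bf Z}_t'{\boldsymbol\theta}\|_K^2$ (minimum $D_K$-distance estimator) and $\hat{\boldsymbol\theta}_T=\arg\min_{\boldsymbol\theta}\sum_{t=1}^T\|Y_t-{\bf Z}_t'{\boldsymbol\theta}\|_K^2+\lambda_T\sum_{j=1}^p|\theta_j|/|\tilde\theta_j|^\gamma$ with tuning parameter $\lambda_T>0$ and constant $\gamma>0$.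
   Formalization: The information set at time t−1 is taken to contain the current X_t (so Z_t is known given it), without which the claim fails; the penalty is read as infinite where the first-stage estimate of a coordinate is 0; both minimizations are over Θ and the lasso estimator is assumed measurable. *)

theory Defs
  imports "HOL-Probability.Probability"
begin

section \<open>Extended intervals as pairs (left endpoint, right endpoint)\<close>

type_synonym interval = "real \<times> real"

definition iadd :: "interval \<Rightarrow> interval \<Rightarrow> interval" where
  "iadd A B = (fst A + fst B, snd A + snd B)"

definition isub :: "interval \<Rightarrow> interval \<Rightarrow> interval" where
  "isub A B = (fst A - fst B, snd A - snd B)"

definition iscale :: "real \<Rightarrow> interval \<Rightarrow> interval" where
  "iscale c A = (c * fst A, c * snd A)"

definition ilin :: "nat \<Rightarrow> (nat \<Rightarrow> interval) \<Rightarrow> (nat \<Rightarrow> real) \<Rightarrow> interval" where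
  "ilin p A \<theta> = ((\<Sum>i<p. \<theta> i * fst (A i)), (\<Sum>i<p. \<theta> i * snd (A i)))"

text \<open>Support function on {-1,1}: s_A(1) = A_R, s_A(-1) = - A_L.\<close>
definition supp :: "interval \<Rightarrow> int \<Rightarrow> real" where
  "supp A u = (if u = 1 then snd A else - fst A)"

definition innerK :: "(int \<Rightarrow> int \<Rightarrow> real) \<Rightarrow> interval \<Rightarrow> interval \<Rightarrow> real" where
  "innerK K A B = (\<Sum>u\<in>{-1,1}. \<Sum>v\<in>{-1,1}. K u v * supp A u * supp B v)"

definition normK2 :: "(int \<Rightarrow> int \<Rightarrow> real) \<Rightarrow> interval \<Rightarrow> real" where
  "normK2 K A = innerK K A A"

definition kernel_pd :: "(int \<Rightarrow> int \<Rightarrow> real) \<Rightarrow> bool" where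
  "kernel_pd K \<longleftrightarrow> K 1 (-1) = K (-1) 1 \<and> K 1 1 > 0 \<and> K 1 1 * K (-1) (-1) > (K 1 (-1))\<^sup>2"

text \<open>X j is the exogenous series X_{j+1} (j < J).  p = 2 + q + J (s+1).\<close>
definition dimZ :: "nat \<Rightarrow> nat \<Rightarrow> nat \<Rightarrow> nat" where
  "dimZ q s J = 2 + q + J * (s + 1)"

text \<open>Z_t = ([1,1], I_0, Y_{t-1},...,Y_{t-q}, X_t', ..., X_{t-s}')' with
  X_{t-l}' = (X_{1,t-l}, ..., X_{J,t-l}).  Component i (0-based).\<close>
definition Zvec :: "nat \<Rightarrow> nat \<Rightarrow> nat \<Rightarrow> (int \<Rightarrow> 'a \<Rightarrow> interval) \<Rightarrow> (nat \<Rightarrow> int \<Rightarrow> 'a \<Rightarrow> interval)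
    \<Rightarrow> int \<Rightarrow> 'a \<Rightarrow> nat \<Rightarrow> interval" where
  "Zvec q s J Y X t \<omega> i =
     (if i = 0 then (1, 1)
      else if i = 1 then (-1/2, 1/2)
      else if i < 2 + q then Y (t - int (i - 1)) \<omega>
      else X ((i - (2 + q)) mod J) (t - int ((i - (2 + q)) div J)) \<omega>)"

definition resid :: "nat \<Rightarrow> nat \<Rightarrow> nat \<Rightarrow> (int \<Rightarrow> 'a \<Rightarrow> interval) \<Rightarrow> (nat \<Rightarrow> int \<Rightarrow> 'a \<Rightarrow> interval)
    \<Rightarrow> (nat \<Rightarrow> real) \<Rightarrow> int \<Rightarrow> 'a \<Rightarrow> interval" where
  "resid q s J Y X \<theta> t \<omega> = isub (Y t \<omega>) (ilin (dimZ q s J) (Zvec q s J Y X t \<omega>) \<theta>)"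

definition coord :: "(int \<Rightarrow> 'a \<Rightarrow> interval) \<Rightarrow> (nat \<Rightarrow> int \<Rightarrow> 'a \<Rightarrow> interval) \<Rightarrow> nat \<Rightarrow> int \<Rightarrow> 'a \<Rightarrow> real" where
  "coord Y X c t \<omega> =
     (if c = 0 then fst (Y t \<omega>) else if c = 1 then snd (Y t \<omega>)
      else if even c then fst (X ((c - 2) div 2) t \<omega>) else snd (X ((c - 2) div 2) t \<omega>))"

definition process_measurable :: "'a measure \<Rightarrow> (int \<Rightarrow> 'a \<Rightarrow> interval) \<Rightarrow> (nat \<Rightarrow> int \<Rightarrow> 'a \<Rightarrow> interval) \<Rightarrow> nat \<Rightarrow> bool" where
  "process_measurable M Y X J \<longleftrightarrow> (\<forall>c < 2 + 2 * J. \<forall>t. coord Y X c t \<in> borel_measurable M)"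

definition path :: "(int \<Rightarrow> 'a \<Rightarrow> interval) \<Rightarrow> (nat \<Rightarrow> int \<Rightarrow> 'a \<Rightarrow> interval) \<Rightarrow> nat \<Rightarrow> 'a \<Rightarrow> (int \<times> nat \<Rightarrow> real)" where
  "path Y X J \<omega> = (\<lambda>(t, c). if c < 2 + 2 * J then coord Y X c t \<omega> else 0)"

definition PS :: "(int \<times> nat \<Rightarrow> real) measure" where
  "PS = Pi\<^sub>M UNIV (\<lambda>_. borel)"

definition shift1 :: "(int \<times> nat \<Rightarrow> real) \<Rightarrow> (int \<times> nat \<Rightarrow> real)" where
  "shift1 x = (\<lambda>(t, c). x (t + 1, c))"

definition law :: "'a measure \<Rightarrow> (int \<Rightarrow> 'a \<Rightarrow> interval) \<Rightarrow> (nat \<Rightarrow> int \<Rightarrow> 'a \<Rightarrow> interval) \<Rightarrow> nat \<Rightarrow> (int \<times> nat \<Rightarrow> real) measure" where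
  "law M Y X J = distr M PS (path Y X J)"

definition strictly_stationary :: "'a measure \<Rightarrow> (int \<Rightarrow> 'a \<Rightarrow> interval) \<Rightarrow> (nat \<Rightarrow> int \<Rightarrow> 'a \<Rightarrow> interval) \<Rightarrow> nat \<Rightarrow> bool" where
  "strictly_stationary M Y X J \<longleftrightarrow> distr (law M Y X J) PS shift1 = law M Y X J"

definition ergodic :: "'a measure \<Rightarrow> (int \<Rightarrow> 'a \<Rightarrow> interval) \<Rightarrow> (nat \<Rightarrow> int \<Rightarrow> 'a \<Rightarrow> interval) \<Rightarrow> nat \<Rightarrow> bool" where
  "ergodic M Y X J \<longleftrightarrow>
     (\<forall>A \<in> sets PS. shift1 -` A \<inter> space PS = A \<longrightarrow>
        measure (law M Y X J) A = 0 \<or> measure (law M Y X J) A = 1)"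

text \<open>Information set I_{t-1} used in the equation for Y_t:
  generated by Y_r (r <= t-1) and X_{j,r} (r <= t).\<close>
definition info :: "'a measure \<Rightarrow> (int \<Rightarrow> 'a \<Rightarrow> interval) \<Rightarrow> (nat \<Rightarrow> int \<Rightarrow> 'a \<Rightarrow> interval) \<Rightarrow> nat \<Rightarrow> int \<Rightarrow> 'a measure" where
  "info M Y X J t = sigma (space M)
     {coord Y X c r -` B \<inter> space M | c r B. B \<in> sets borel \<and>
        ((c < 2 \<and> r \<le> t - 1) \<or> (2 \<le> c \<and> c < 2 + 2 * J \<and> r \<le> t))}"

definition DKobj :: "(int \<Rightarrow> int \<Rightarrow> real) \<Rightarrow> nat \<Rightarrow> nat \<Rightarrow> nat \<Rightarrow> (int \<Rightarrow> 'a \<Rightarrow> interval)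
   \<Rightarrow> (nat \<Rightarrow> int \<Rightarrow> 'a \<Rightarrow> interval) \<Rightarrow> nat \<Rightarrow> 'a \<Rightarrow> (nat \<Rightarrow> real) \<Rightarrow> real" where
  "DKobj K q s J Y X T \<omega> \<theta> = (\<Sum>t = 1..T. normK2 K (resid q s J Y X \<theta> (int t) \<omega>))"

definition adapt_pen :: "nat \<Rightarrow> real \<Rightarrow> (nat \<Rightarrow> real) \<Rightarrow> (nat \<Rightarrow> real) \<Rightarrow> real" where
  "adapt_pen p \<gamma> \<theta>t \<theta> = (\<Sum>j<p. \<bar>\<theta> j\<bar> / \<bar>\<theta>t j\<bar> powr \<gamma>)"

definition Rp :: "nat \<Rightarrow> (nat \<Rightarrow> real) set" where
  "Rp p = {\<theta>. \<forall>i \<ge> p. \<theta> i = 0}"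

definition posdef_on :: "nat set \<Rightarrow> (nat \<Rightarrow> nat \<Rightarrow> real) \<Rightarrow> bool" where
  "posdef_on S A \<longleftrightarrow> (\<forall>i\<in>S. \<forall>j\<in>S. A i j = A j i) \<and>
     (\<forall>v. (\<exists>i\<in>S. v i \<noteq> 0) \<longrightarrow> (\<Sum>i\<in>S. \<Sum>j\<in>S. v i * A i j * v j) > 0)"

definition inv_on :: "nat set \<Rightarrow> (nat \<Rightarrow> nat \<Rightarrow> real) \<Rightarrow> (nat \<Rightarrow> nat \<Rightarrow> real)" where
  "inv_on S A = (THE B. (\<forall>i\<in>S. \<forall>j\<in>S. (\<Sum>k\<in>S. A i k * B k j) = (if i = j then 1 else 0)) \<and>
                         (\<forall>i j. i \<notin> S \<or> j \<notin> S \<longrightarrow> B i j = 0))"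

definition gaussian_on :: "nat set \<Rightarrow> (nat \<Rightarrow> nat \<Rightarrow> real) \<Rightarrow> (nat \<Rightarrow> real) measure \<Rightarrow> bool" where
  "gaussian_on S V \<mu> \<longleftrightarrow> prob_space \<mu> \<and> sets \<mu> = sets (Pi\<^sub>M S (\<lambda>_. borel)) \<and>
     (\<forall>\<xi> :: nat \<Rightarrow> real. (\<integral>x. cis (\<Sum>i\<in>S. \<xi> i * x i) \<partial>\<mu>) =
         complex_of_real (exp (- (\<Sum>i\<in>S. \<Sum>j\<in>S. \<xi> i * V i j * \<xi> j) / 2)))"

definition conv_dist_to :: "'a measure \<Rightarrow> nat set \<Rightarrow> (nat \<Rightarrow> 'a \<Rightarrow> (nat \<Rightarrow> real)) \<Rightarrow> (nat \<Rightarrow> real) measure \<Rightarrow> bool" where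
  "conv_dist_to M S Xs \<mu> \<longleftrightarrow>
     (\<forall>f :: (nat \<Rightarrow> real) \<Rightarrow> real.
        continuous_on (PiE S (\<lambda>_. UNIV)) f \<and> bounded (f ` PiE S (\<lambda>_. UNIV)) \<longrightarrow>
        (\<lambda>n. \<integral>\<omega>. f (Xs n \<omega>) \<partial>M) \<longlonglongrightarrow> (\<integral>x. f x \<partial>\<mu>))"


definition Cmat :: "'a measure \<Rightarrow> (int \<Rightarrow> int \<Rightarrow> real) \<Rightarrow> nat \<Rightarrow> nat \<Rightarrow> nat \<Rightarrow> (int \<Rightarrow> 'a \<Rightarrow> interval)
   \<Rightarrow> (nat \<Rightarrow> int \<Rightarrow> 'a \<Rightarrow> interval) \<Rightarrow> int \<Rightarrow> nat \<Rightarrow> nat \<Rightarrow> real" where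
  "Cmat M K q s J Y X t i j = (\<integral>\<omega>. innerK K (Zvec q s J Y X t \<omega> i) (Zvec q s J Y X t \<omega> j) \<partial>M)"

definition Bmat :: "'a measure \<Rightarrow> (int \<Rightarrow> int \<Rightarrow> real) \<Rightarrow> nat \<Rightarrow> nat \<Rightarrow> nat \<Rightarrow> (int \<Rightarrow> 'a \<Rightarrow> interval)
   \<Rightarrow> (nat \<Rightarrow> int \<Rightarrow> 'a \<Rightarrow> interval) \<Rightarrow> (nat \<Rightarrow> real) \<Rightarrow> int \<Rightarrow> nat \<Rightarrow> nat \<Rightarrow> real" where
  "Bmat M K q s J Y X \<theta> t i j = (\<integral>\<omega>. innerK K (Zvec q s J Y X t \<omega> i) (resid q s J Y X \<theta> t \<omega>) *
                                     innerK K (resid q s J Y X \<theta> t \<omega>) (Zvec q s J Y X t \<omega> j) \<partial>M)"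

definition sandwich :: "nat set \<Rightarrow> (nat \<Rightarrow> nat \<Rightarrow> real) \<Rightarrow> (nat \<Rightarrow> nat \<Rightarrow> real) \<Rightarrow> nat \<Rightarrow> nat \<Rightarrow> real" where
  "sandwich S A B i j = (\<Sum>k\<in>S. \<Sum>l\<in>S. inv_on S A i k * B k l * inv_on S A l j)"

end

theory Submission
  imports Defs
begin

text \<open>
  Writing \<open>h = \<theta> - \<theta>\<^sup>0\<close>, the least squares objective is the quadratic \<open>h'A h - 2 h'G\<close> plus a constant, where
  \<open>A = \<Sum>\<^sub>t \<langle>s\<^sub>Z, s\<^sub>Z'\<rangle>\<close> and \<open>G = \<Sum>\<^sub>t \<langle>s\<^sub>Z, s\<^sub>u\<rangle>\<close>. By the ergodic theorem \<open>A/T\<close> tends to a positive definite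
  matrix \<open>C\<close>, and by the martingale central limit theorem \<open>G/\<surd>T\<close> is asymptotically Gaussian, in particular bounded
  in probability; hence both estimators are \<open>\<surd>T\<close>-consistent. Setting a coordinate \<open>j\<close> with \<open>\<theta>\<^sup>0\<^sub>j = 0\<close> to zero
  changes the quadratic part by \<open>|\<theta>\<^sub>j| O(\<surd>T)\<close> but saves a penalty \<open>|\<theta>\<^sub>j| \<lambda> |\<theta>~\<^sub>j|\<^bsup>-\<gamma>\<^esup>\<close>, which is of order at
  least \<open>|\<theta>\<^sub>j| \<lambda> T\<^bsup>\<gamma>/2\<^esup>\<close> and dominates: this is sparsity. On the remaining coordinates the first order condition
  reads \<open>A h - G = O(\<lambda>) = o(\<surd>T)\<close>, so \<open>\<surd>T h\<close> behaves like \<open>C\<^bsup>-1\<^esup> G / \<surd>T\<close>.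
\<close>

section \<open>The pointwise ergodic theorem\<close>

definition birkhoff_sum :: "('a \<Rightarrow> 'a) \<Rightarrow> ('a \<Rightarrow> real) \<Rightarrow> nat \<Rightarrow> 'a \<Rightarrow> real" where
  "birkhoff_sum T f n x = (\<Sum>k<n. f ((T ^^ k) x))"

text \<open>The maximum of the first \<open>n + 1\<close> Birkhoff sums, starting with the empty sum.\<close>
primrec birkhoff_max :: "('a \<Rightarrow> 'a) \<Rightarrow> ('a \<Rightarrow> real) \<Rightarrow> nat \<Rightarrow> 'a \<Rightarrow> real" where
  "birkhoff_max T f 0 x = 0"
| "birkhoff_max T f (Suc n) x = max 0 (f x + birkhoff_max T f n (T x))"

lemma birkhoff_max_nonneg: "0 \<le> birkhoff_max T f n x"
  by (cases n) auto

lemma birkhoff_max_mono: "mono (\<lambda>n. birkhoff_max T f n x)"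
proof -
  have "birkhoff_max T f n x \<le> birkhoff_max T f (Suc n) x" for n
  proof (induction n arbitrary: x)
    case (Suc n)
    show ?case using Suc[of "T x"] by (simp add: max_def)
  qed simp
  then show ?thesis by (simp add: mono_iff_le_Suc)
qed

lemma birkhoff_sum_le_birkhoff_max: "birkhoff_sum T f n x \<le> birkhoff_max T f n x"
proof (induction n arbitrary: x)
  case (Suc n)
  have "birkhoff_sum T f (Suc n) x = f x + birkhoff_sum T f n (T x)"
    unfolding birkhoff_sum_def sum.lessThan_Suc_shift by (simp add: funpow_swap1)
  then show ?case using Suc[of "T x"] by simp
qed (simp add: birkhoff_sum_def)

lemma bdd_above_birkhoff_max_comp:
  "bdd_above (range (\<lambda>n. birkhoff_max T f n (T x))) \<longleftrightarrow> bdd_above (range (\<lambda>n. birkhoff_max T f n x))"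
proof
  assume "bdd_above (range (\<lambda>n. birkhoff_max T f n (T x)))"
  then obtain B where bound: "birkhoff_max T f n (T x) \<le> B" for n by (auto simp: bdd_above_def)
  have "birkhoff_max T f n x \<le> max 0 (f x + B)" for n
    using bound by (cases n) (auto simp: max_def intro: order_trans)
  then show "bdd_above (range (\<lambda>n. birkhoff_max T f n x))" by (rule bdd_aboveI2)
next
  assume "bdd_above (range (\<lambda>n. birkhoff_max T f n x))"
  then obtain B where bound: "birkhoff_max T f n x \<le> B" for n by (auto simp: bdd_above_def)
  have "birkhoff_max T f n (T x) \<le> B - f x" for n
    using bound[of "Suc n"] by simp
  then show "bdd_above (range (\<lambda>n. birkhoff_max T f n (T x)))" by (rule bdd_aboveI2)
qed

locale ergodic_system = prob_space M for M :: "'a measure" +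
  fixes T :: "'a \<Rightarrow> 'a"
  assumes measurable_T[measurable]: "T \<in> measurable M M"
    and invariant: "distr M M T = M"
    and zero_one: "A \<in> events \<Longrightarrow> T -` A \<inter> space M = A \<Longrightarrow> prob A = 0 \<or> prob A = 1"
begin

lemma integrable_comp:
  fixes f :: "'a \<Rightarrow> real"
  assumes "integrable M f"
  shows "integrable M (\<lambda>x. f (T x))"
  using assms integrable_distr_eq[OF measurable_T, of f] invariant by auto

lemma integral_comp:
  fixes f :: "'a \<Rightarrow> real"
  assumes "f \<in> borel_measurable M"
  shows "(\<integral>x. f (T x) \<partial>M) = (\<integral>x. f x \<partial>M)"
  using integral_distr[OF measurable_T assms] invariant by simp

lemma measurable_funpow: "T ^^ k \<in> measurable M M"
  by (induction k) (auto intro: measurable_comp)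

lemma invariant_funpow: "distr M M (T ^^ k) = M"
proof (induction k)
  case 0
  then show ?case by (simp add: id_def distr_id)
next
  case (Suc k)
  have "distr M M (T ^^ Suc k) = distr (distr M M (T ^^ k)) M T"
    unfolding funpow.simps by (rule distr_distr[OF measurable_T measurable_funpow, symmetric])
  then show ?case by (simp only: Suc invariant)
qed

lemma integrable_birkhoff_max:
  assumes "integrable M f"
  shows "integrable M (birkhoff_max T f n)"
proof (induction n)
  case (Suc n)
  have "integrable M (\<lambda>x. max 0 (f x + birkhoff_max T f n (T x)))"
    using assms integrable_comp[OF Suc] by (intro integrable_max) auto
  then show ?case by (simp cong: integrable_cong)
qed (simp cong: integrable_cong)

text \<open>Where the running maxima \<open>m\<^sub>n\<close> diverge, \<open>m\<^bsub>n+1\<^esub> - m\<^sub>n \<circ> T\<close> is eventually equal to \<open>f\<close>; its integral is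
  nonnegative because \<open>T\<close> preserves the measure.\<close>
lemma integral_nonneg_if_birkhoff_max_unbounded:
  assumes integrable_f: "integrable M f"
    and unbounded: "AE x in M. \<not> bdd_above (range (\<lambda>n. birkhoff_max T f n x))"
  shows "0 \<le> (\<integral>x. f x \<partial>M)"
proof -
  let ?m = "birkhoff_max T f"
  define D where "D n x = ?m (Suc n) x - ?m n (T x)" for n x
  have D_eq: "D n x = max (- ?m n (T x)) (f x)" for n x
    by (auto simp: D_def max_def)
  note int = integrable_birkhoff_max[OF integrable_f]
  note [measurable] = borel_measurable_integrable[OF integrable_f] borel_measurable_integrable[OF int]
  have "(\<lambda>n. \<integral>x. D n x \<partial>M) \<longlonglongrightarrow> (\<integral>x. f x \<partial>M)"
  proof (rule integral_dominated_convergence[where w="\<lambda>x. \<bar>f x\<bar>"])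
    show "AE x in M. (\<lambda>n. D n x) \<longlonglongrightarrow> f x"
      using unbounded
    proof eventually_elim
      case (elim x)
      then have "\<not> bdd_above (range (\<lambda>n. ?m n (T x)))" by (simp add: bdd_above_birkhoff_max_comp)
      then obtain N where "?m N (T x) > - f x" by (metis bdd_aboveI2 not_le)
      then have "D n x = f x" if "n \<ge> N" for n
        using monoD[OF birkhoff_max_mono[of T f "T x"] that] by (simp add: D_eq)
      then show ?case by (intro tendsto_eventually) (auto simp: eventually_sequentially)
    qed
    have "norm (D n x) \<le> \<bar>f x\<bar>" for n x
      using birkhoff_max_nonneg[of T f n "T x"] unfolding D_eq by auto
    then show "AE x in M. norm (D n x) \<le> \<bar>f x\<bar>" for n by simp
  qed (use integrable_f in \<open>auto simp: D_def\<close>)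
  moreover have "(\<integral>x. D n x \<partial>M) \<ge> 0" for n
  proof -
    have "(\<integral>x. ?m n x \<partial>M) \<le> (\<integral>x. ?m (Suc n) x \<partial>M)"
      using monoD[OF birkhoff_max_mono, of n "Suc n"] by (intro integral_mono int) simp
    moreover have "(\<integral>x. D n x \<partial>M) = (\<integral>x. ?m (Suc n) x \<partial>M) - (\<integral>x. ?m n (T x) \<partial>M)"
      unfolding D_def by (rule Bochner_Integration.integral_diff[OF int integrable_comp[OF int]])
    moreover have "(\<integral>x. ?m n (T x) \<partial>M) = (\<integral>x. ?m n x \<partial>M)"
      by (rule integral_comp[OF borel_measurable_integrable[OF int]])
    ultimately show ?thesis by linarith
  qed
  ultimately show ?thesis by (auto intro: LIMSEQ_le_const)
qed

lemma birkhoff_sum_bdd_above: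
  assumes integrable_f: "integrable M f" and neg: "(\<integral>x. f x \<partial>M) < 0"
  shows "AE x in M. bdd_above (range (\<lambda>n. birkhoff_sum T f n x))"
proof -
  define A where "A = {x \<in> space M. \<not> bdd_above (range (\<lambda>n. birkhoff_max T f n x))}"
  note [measurable] = borel_measurable_integrable[OF integrable_birkhoff_max[OF integrable_f]]
  have "bdd_above (range (\<lambda>n. birkhoff_max T f n x)) \<longleftrightarrow> (\<exists>B::nat. \<forall>n. birkhoff_max T f n x \<le> real B)" for x
    unfolding bdd_above_def by (auto, meson order_trans real_arch_simple)
  then have A_event: "A \<in> events" unfolding A_def by simp
  have "T -` A \<inter> space M = A"
    using measurable_space[OF measurable_T] by (auto simp: A_def bdd_above_birkhoff_max_comp)
  with A_event have "prob A = 0 \<or> prob A = 1" by (rule zero_one)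
  moreover have "prob A \<noteq> 1"
  proof
    assume "prob A = 1"
    then have "AE x in M. \<not> bdd_above (range (\<lambda>n. birkhoff_max T f n x))"
      using AE_in_set_eq_1[OF A_event] by (auto simp: A_def)
    then show False using integral_nonneg_if_birkhoff_max_unbounded[OF integrable_f] neg by simp
  qed
  ultimately have "AE x in M. x \<notin> A" using prob_eq_0[OF A_event] by simp
  then show ?thesis
    using AE_space
  proof eventually_elim
    case (elim x)
    then obtain B where "birkhoff_max T f n x \<le> B" for n unfolding A_def bdd_above_def by auto
    then show ?case
      by (intro bdd_aboveI2[of _ _ B] order_trans[OF birkhoff_sum_le_birkhoff_max])
  qed
qed

lemma birkhoff_average_eventually_less:
  assumes integrable_f: "integrable M f"
  shows "AE x in M. \<forall>a>(\<integral>x. f x \<partial>M). \<forall>\<^sub>F n in sequentially. birkhoff_sum T f n x / real n < a"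
proof -
  define c where "c m = (\<integral>x. f x \<partial>M) + 1 / real (Suc m)" for m
  have "AE x in M. bdd_above (range (\<lambda>n. birkhoff_sum T (\<lambda>x. f x - c m) n x))" for m
    by (rule birkhoff_sum_bdd_above) (use integrable_f in \<open>auto simp: c_def prob_space field_simps\<close>)
  then have "AE x in M. \<forall>m. bdd_above (range (\<lambda>n. birkhoff_sum T (\<lambda>x. f x - c m) n x))"
    by (simp add: AE_all_countable)
  then show ?thesis
  proof (eventually_elim, intro allI impI)
    fix x a assume bdd: "\<forall>m. bdd_above (range (\<lambda>n. birkhoff_sum T (\<lambda>x. f x - c m) n x))"
      and a_gt: "a > (\<integral>x. f x \<partial>M)"
    obtain m where "1 / real (Suc m) < a - (\<integral>x. f x \<partial>M)" using nat_approx_posE[of "a - _"] a_gt by auto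
    then have "c m < a" by (simp add: c_def)
    obtain B where sum_bound: "birkhoff_sum T (\<lambda>x. f x - c m) n x \<le> B" for n
      using bdd by (auto simp: bdd_above_def)
    have "(\<lambda>n. B / real n + c m) \<longlonglongrightarrow> 0 + c m"
      by (intro tendsto_add tendsto_const lim_const_over_n)
    then have "\<forall>\<^sub>F n in sequentially. B / real n + c m < a"
      using \<open>c m < a\<close> by (intro order_tendstoD) auto
    then show "\<forall>\<^sub>F n in sequentially. birkhoff_sum T f n x / real n < a"
      using eventually_gt_at_top[of 0]
    proof eventually_elim
      case (elim n)
      have "birkhoff_sum T f n x \<le> B + real n * c m"
        using sum_bound[of n] by (simp add: birkhoff_sum_def sum_subtractf)
      then have "birkhoff_sum T f n x / real n \<le> B / real n + c m"
        using elim(2) by (simp add: field_simps)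
      then show ?case using elim(1) by simp
    qed
  qed
qed

theorem birkhoff_average_tendsto:
  assumes integrable_f: "integrable M f"
  shows "AE x in M. (\<lambda>n. birkhoff_sum T f n x / real n) \<longlonglongrightarrow> (\<integral>x. f x \<partial>M)"
proof -
  have neg: "birkhoff_sum T (\<lambda>x. - f x) n x = - birkhoff_sum T f n x" for n x
    by (simp add: birkhoff_sum_def sum_negf)
  have "integrable M (\<lambda>x. - f x)" using integrable_f by simp
  from birkhoff_average_eventually_less[OF integrable_f] birkhoff_average_eventually_less[OF this]
  show ?thesis
  proof eventually_elim
    case (elim x)
    show ?case
    proof (rule order_tendstoI)
      fix a assume "a < (\<integral>x. f x \<partial>M)"
      then show "\<forall>\<^sub>F n in sequentially. a < birkhoff_sum T f n x / real n"
        using elim(2)[rule_format, of "- a"] by (simp add: neg)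
    next
      fix a assume "(\<integral>x. f x \<partial>M) < a"
      then show "\<forall>\<^sub>F n in sequentially. birkhoff_sum T f n x / real n < a" using elim(1) by blast
    qed
  qed
qed

end

section \<open>Moments and convergence in probability\<close>

definition finite_moment :: "'a measure \<Rightarrow> nat \<Rightarrow> ('a \<Rightarrow> real) \<Rightarrow> bool" where
  "finite_moment M k f \<longleftrightarrow> f \<in> borel_measurable M \<and> integrable M (\<lambda>x. \<bar>f x\<bar> ^ k)"

lemma finite_moment_measurable: "finite_moment M k f \<Longrightarrow> f \<in> borel_measurable M"
  by (simp add: finite_moment_def)

lemma finite_moment_1_iff: "finite_moment M 1 f \<longleftrightarrow> integrable M f"
  by (auto simp: finite_moment_def integrable_abs_iff)

lemma finite_moment_2_iff: "finite_moment M 2 f \<longleftrightarrow> f \<in> borel_measurable M \<and> integrable M (\<lambda>x. (f x)\<^sup>2)"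
  by (simp add: finite_moment_def)

lemma finite_moment_bound:
  assumes "f \<in> borel_measurable M" "integrable M h" "\<And>x. \<bar>f x\<bar> ^ k \<le> h x"
  shows "finite_moment M k f"
  unfolding finite_moment_def
proof (intro conjI assms(1) Bochner_Integration.integrable_bound[OF assms(2)])
  show "AE x in M. norm (\<bar>f x\<bar> ^ k) \<le> norm (h x)"
    using assms(3) by (auto intro: order_trans[OF _ abs_ge_self])
qed (use assms(1) in measurable)

lemma finite_moment_add:
  assumes "finite_moment M k f" "finite_moment M k g"
  shows "finite_moment M k (\<lambda>x. f x + g x)"
proof (rule finite_moment_bound)
  show "integrable M (\<lambda>x. 2 ^ k * (\<bar>f x\<bar> ^ k + \<bar>g x\<bar> ^ k))" using assms by (simp add: finite_moment_def)
  show "\<bar>f x + g x\<bar> ^ k \<le> 2 ^ k * (\<bar>f x\<bar> ^ k + \<bar>g x\<bar> ^ k)" for x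
  proof -
    have "\<bar>f x + g x\<bar> ^ k \<le> (2 * max \<bar>f x\<bar> \<bar>g x\<bar>) ^ k" by (intro power_mono) auto
    also have "\<dots> \<le> 2 ^ k * (\<bar>f x\<bar> ^ k + \<bar>g x\<bar> ^ k)"
      by (auto simp: power_mult_distrib max_def)
    finally show ?thesis .
  qed
qed (use assms in \<open>auto simp: finite_moment_def\<close>)

lemma finite_moment_mult:
  assumes "finite_moment M (2 * k) f" "finite_moment M (2 * k) g"
  shows "finite_moment M k (\<lambda>x. f x * g x)"
proof (rule finite_moment_bound)
  show "integrable M (\<lambda>x. \<bar>f x\<bar> ^ (2 * k) + \<bar>g x\<bar> ^ (2 * k))" using assms by (simp add: finite_moment_def)
  show "\<bar>f x * g x\<bar> ^ k \<le> \<bar>f x\<bar> ^ (2 * k) + \<bar>g x\<bar> ^ (2 * k)" for x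
  proof -
    have "\<bar>f x * g x\<bar> ^ k \<le> 2 * (\<bar>f x\<bar> ^ k * \<bar>g x\<bar> ^ k)" by (simp add: abs_mult power_mult_distrib)
    also have "\<dots> \<le> \<bar>f x\<bar> ^ (2 * k) + \<bar>g x\<bar> ^ (2 * k)"
      using sum_squares_bound[of "\<bar>f x\<bar> ^ k" "\<bar>g x\<bar> ^ k"]
      by (simp add: mult.assoc mult.commute[of k] del: power_even_abs flip: power_mult)
    finally show ?thesis .
  qed
qed (use assms in \<open>auto simp: finite_moment_def\<close>)

lemma finite_moment_cmult: "finite_moment M k f \<Longrightarrow> finite_moment M k (\<lambda>x. c * f x)"
  by (auto simp: finite_moment_def abs_mult power_mult_distrib)

lemma finite_moment_diff:
  "finite_moment M k f \<Longrightarrow> finite_moment M k g \<Longrightarrow> finite_moment M k (\<lambda>x. f x - g x)"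
  using finite_moment_add[of M k f "\<lambda>x. -1 * g x"] finite_moment_cmult[of M k g "-1"] by simp

lemma (in finite_measure) finite_moment_const: "finite_moment M k (\<lambda>x. c)"
  by (simp add: finite_moment_def)

lemma (in finite_measure) finite_moment_sum:
  "(\<And>i. i \<in> I \<Longrightarrow> finite_moment M k (f i)) \<Longrightarrow> finite_moment M k (\<lambda>x. \<Sum>i\<in>I. f i x)"
  by (induction I rule: infinite_finite_induct) (simp_all add: finite_moment_add finite_moment_const)

context prob_space
begin

definition eventually_except :: "real \<Rightarrow> (nat \<Rightarrow> 'a \<Rightarrow> bool) \<Rightarrow> bool" where
  "eventually_except e P \<longleftrightarrow>
    (\<forall>\<^sub>F n in sequentially. \<exists>E\<in>events. prob E < e \<and> (\<forall>x\<in>space M - E. P n x))"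

definition with_high_prob :: "(nat \<Rightarrow> 'a \<Rightarrow> bool) \<Rightarrow> bool" where
  "with_high_prob P \<longleftrightarrow> (\<forall>e>0. eventually_except e P)"

definition tendsto_in_prob :: "(nat \<Rightarrow> 'a \<Rightarrow> real) \<Rightarrow> real \<Rightarrow> bool" where
  "tendsto_in_prob X c \<longleftrightarrow> (\<forall>d>0. with_high_prob (\<lambda>n x. \<bar>X n x - c\<bar> \<le> d))"

definition bounded_in_prob :: "(nat \<Rightarrow> 'a \<Rightarrow> real) \<Rightarrow> bool" where
  "bounded_in_prob X \<longleftrightarrow> (\<forall>e>0. \<exists>R. eventually_except e (\<lambda>n x. \<bar>X n x\<bar> \<le> R))"

lemma eventually_except_mono:
  assumes "eventually_except e P" "\<forall>\<^sub>F n in sequentially. \<forall>x\<in>space M. P n x \<longrightarrow> Q n x"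
  shows "eventually_except e Q"
  using assms unfolding eventually_except_def by eventually_elim blast

lemma eventually_except_if_always:
  assumes "e > 0" "\<And>n x. x \<in> space M \<Longrightarrow> P n x"
  shows "eventually_except e P"
  unfolding eventually_except_def using assms by (intro always_eventually allI bexI[of _ "{}"]) auto

lemma eventually_except_if_prob_tendsto_zero:
  assumes "\<And>n. {x \<in> space M. \<not> P n x} \<in> events" "(\<lambda>n. prob {x \<in> space M. \<not> P n x}) \<longlonglongrightarrow> 0" "e > 0"
  shows "eventually_except e P"
  unfolding eventually_except_def using order_tendstoD(2)[OF assms(2,3)]
proof eventually_elim
  case (elim n)
  then show ?case using assms(1) by (intro bexI[of _ "{x \<in> space M. \<not> P n x}"]) auto
qed

lemma eventually_except_ball_finite:
  assumes "finite I" "e > 0" and each: "\<And>i. i \<in> I \<Longrightarrow> eventually_except (e / real (card I)) (P i)"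
  shows "eventually_except e (\<lambda>n x. \<forall>i\<in>I. P i n x)"
proof -
  have "\<forall>\<^sub>F n in sequentially. \<forall>i\<in>I. \<exists>E\<in>events. prob E < e / real (card I) \<and> (\<forall>x\<in>space M - E. P i n x)"
    using assms(1) each unfolding eventually_except_def by (intro eventually_ball_finite) auto
  then show ?thesis
    unfolding eventually_except_def
  proof eventually_elim
    case (elim n)
    then obtain E where exceptional: "\<And>i. i \<in> I \<Longrightarrow> E i \<in> events" "\<And>i. i \<in> I \<Longrightarrow> prob (E i) < e / real (card I)"
      "\<And>i x. i \<in> I \<Longrightarrow> x \<in> space M - E i \<Longrightarrow> P i n x" by metis
    have "prob (\<Union>i\<in>I. E i) < e"
    proof (cases "I = {}")
      case False
      have "prob (\<Union>i\<in>I. E i) \<le> (\<Sum>i\<in>I. prob (E i))"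
        using exceptional(1) assms(1) by (intro measure_UNION_le) auto
      also have "\<dots> < (\<Sum>i\<in>I. e / real (card I))"
        using False assms(1) exceptional(2) by (intro sum_strict_mono) auto
      also have "\<dots> = e" using False assms(1) by simp
      finally show ?thesis .
    qed (use assms(2) in simp)
    then show ?case
      using exceptional assms(1) by (intro bexI[of _ "\<Union>i\<in>I. E i"]) auto
  qed
qed

lemma eventually_except_conj:
  assumes "eventually_except (e / 2) P" "eventually_except (e / 2) Q"
  shows "eventually_except e (\<lambda>n x. P n x \<and> Q n x)"
  using assms unfolding eventually_except_def
proof eventually_elim
  case (elim n)
  then obtain E F where E_exceptional: "E \<in> events" "prob E < e / 2" "\<forall>x\<in>space M - E. P n x"
    and F_exceptional: "F \<in> events" "prob F < e / 2" "\<forall>x\<in>space M - F. Q n x" by blast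
  have "prob (E \<union> F) \<le> prob E + prob F" using E_exceptional F_exceptional by (intro measure_Un_le)
  then show ?case using E_exceptional F_exceptional by (intro bexI[of _ "E \<union> F"]) auto
qed

lemma with_high_prob_mono:
  assumes "with_high_prob P" "\<forall>\<^sub>F n in sequentially. \<forall>x\<in>space M. P n x \<longrightarrow> Q n x"
  shows "with_high_prob Q"
  using assms eventually_except_mono unfolding with_high_prob_def by blast

lemma with_high_prob_conj:
  assumes "with_high_prob P" "with_high_prob Q"
  shows "with_high_prob (\<lambda>n x. P n x \<and> Q n x)"
  using assms eventually_except_conj unfolding with_high_prob_def by simp

lemma prob_tendsto_one_if_with_high_prob:
  assumes likely: "with_high_prob P" and meas: "\<And>n. {x \<in> space M. P n x} \<in> events"
  shows "(\<lambda>n. prob {x \<in> space M. P n x}) \<longlonglongrightarrow> 1"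
proof (rule tendstoI)
  fix e :: real assume "e > 0"
  then have "eventually_except e P" using likely by (simp add: with_high_prob_def)
  then show "\<forall>\<^sub>F n in sequentially. dist (prob {x \<in> space M. P n x}) 1 < e"
    unfolding eventually_except_def
  proof eventually_elim
    case (elim n)
    then obtain E where exceptional: "E \<in> events" "prob E < e" "\<forall>x\<in>space M - E. P n x" by blast
    have "prob (space M - E) \<le> prob {x \<in> space M. P n x}"
      using exceptional meas by (intro finite_measure_mono) auto
    then show ?case using exceptional prob_compl[OF exceptional(1)] prob_le_1 by (simp add: dist_real_def)
  qed
qed

lemma tendsto_in_prob_add:
  assumes "tendsto_in_prob X a" "tendsto_in_prob Y b"
  shows "tendsto_in_prob (\<lambda>n x. X n x + Y n x) (a + b)"
  unfolding tendsto_in_prob_def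
proof (intro allI impI)
  fix d :: real assume "d > 0"
  then have "with_high_prob (\<lambda>n x. \<bar>X n x - a\<bar> \<le> d / 2 \<and> \<bar>Y n x - b\<bar> \<le> d / 2)"
    using assms unfolding tendsto_in_prob_def by (intro with_high_prob_conj) (meson half_gt_zero)+
  then show "with_high_prob (\<lambda>n x. \<bar>X n x + Y n x - (a + b)\<bar> \<le> d)"
    by (rule with_high_prob_mono) (intro always_eventually allI ballI impI, linarith)
qed

lemma tendsto_in_prob_const: "tendsto_in_prob (\<lambda>n x. c) c"
  by (simp add: tendsto_in_prob_def with_high_prob_def eventually_except_if_always)

lemma tendsto_in_prob_sum:
  assumes "\<And>i. i \<in> I \<Longrightarrow> tendsto_in_prob (X i) (a i)"
  shows "tendsto_in_prob (\<lambda>n x. \<Sum>i\<in>I. X i n x) (\<Sum>i\<in>I. a i)"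
  using assms
  by (induction I rule: infinite_finite_induct) (simp_all add: tendsto_in_prob_add tendsto_in_prob_const)

lemma bounded_in_prob_const: "bounded_in_prob (\<lambda>n x. c)"
  unfolding bounded_in_prob_def by (auto intro!: exI[of _ "\<bar>c\<bar>"] eventually_except_if_always)

lemma tendsto_in_prob_zero_mult_bounded:
  assumes X_tendsto: "tendsto_in_prob X 0" and Y_bounded: "bounded_in_prob Y"
  shows "tendsto_in_prob (\<lambda>n x. X n x * Y n x) 0"
  unfolding tendsto_in_prob_def with_high_prob_def
proof (intro allI impI)
  fix d e :: real assume pos: "d > 0" "e > 0"
  then obtain R where Y_le_R: "eventually_except (e / 2) (\<lambda>n x. \<bar>Y n x\<bar> \<le> R)"
    using Y_bounded unfolding bounded_in_prob_def by (meson half_gt_zero)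
  define \<delta> where "\<delta> = d / (\<bar>R\<bar> + 1)"
  have "\<delta> > 0" using pos by (simp add: \<delta>_def)
  then have "eventually_except (e / 2) (\<lambda>n x. \<bar>X n x\<bar> \<le> \<delta>)"
    using X_tendsto pos by (simp add: tendsto_in_prob_def with_high_prob_def)
  from eventually_except_conj[OF this Y_le_R]
  show "eventually_except e (\<lambda>n x. \<bar>X n x * Y n x - 0\<bar> \<le> d)"
  proof (rule eventually_except_mono, intro always_eventually allI ballI impI, elim conjE)
    fix n x assume "\<bar>X n x\<bar> \<le> \<delta>" "\<bar>Y n x\<bar> \<le> R"
    then have "\<bar>X n x\<bar> * \<bar>Y n x\<bar> \<le> \<delta> * (\<bar>R\<bar> + 1)" using \<open>\<delta> > 0\<close> by (intro mult_mono) auto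
    then show "\<bar>X n x * Y n x - 0\<bar> \<le> d" by (simp add: \<delta>_def abs_mult)
  qed
qed

lemma tendsto_in_prob_cmult_zero:
  assumes "tendsto_in_prob X 0"
  shows "tendsto_in_prob (\<lambda>n x. c * X n x) 0"
  using tendsto_in_prob_zero_mult_bounded[OF assms bounded_in_prob_const, of c] by (simp add: mult.commute)

lemma tendsto_in_prob_if_AE_tendsto:
  assumes [measurable]: "\<And>n. X n \<in> borel_measurable M" and lim: "AE x in M. (\<lambda>n. X n x) \<longlonglongrightarrow> c"
  shows "tendsto_in_prob X c"
  unfolding tendsto_in_prob_def with_high_prob_def
proof (intro allI impI eventually_except_if_prob_tendsto_zero)
  fix d :: real assume d_pos: "d > 0"
  let ?E = "\<lambda>n. {x \<in> space M. \<not> \<bar>X n x - c\<bar> \<le> d}"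
  have "(\<lambda>n. expectation (indicator (?E n))) \<longlonglongrightarrow> expectation (\<lambda>x. 0 :: real)"
  proof (rule integral_dominated_convergence[where w="\<lambda>x. 1"])
    show "AE x in M. (\<lambda>n. indicator (?E n) x :: real) \<longlonglongrightarrow> 0"
      using lim
    proof eventually_elim
      case (elim x)
      have "\<forall>\<^sub>F n in sequentially. indicator (?E n) x = (0::real)"
        using tendstoD[OF elim d_pos] by eventually_elim (auto simp: dist_real_def indicator_def)
      then show ?case by (rule tendsto_eventually)
    qed
  qed (auto simp: indicator_def)
  then show "(\<lambda>n. prob (?E n)) \<longlonglongrightarrow> 0" by simp
qed auto

lemma tendsto_in_prob_zero_if_expectation_tendsto_zero:
  assumes integrable_X: "\<And>n. integrable M (X n)" and nonneg: "\<And>n x. 0 \<le> X n x"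
    and lim: "(\<lambda>n. expectation (X n)) \<longlonglongrightarrow> 0"
  shows "tendsto_in_prob X 0"
  unfolding tendsto_in_prob_def with_high_prob_def
proof (intro allI impI eventually_except_if_prob_tendsto_zero)
  fix d :: real assume d_pos: "d > 0"
  note [measurable] = borel_measurable_integrable[OF integrable_X]
  show "{x \<in> space M. \<not> \<bar>X n x - 0\<bar> \<le> d} \<in> events" for n by measurable
  have markov: "prob {x \<in> space M. \<not> \<bar>X n x - 0\<bar> \<le> d} \<le> expectation (X n) / d" for n
  proof -
    have "prob {x \<in> space M. \<not> \<bar>X n x - 0\<bar> \<le> d} \<le> prob {x \<in> space M. X n x \<ge> d}"
      using nonneg by (intro finite_measure_mono) auto
    also have "\<dots> \<le> expectation (X n) / d"
      using nonneg d_pos by (intro integral_Markov_inequality_measure[OF integrable_X, of "{}"]) auto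
    finally show ?thesis .
  qed
  have "(\<lambda>n. expectation (X n) / d) \<longlonglongrightarrow> 0"
    using tendsto_divide[OF lim tendsto_const[of d]] d_pos by simp
  then show "(\<lambda>n. prob {x \<in> space M. \<not> \<bar>X n x - 0\<bar> \<le> d}) \<longlonglongrightarrow> 0"
    by (rule Lim_null_comparison[rotated]) (use markov in simp)
qed

lemma norm_expectation_le_off_event:
  fixes f :: "'a \<Rightarrow> 'b::{banach, second_countable_topology}"
  assumes f_measurable: "f \<in> borel_measurable M" and E_event: "E \<in> events"
    and small: "\<And>x. x \<in> space M - E \<Longrightarrow> norm (f x) \<le> e" and bounded: "\<And>x. x \<in> space M \<Longrightarrow> norm (f x) \<le> C" and "0 \<le> e"
  shows "norm (expectation f) \<le> e + C * prob E"
proof -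
  have "integrable M f" by (rule integrable_const_bound[of _ C]) (use f_measurable bounded in auto)
  have "norm (expectation f) \<le> expectation (\<lambda>x. norm (f x))" by (rule integral_norm_bound)
  also have "\<dots> \<le> expectation (\<lambda>x. e + C * indicator E x)"
  proof (rule integral_mono)
    show "norm (f x) \<le> e + C * indicator E x" if "x \<in> space M" for x
      using that small[of x] bounded[of x] \<open>0 \<le> e\<close> by (auto simp: indicator_def)
  qed (use \<open>integrable M f\<close> E_event in \<open>auto simp: emeasure_eq_measure\<close>)
  also have "\<dots> = e + C * prob E"
    using E_event by (subst Bochner_Integration.integral_add) (auto simp: prob_space emeasure_eq_measure)
  finally show ?thesis .
qed

lemma expectation_tendsto_zero_if_tendsto_in_prob:
  fixes f :: "nat \<Rightarrow> 'a \<Rightarrow> 'b::{banach, second_countable_topology}"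
  assumes meas: "\<And>n. f n \<in> borel_measurable M" and bounded: "\<And>n x. norm (f n x) \<le> C"
    and lim: "tendsto_in_prob (\<lambda>n x. norm (f n x)) 0"
  shows "(\<lambda>n. expectation (f n)) \<longlonglongrightarrow> 0"
proof (rule tendstoI)
  fix e :: real assume e_pos: "e > 0"
  have C_nonneg: "C \<ge> 0" using bounded[of 0 undefined] norm_ge_zero order_trans by blast
  define \<delta> where "\<delta> = e / (2 * (C + 1))"
  have \<delta>_pos: "\<delta> > 0" using e_pos C_nonneg by (simp add: \<delta>_def)
  then have "eventually_except \<delta> (\<lambda>n x. \<bar>norm (f n x) - 0\<bar> \<le> e / 2)"
    using lim e_pos unfolding tendsto_in_prob_def with_high_prob_def by (meson half_gt_zero)
  then show "\<forall>\<^sub>F n in sequentially. dist (expectation (f n)) 0 < e"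
    unfolding eventually_except_def
  proof eventually_elim
    case (elim n)
    then obtain E where exceptional: "E \<in> events" "prob E < \<delta>" "\<forall>x\<in>space M - E. norm (f n x) \<le> e / 2" by auto
    have "norm (expectation (f n)) \<le> e / 2 + C * prob E"
      using exceptional e_pos bounded by (intro norm_expectation_le_off_event meas) auto
    also have "\<dots> \<le> e / 2 + C * \<delta>" using exceptional C_nonneg by (intro add_left_mono mult_left_mono) auto
    also have "\<dots> < e / 2 + (C + 1) * \<delta>" using \<delta>_pos by simp
    also have "(C + 1) * \<delta> = e / 2" using C_nonneg by (simp add: \<delta>_def field_simps)
    finally show ?case by simp
  qed
qed

end

lemma cmod_cis_diff_le: "cmod (cis a - cis b) \<le> \<bar>a - b\<bar>"
proof -
  have "cis a - cis b = cis b * (cis (a - b) - 1)"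
    by (simp add: right_diff_distrib cis_mult)
  then have "cmod (cis a - cis b) = cmod (cis (a - b) - 1)" by (simp add: norm_mult)
  also have "\<dots> \<le> \<bar>a - b\<bar>"
    using iexp_approx1[of "a - b" 0] by (simp add: cis_conv_exp)
  finally show ?thesis .
qed

lemma borel_measurable_cis[measurable]: "cis \<in> borel_measurable borel"
  by (simp add: cis_conv_exp[abs_def])

lemma (in prob_space) integrable_cis:
  assumes [measurable]: "X \<in> borel_measurable M"
  shows "integrable M (\<lambda>x. cis (X x))"
  by (rule integrable_const_bound[of _ 1]) simp_all

lemma (in prob_space) char_tendsto_if_diff_tendsto_in_prob:
  assumes [measurable]: "\<And>n. X n \<in> borel_measurable M" "\<And>n. Y n \<in> borel_measurable M"
    and diff: "tendsto_in_prob (\<lambda>n x. X n x - Y n x) 0"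
    and char_Y: "(\<lambda>n. expectation (\<lambda>x. cis (Y n x))) \<longlonglongrightarrow> c"
  shows "(\<lambda>n. expectation (\<lambda>x. cis (X n x))) \<longlonglongrightarrow> c"
proof -
  have "(\<lambda>n. expectation (\<lambda>x. cis (X n x) - cis (Y n x))) \<longlonglongrightarrow> 0"
  proof (rule expectation_tendsto_zero_if_tendsto_in_prob)
    show "norm (cis (X n x) - cis (Y n x)) \<le> 2" for n x
      using norm_triangle_ineq4[of "cis (X n x)" "cis (Y n x)"] by simp
    show "tendsto_in_prob (\<lambda>n x. norm (cis (X n x) - cis (Y n x))) 0"
      unfolding tendsto_in_prob_def
    proof (intro allI impI)
      fix d :: real assume "d > 0"
      then have "with_high_prob (\<lambda>n x. \<bar>X n x - Y n x - 0\<bar> \<le> d)"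
        using diff by (simp add: tendsto_in_prob_def)
      then show "with_high_prob (\<lambda>n x. \<bar>cmod (cis (X n x) - cis (Y n x)) - 0\<bar> \<le> d)"
        by (rule with_high_prob_mono) (auto intro!: always_eventually order_trans[OF cmod_cis_diff_le])
    qed
  qed measurable
  from tendsto_add[OF this char_Y] show ?thesis by (simp add: integrable_cis)
qed

section \<open>A central limit theorem for martingale differences\<close>

lemma const_over_sqrt_tendsto: "(\<lambda>n. c / sqrt (real n)) \<longlonglongrightarrow> 0"
  by (intro tendsto_divide_0[OF tendsto_const] filterlim_at_top_imp_at_infinity
      filterlim_compose[OF sqrt_at_top] filterlim_real_sequentially)

definition trunc_sq :: "real \<Rightarrow> real" where "trunc_sq x = min (x\<^sup>2) 1"

definition cub_sq :: "real \<Rightarrow> real" where "cub_sq x = min (\<bar>x\<bar> ^ 3) (x\<^sup>2)"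

definition compensated_exp :: "real \<Rightarrow> complex" where
  "compensated_exp x = cis x * of_real (exp (trunc_sq x / 2))"

lemma trunc_sq_measurable[measurable]: "trunc_sq \<in> borel_measurable borel"
  unfolding trunc_sq_def by measurable

lemma cub_sq_measurable[measurable]: "cub_sq \<in> borel_measurable borel"
  unfolding cub_sq_def by measurable

lemma compensated_exp_measurable[measurable]: "compensated_exp \<in> borel_measurable borel"
  unfolding compensated_exp_def by measurable

lemma trunc_sq_bounds: "0 \<le> trunc_sq x" "trunc_sq x \<le> 1" "trunc_sq 0 = 0"
  by (auto simp: trunc_sq_def)

lemma cub_sq_bounds: "0 \<le> cub_sq x" "cub_sq x \<le> x\<^sup>2" "cub_sq x \<le> \<bar>x\<bar> ^ 3" "cub_sq 0 = 0"
  by (auto simp: cub_sq_def)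

lemma cmod_compensated_exp: "cmod (compensated_exp x) = exp (trunc_sq x / 2)"
  by (simp add: compensated_exp_def norm_mult)

lemma exp_quadratic_taylor_remainder:
  fixes x :: real
  assumes "\<bar>x\<bar> \<le> 1"
  defines "z \<equiv> \<i> * of_real x + of_real (x\<^sup>2 / 2)"
  shows "cmod (exp z - (\<Sum>k\<le>2. z ^ k / fact k)) \<le> 3 * \<bar>x\<bar> ^ 3"
proof -
  have square_le: "x\<^sup>2 \<le> \<bar>x\<bar>" "x\<^sup>2 \<le> 1"
    using assms(1) power_decreasing[of 1 2 "\<bar>x\<bar>"] by (auto simp: abs_square_le_1)
  have "cmod z \<le> \<bar>x\<bar> + x\<^sup>2 / 2"
    unfolding z_def by (rule order_trans[OF norm_triangle_ineq]) (simp add: norm_mult norm_divide norm_power)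
  then have "cmod z \<le> 3 / 2 * \<bar>x\<bar>" using square_le by simp
  then have "cmod z ^ 3 \<le> (3 / 2 * \<bar>x\<bar>) ^ 3" by (intro power_mono) auto
  moreover have "exp \<bar>Re z\<bar> \<le> 7 / 4"
  proof -
    have "exp \<bar>Re z\<bar> \<le> exp (1 / 2)" using square_le by (simp add: z_def)
    also have "\<dots> \<le> 7 / 4" using exp_bound[of "1/2"] by (simp add: power2_eq_square)
    finally show ?thesis .
  qed
  ultimately have "exp \<bar>Re z\<bar> * cmod z ^ 3 \<le> 7 / 4 * (3 / 2 * \<bar>x\<bar>) ^ 3" by (intro mult_mono) auto
  then have "exp \<bar>Re z\<bar> * cmod z ^ Suc 2 / fact 2 \<le> 189 / 64 * \<bar>x\<bar> ^ 3"
    by (simp add: power_mult_distrib power_divide del: power_Suc)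
  also have "\<dots> \<le> 3 * \<bar>x\<bar> ^ 3" by (intro mult_right_mono) auto
  finally show ?thesis by (rule order_trans[OF Taylor_exp])
qed

lemma compensated_exp_remainder_small:
  assumes "\<bar>x\<bar> \<le> 1"
  shows "cmod (compensated_exp x - 1 - \<i> * of_real x) \<le> 4 * \<bar>x\<bar> ^ 3"
proof -
  define z :: complex where "z = \<i> * of_real x + of_real (x\<^sup>2 / 2)"
  have "exp z = cis x * exp (of_real (x\<^sup>2 / 2))" by (simp only: z_def exp_add cis_conv_exp)
  moreover have "x\<^sup>2 \<le> 1" using assms by (simp add: abs_square_le_1)
  ultimately have exp_z: "compensated_exp x = exp z"
    by (simp add: compensated_exp_def trunc_sq_def exp_of_real del: of_real_divide of_real_power)
  have z_square: "z\<^sup>2 = - of_real (x\<^sup>2) + \<i> * of_real (x ^ 3) + of_real (x ^ 4 / 4)"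
    by (simp add: z_def power2_eq_square power3_eq_cube power4_eq_xxxx field_simps)
  have "(\<Sum>k\<le>2. z ^ k / fact k) = 1 + z + z\<^sup>2 / 2"
    by (simp add: numeral_2_eq_2)
  then have poly: "(\<Sum>k\<le>2. z ^ k / fact k) - 1 - \<i> * of_real x = \<i> * of_real (x ^ 3 / 2) + of_real (x ^ 4 / 8)"
    unfolding z_square by (simp add: z_def add_divide_distrib diff_divide_distrib)
  have "compensated_exp x - 1 - \<i> * of_real x
      = (exp z - (\<Sum>k\<le>2. z ^ k / fact k)) + (\<i> * of_real (x ^ 3 / 2) + of_real (x ^ 4 / 8))"
    unfolding poly[symmetric] exp_z by simp
  also have "cmod \<dots> \<le> 3 * \<bar>x\<bar> ^ 3 + (\<bar>x\<bar> ^ 3 / 2 + x ^ 4 / 8)"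
    by (intro norm_triangle_mono exp_quadratic_taylor_remainder[OF assms, folded z_def])
       (simp_all only: norm_mult norm_ii norm_of_real, simp_all add: power_abs)
  also have "\<dots> \<le> 4 * \<bar>x\<bar> ^ 3"
  proof -
    have "x ^ 4 \<le> \<bar>x\<bar> ^ 3" using assms power_decreasing[of 3 4 "\<bar>x\<bar>"] by simp
    then show ?thesis using zero_le_power[of "\<bar>x\<bar>" 3] by linarith
  qed
  finally show ?thesis .
qed

lemma compensated_exp_remainder: "cmod (compensated_exp x - 1 - \<i> * of_real x) \<le> 4 * cub_sq x"
proof (cases "\<bar>x\<bar> \<le> 1")
  case True
  then have "cub_sq x = \<bar>x\<bar> ^ 3"
    using power_decreasing[of 2 3 "\<bar>x\<bar>"] by (simp add: cub_sq_def)
  then show ?thesis using compensated_exp_remainder_small[OF True] by simp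
next
  case False
  then have x_large: "\<bar>x\<bar> > 1" "x\<^sup>2 \<ge> \<bar>x\<bar>"
    using power_increasing[of 1 2 "\<bar>x\<bar>"] by auto
  have cub: "cub_sq x = x\<^sup>2"
    using x_large power_increasing[of 2 3 "\<bar>x\<bar>"] by (simp add: cub_sq_def)
  have "cmod (compensated_exp x - 1 - \<i> * of_real x) \<le> cmod (compensated_exp x) + 1 + \<bar>x\<bar>"
    using norm_triangle_ineq4[of "compensated_exp x - 1" "\<i> * of_real x"]
      norm_triangle_ineq4[of "compensated_exp x" 1] by (simp add: norm_mult)
  also have "\<dots> \<le> exp (1 / 2) + 1 + \<bar>x\<bar>" by (simp add: cmod_compensated_exp trunc_sq_bounds)
  also have "\<dots> \<le> 2 + 1 + \<bar>x\<bar>" using exp_bound[of "1/2"] by (simp add: power2_eq_square)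
  also have "\<dots> \<le> 4 * cub_sq x" using x_large cub by linarith
  finally show ?thesis .
qed

lemma (in finite_measure) sigma_finite_subalgebra_if_subalgebra:
  "subalgebra M F \<Longrightarrow> sigma_finite_subalgebra M F"
  by (intro finite_measure_subalgebra_is_sigma_finite finite_measure_subalgebra.intro
      finite_measure_subalgebra_axioms.intro finite_measure_axioms)

locale martingale_difference = prob_space M for M :: "'a measure" +
  fixes F :: "nat \<Rightarrow> 'a measure" and d :: "nat \<Rightarrow> 'a \<Rightarrow> real"
  assumes subalgebra_F: "subalgebra M (F t)"
    and filtration: "sets (F t) \<subseteq> sets (F (Suc t))"
    and adapted: "d t \<in> borel_measurable (F (Suc t))"
    and square_integrable: "integrable M (\<lambda>x. (d t x)\<^sup>2)"
    and cond_exp_zero: "AE x in M. real_cond_exp M (F t) (d t) x = 0"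
begin

lemma measurable_M_if_measurable_F: "g \<in> measurable (F t) N \<Longrightarrow> g \<in> measurable M N"
  by (rule measurable_from_subalg[OF subalgebra_F])

lemma d_measurable_M[measurable]: "d t \<in> borel_measurable M"
  by (rule measurable_M_if_measurable_F[OF adapted])

lemma d_measurable_F:
  assumes "s < t"
  shows "d s \<in> borel_measurable (F t)"
proof -
  have "sets (F (Suc s)) \<subseteq> sets (F t)"
    using assms filtration lift_Suc_mono_le[of "\<lambda>t. sets (F t)" "Suc s" t] by simp
  then have "subalgebra (F t) (F (Suc s))"
    using subalgebra_F by (simp add: subalgebra_def)
  then show ?thesis using adapted by (rule measurable_from_subalg)
qed

lemma d_integrable: "integrable M (d t)"
  by (rule square_integrable_imp_integrable[OF d_measurable_M square_integrable])

lemma expectation_bounded_mult_eq_zero: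
  fixes h :: "'a \<Rightarrow> complex"
  assumes h_measurable: "h \<in> borel_measurable (F t)" and h_bounded: "\<And>x. cmod (h x) \<le> B"
  shows "integrable M (\<lambda>x. h x * of_real (d t x))" "expectation (\<lambda>x. h x * of_real (d t x)) = 0"
proof -
  interpret sigma_finite_subalgebra M "F t" by (rule sigma_finite_subalgebra_if_subalgebra[OF subalgebra_F])
  note [measurable] = h_measurable measurable_M_if_measurable_F[OF h_measurable]
  have B_nonneg: "0 \<le> B" using h_bounded norm_ge_zero order_trans by blast
  show integrable_hd: "integrable M (\<lambda>x. h x * of_real (d t x))"
  proof (rule Bochner_Integration.integrable_bound)
    show "integrable M (\<lambda>x. B * d t x)" using d_integrable by simp
    show "AE x in M. norm (h x * of_real (d t x)) \<le> norm (B * d t x)"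
      using h_bounded B_nonneg by (auto simp: norm_mult abs_mult intro!: mult_right_mono)
  qed simp
  have zero: "expectation (\<lambda>x. g x * d t x) = 0"
    if [measurable]: "g \<in> borel_measurable (F t)" and integrable_gd: "integrable M (\<lambda>x. g x * d t x)"
    for g :: "'a \<Rightarrow> real"
  proof -
    have [measurable]: "g \<in> borel_measurable M" using that(1) by (rule measurable_M_if_measurable_F)
    have "expectation (\<lambda>x. g x * d t x) = expectation (\<lambda>x. g x * real_cond_exp M (F t) (d t) x)"
      using integrable_gd by (intro real_cond_exp_intg(2)[symmetric]) auto
    also have "\<dots> = expectation (\<lambda>x. 0)"
      using cond_exp_zero[of t] by (intro integral_cong_AE) auto
    finally show ?thesis by simp
  qed
  show "expectation (\<lambda>x. h x * of_real (d t x)) = 0"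
  proof (rule complex_eqI)
    show "Re (expectation (\<lambda>x. h x * of_real (d t x))) = Re 0"
      using zero[of "\<lambda>x. Re (h x)"] integral_Re[OF integrable_hd] integrable_Re[OF integrable_hd] by simp
    show "Im (expectation (\<lambda>x. h x * of_real (d t x))) = Im 0"
      using zero[of "\<lambda>x. Im (h x)"] integral_Im[OF integrable_hd] integrable_Im[OF integrable_hd] by simp
  qed
qed

end

text \<open>With \<open>x\<^sub>t = d\<^sub>t/\<surd>n\<close>, the factor \<open>exp (i x\<^sub>t + min(x\<^sub>t\<^sup>2, 1)/2)\<close> equals \<open>1 + i x\<^sub>t\<close> up to a remainder that sums
  to \<open>o(1)\<close>, so the partial products of these factors have mean close to 1. Stopping once
  \<open>\<Sum> min(x\<^sub>t\<^sup>2, 1)\<close> exceeds \<open>E d\<^sub>0\<^sup>2 + 1\<close> keeps the products bounded; since that sum tends to \<open>E d\<^sub>0\<^sup>2\<close> in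
  probability, stopping is asymptotically negligible.\<close>
locale stationary_martingale_difference = martingale_difference +
  assumes identically_distributed: "distr M borel (d t) = distr M borel (d 0)"
    and lln_squares:
      "tendsto_in_prob (\<lambda>n x. (\<Sum>t<n. (d t x)\<^sup>2) / real n) (expectation (\<lambda>x. (d 0 x)\<^sup>2))"
begin

definition step_var :: real where
  "step_var = expectation (\<lambda>x. (d 0 x)\<^sup>2)"

definition trunc_var :: "nat \<Rightarrow> nat \<Rightarrow> 'a \<Rightarrow> real" where
  "trunc_var n k x = (\<Sum>t<k. trunc_sq (d t x / sqrt (real n)))"

definition stopped :: "nat \<Rightarrow> nat \<Rightarrow> 'a \<Rightarrow> real" where
  "stopped n t x = (if trunc_var n t x \<le> step_var + 1 then d t x / sqrt (real n) else 0)"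

definition compensated_prod :: "nat \<Rightarrow> nat \<Rightarrow> 'a \<Rightarrow> complex" where
  "compensated_prod n k x = (\<Prod>t<k. compensated_exp (stopped n t x))"

definition mean_remainder :: "nat \<Rightarrow> real" where
  "mean_remainder n = expectation (\<lambda>x. cub_sq (d 0 x / sqrt (real n)))"

lemma step_var_nonneg: "0 \<le> step_var"
  by (simp add: step_var_def)

lemma expectation_comp_d:
  fixes f :: "real \<Rightarrow> real"
  assumes "f \<in> borel_measurable borel"
  shows "expectation (\<lambda>x. f (d t x)) = expectation (\<lambda>x. f (d 0 x))"
  using integral_distr[OF d_measurable_M assms] identically_distributed[of t] by metis

lemma trunc_var_measurable_F:
  assumes "k \<le> t"
  shows "trunc_var n k \<in> borel_measurable (F t)"
  unfolding trunc_var_def using assms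
  by (auto intro!: borel_measurable_sum measurable_compose[OF _ trunc_sq_measurable]
      borel_measurable_divide d_measurable_F)

lemma stopped_measurable_F:
  assumes "k < t"
  shows "stopped n k \<in> borel_measurable (F t)"
  unfolding stopped_def using trunc_var_measurable_F[of k t n] d_measurable_F[OF assms] assms by simp

lemma compensated_prod_measurable_F:
  assumes "k \<le> t"
  shows "compensated_prod n k \<in> borel_measurable (F t)"
  unfolding compensated_prod_def using assms
  by (auto intro!: borel_measurable_prod measurable_compose[OF _ compensated_exp_measurable] stopped_measurable_F)

lemma measurable_M[measurable]:
  "trunc_var n k \<in> borel_measurable M" "stopped n k \<in> borel_measurable M"
  "compensated_prod n k \<in> borel_measurable M"
  by (rule measurable_M_if_measurable_F[OF trunc_var_measurable_F[OF order_refl]]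
      measurable_M_if_measurable_F[OF stopped_measurable_F[OF lessI]]
      measurable_M_if_measurable_F[OF compensated_prod_measurable_F[OF order_refl]])+

lemma trunc_var_mono: "k \<le> l \<Longrightarrow> trunc_var n k x \<le> trunc_var n l x"
  unfolding trunc_var_def by (intro sum_mono2) (auto simp: trunc_sq_bounds)

lemma stopped_var_le: "(\<Sum>t<k. trunc_sq (stopped n t x)) \<le> step_var + 2"
proof (induction k)
  case (Suc k)
  show ?case
  proof (cases "trunc_var n k x \<le> step_var + 1")
    case True
    have "(\<Sum>t<k. trunc_sq (stopped n t x)) \<le> trunc_var n k x"
      unfolding trunc_var_def stopped_def by (intro sum_mono) (auto simp: trunc_sq_bounds)
    then show ?thesis using True trunc_sq_bounds(2)[of "stopped n k x"] by simp
  next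
    case False
    then show ?thesis using Suc by (simp add: stopped_def trunc_sq_bounds)
  qed
qed (use step_var_nonneg in simp)

lemma cmod_compensated_prod_le: "cmod (compensated_prod n k x) \<le> exp ((step_var + 2) / 2)"
proof -
  have "cmod (compensated_prod n k x) = exp ((\<Sum>t<k. trunc_sq (stopped n t x)) / 2)"
    by (simp add: compensated_prod_def cmod_compensated_exp exp_sum sum_divide_distrib flip: prod_norm)
  then show ?thesis using stopped_var_le[of n x k] by simp
qed

lemma compensated_prod_integrable: "integrable M (compensated_prod n k)"
  by (rule integrable_const_bound[of _ "exp ((step_var + 2) / 2)"]) (use cmod_compensated_prod_le in auto)

lemma cub_sq_integrable: "integrable M (\<lambda>x. cub_sq (d t x / sqrt (real n)))"
proof (rule Bochner_Integration.integrable_bound)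
  show "integrable M (\<lambda>x. (d t x)\<^sup>2 / real n)" using square_integrable by simp
  show "AE x in M. norm (cub_sq (d t x / sqrt (real n))) \<le> norm ((d t x)\<^sup>2 / real n)"
    using cub_sq_bounds(1,2)[of "d t _ / sqrt (real n)"] by (auto simp: power_divide)
qed simp

lemma compensated_prod_remainder_le:
  "cmod (compensated_prod n k x * (compensated_exp (stopped n k x) - 1 - \<i> * of_real (stopped n k x)))
    \<le> 4 * exp ((step_var + 2) / 2) * cub_sq (d k x / sqrt (real n))" (is "cmod ?r \<le> _")
proof -
  have "cmod ?r \<le> exp ((step_var + 2) / 2) * (4 * cub_sq (stopped n k x))"
    unfolding norm_mult by (intro mult_mono cmod_compensated_prod_le compensated_exp_remainder) auto
  also have "\<dots> \<le> exp ((step_var + 2) / 2) * (4 * cub_sq (d k x / sqrt (real n)))"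
    by (simp add: stopped_def cub_sq_bounds)
  finally show ?thesis by (simp add: mult_ac)
qed

lemma expectation_compensated_prod_step:
  "cmod (expectation (compensated_prod n (Suc k)) - expectation (compensated_prod n k))
    \<le> 4 * exp ((step_var + 2) / 2) * mean_remainder n"
proof -
  let ?\<phi> = "compensated_prod n k" and ?B = "exp ((step_var + 2) / 2)"
  define h where "h x = (if trunc_var n k x \<le> step_var + 1 then ?\<phi> x / of_real (sqrt (real n)) else 0)" for x
  define r where "r x = ?\<phi> x * (compensated_exp (stopped n k x) - 1 - \<i> * of_real (stopped n k x))" for x
  have [measurable]: "r \<in> borel_measurable M" unfolding r_def by measurable
  have split: "compensated_prod n (Suc k) x - ?\<phi> x = \<i> * (h x * of_real (d k x)) + r x" for x
    by (simp add: compensated_prod_def h_def r_def stopped_def algebra_simps)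
  have "h \<in> borel_measurable (F k)"
    unfolding h_def using trunc_var_measurable_F[of k k n] compensated_prod_measurable_F[of k k n] by simp
  moreover have "cmod (h x) \<le> ?B" for x
  proof -
    have "cmod (h x) \<le> cmod (?\<phi> x)"
      by (cases "n = 0") (auto simp: h_def norm_divide divide_le_eq mult_le_cancel_left1 intro: order_trans)
    then show ?thesis using cmod_compensated_prod_le[of n k x] by linarith
  qed
  ultimately have integrable_hd: "integrable M (\<lambda>x. h x * of_real (d k x))"
    and "expectation (\<lambda>x. h x * of_real (d k x)) = 0"
    by (rule expectation_bounded_mult_eq_zero)+
  have r_le: "cmod (r x) \<le> 4 * ?B * cub_sq (d k x / sqrt (real n))" for x
    unfolding r_def by (rule compensated_prod_remainder_le)
  have integrable_r: "integrable M r"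
  proof (rule Bochner_Integration.integrable_bound)
    show "integrable M (\<lambda>x. 4 * ?B * cub_sq (d k x / sqrt (real n)))" using cub_sq_integrable by simp
    show "AE x in M. norm (r x) \<le> norm (4 * ?B * cub_sq (d k x / sqrt (real n)))"
      using r_le by (auto intro!: AE_I2 order_trans[OF r_le])
  qed simp
  have "expectation (compensated_prod n (Suc k)) - expectation ?\<phi>
      = expectation (\<lambda>x. compensated_prod n (Suc k) x - ?\<phi> x)"
    by (intro Bochner_Integration.integral_diff[symmetric] compensated_prod_integrable)
  also have "\<dots> = expectation r"
    unfolding split using integrable_hd \<open>expectation (\<lambda>x. h x * of_real (d k x)) = 0\<close> integrable_r by simp
  finally have "cmod (expectation (compensated_prod n (Suc k)) - expectation ?\<phi>) \<le> expectation (\<lambda>x. cmod (r x))"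
    by (simp add: integral_norm_bound)
  also have "\<dots> \<le> expectation (\<lambda>x. 4 * ?B * cub_sq (d k x / sqrt (real n)))"
    using integrable_r cub_sq_integrable r_le by (intro integral_mono) auto
  also have "\<dots> = 4 * ?B * mean_remainder n"
    using expectation_comp_d[of "\<lambda>u. cub_sq (u / sqrt (real n))" k] by (simp add: mean_remainder_def)
  finally show ?thesis .
qed

lemma expectation_compensated_prod_near_one:
  "cmod (expectation (compensated_prod n k) - 1) \<le> real k * (4 * exp ((step_var + 2) / 2) * mean_remainder n)"
proof (induction k)
  case (Suc k)
  have "cmod (expectation (compensated_prod n (Suc k)) - 1)
    \<le> cmod (expectation (compensated_prod n (Suc k)) - expectation (compensated_prod n k))
      + cmod (expectation (compensated_prod n k) - 1)"
    using norm_triangle_ineq[of "expectation (compensated_prod n (Suc k)) - expectation (compensated_prod n k)"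
        "expectation (compensated_prod n k) - 1"] by simp
  then show ?case using Suc expectation_compensated_prod_step[of n k] by (simp add: distrib_right)
qed (simp add: compensated_prod_def prob_space)

lemma mean_remainder_tendsto: "(\<lambda>n. real n * mean_remainder n) \<longlonglongrightarrow> 0"
proof -
  have "(\<lambda>n. expectation (\<lambda>x. real n * cub_sq (d 0 x / sqrt (real n)))) \<longlonglongrightarrow> expectation (\<lambda>x. 0)"
  proof (rule integral_dominated_convergence[where w="\<lambda>x. (d 0 x)\<^sup>2"])
    show "AE x in M. (\<lambda>n. real n * cub_sq (d 0 x / sqrt (real n))) \<longlonglongrightarrow> 0"
    proof (rule AE_I2)
      fix x
      have cub_sq_le: "real n * cub_sq (u / sqrt (real n)) \<le> \<bar>u\<bar> ^ 3 / sqrt (real n)" for u n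
      proof -
        have "real n * cub_sq (u / sqrt (real n)) \<le> real n * \<bar>u / sqrt (real n)\<bar> ^ 3"
          by (intro mult_left_mono cub_sq_bounds) auto
        also have "\<dots> = \<bar>u\<bar> ^ 3 * (real n / sqrt (real n) ^ 3)" by (simp add: power_divide)
        also have "real n / sqrt (real n) ^ 3 = 1 / sqrt (real n)"
          by (cases "n = 0") (simp_all add: power3_eq_cube field_simps)
        finally show ?thesis by simp
      qed
      have "(\<lambda>n. \<bar>d 0 x\<bar> ^ 3 / sqrt (real n)) \<longlonglongrightarrow> 0"
        by (rule const_over_sqrt_tendsto)
      then show "(\<lambda>n. real n * cub_sq (d 0 x / sqrt (real n))) \<longlonglongrightarrow> 0"
        by (rule Lim_null_comparison[rotated]) (simp add: cub_sq_le cub_sq_bounds)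
    qed
    have "norm (real n * cub_sq (d 0 x / sqrt (real n))) \<le> (d 0 x)\<^sup>2" for n x
    proof -
      have "real n * cub_sq (d 0 x / sqrt (real n)) \<le> real n * (d 0 x / sqrt (real n))\<^sup>2"
        by (intro mult_left_mono cub_sq_bounds) auto
      also have "\<dots> \<le> (d 0 x)\<^sup>2" by (simp add: power_divide)
      finally show ?thesis by (simp add: cub_sq_bounds)
    qed
    then show "AE x in M. norm (real n * cub_sq (d 0 x / sqrt (real n))) \<le> (d 0 x)\<^sup>2" for n by simp
  qed (use square_integrable in auto)
  then show ?thesis by (simp add: mean_remainder_def)
qed

lemma expectation_compensated_prod_tendsto: "(\<lambda>n. expectation (compensated_prod n n)) \<longlonglongrightarrow> 1"
proof (rule LIM_zero_cancel, rule Lim_null_comparison)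
  show "\<forall>\<^sub>F n in sequentially. norm (expectation (compensated_prod n n) - 1)
      \<le> 4 * exp ((step_var + 2) / 2) * (real n * mean_remainder n)"
    using expectation_compensated_prod_near_one by (simp add: mult_ac)
  show "(\<lambda>n. 4 * exp ((step_var + 2) / 2) * (real n * mean_remainder n)) \<longlonglongrightarrow> 0"
    by (rule tendsto_mult_right_zero[OF mean_remainder_tendsto])
qed

lemma expectation_excess_tendsto: "(\<lambda>n. expectation (\<lambda>x. max ((d 0 x)\<^sup>2 - real n) 0)) \<longlonglongrightarrow> 0"
proof -
  have "(\<lambda>n. expectation (\<lambda>x. max ((d 0 x)\<^sup>2 - real n) 0)) \<longlonglongrightarrow> expectation (\<lambda>x. 0)"
  proof (rule integral_dominated_convergence[where w="\<lambda>x. (d 0 x)\<^sup>2"])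
    show "AE x in M. (\<lambda>n. max ((d 0 x)\<^sup>2 - real n) 0) \<longlonglongrightarrow> 0"
    proof (rule AE_I2)
      fix x
      obtain N :: nat where "(d 0 x)\<^sup>2 \<le> real N" using real_arch_simple by blast
      then show "(\<lambda>n. max ((d 0 x)\<^sup>2 - real n) 0) \<longlonglongrightarrow> 0"
        by (intro tendsto_eventually) (auto simp: eventually_sequentially intro!: exI[of _ N])
    qed
  qed (use square_integrable in auto)
  then show ?thesis by simp
qed

lemma trunc_var_tendsto: "tendsto_in_prob (\<lambda>n. trunc_var n n) step_var"
proof -
  define excess where "excess n x = (\<Sum>t<n. max ((d t x)\<^sup>2 - real n) 0) / real n" for n x
  have integrable_excess: "integrable M (\<lambda>x. max ((d t x)\<^sup>2 - real n) 0)" for t n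
    using square_integrable by (intro integrable_max) auto
  have "expectation (\<lambda>x. max ((d 0 x)\<^sup>2 - real n) 0) = expectation (excess n)" if "n > 0" for n
  proof -
    have "expectation (excess n) = (\<Sum>t<n. expectation (\<lambda>x. max ((d t x)\<^sup>2 - real n) 0)) / real n"
      using integrable_excess by (simp add: excess_def[abs_def])
    also have "\<dots> = (\<Sum>t<n. expectation (\<lambda>x. max ((d 0 x)\<^sup>2 - real n) 0)) / real n"
      using expectation_comp_d[of "\<lambda>u. max (u\<^sup>2 - real n) 0"] by (intro arg_cong2[where f="(/)"] sum.cong) auto
    finally show ?thesis using that by simp
  qed
  then have "(\<lambda>n. expectation (excess n)) \<longlonglongrightarrow> 0"
    by (intro Lim_transform_eventually[OF expectation_excess_tendsto])
       (simp add: eventually_at_top_dense exI[of _ 0])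
  then have "tendsto_in_prob excess 0"
    using integrable_excess by (intro tendsto_in_prob_zero_if_expectation_tendsto_zero)
      (auto simp: excess_def[abs_def] intro!: divide_nonneg_nonneg sum_nonneg)
  from tendsto_in_prob_add[OF lln_squares tendsto_in_prob_cmult_zero[OF this, of "- 1"]]
  have "tendsto_in_prob (\<lambda>n x. (\<Sum>t<n. (d t x)\<^sup>2) / real n + - 1 * excess n x) step_var"
    by (simp add: step_var_def)
  moreover have "(\<Sum>t<n. (d t x)\<^sup>2) / real n + - 1 * excess n x = trunc_var n n x" for n x
  proof -
    have "trunc_sq (d t x / sqrt (real n)) = (d t x)\<^sup>2 / real n - max ((d t x)\<^sup>2 - real n) 0 / real n"
      if "n > 0" for t
      using that by (auto simp: trunc_sq_def min_def max_def power_divide field_simps)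
    then show ?thesis
      by (cases "n = 0") (simp_all add: trunc_var_def excess_def sum_subtractf sum_divide_distrib)
  qed
  ultimately show ?thesis by simp
qed

lemma compensated_prod_eq_if_not_stopped:
  assumes "trunc_var n n x \<le> step_var + 1"
  shows "compensated_prod n n x = cis ((\<Sum>t<n. d t x) / sqrt (real n)) * of_real (exp (trunc_var n n x / 2))"
proof -
  have "stopped n t x = d t x / sqrt (real n)" if "t < n" for t
    using trunc_var_mono[of t n n x] assms that by (simp add: stopped_def)
  then have "compensated_prod n n x = (\<Prod>t<n. compensated_exp (d t x / sqrt (real n)))"
    by (simp add: compensated_prod_def)
  also have "\<dots> = cis ((\<Sum>t<n. d t x) / sqrt (real n)) * of_real (exp (trunc_var n n x / 2))"
    by (simp add: compensated_exp_def trunc_var_def prod.distrib cis_conv_exp exp_sum sum_divide_distrib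
        sum_distrib_left exp_of_real flip: of_real_prod)
  finally show ?thesis .
qed

lemma cmod_cis_minus_compensated_prod_le:
  assumes "\<bar>trunc_var n n x - step_var\<bar> \<le> e" "e \<le> 1"
  shows "cmod (cis ((\<Sum>t<n. d t x) / sqrt (real n)) - of_real (exp (- step_var / 2)) * compensated_prod n n x)
    \<le> exp (e / 2) - 1"
proof -
  let ?c = "cis ((\<Sum>t<n. d t x) / sqrt (real n))" and ?w = "exp ((trunc_var n n x - step_var) / 2)"
  have "exp (- step_var / 2) * exp (trunc_var n n x / 2) = ?w"
    by (simp add: mult_exp_exp diff_divide_distrib)
  then have "of_real (exp (- step_var / 2)) * compensated_prod n n x = ?c * of_real ?w"
    using assms by (subst compensated_prod_eq_if_not_stopped) (auto simp flip: of_real_mult)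
  then have "cmod (?c - of_real (exp (- step_var / 2)) * compensated_prod n n x) = cmod (?c * of_real (1 - ?w))"
    by (simp add: right_diff_distrib)
  also have "\<dots> = \<bar>1 - ?w\<bar>" by (simp add: norm_mult del: of_real_diff)
  also have "\<dots> \<le> exp (e / 2) - 1"
  proof -
    have "?w \<le> exp (e / 2)" "exp (- (e / 2)) \<le> ?w" using assms by auto
    moreover have "1 - exp (- (e / 2)) \<le> exp (e / 2) - 1"
      using exp_ge_add_one_self[of "e / 2"] exp_ge_add_one_self[of "- (e / 2)"] by linarith
    ultimately show ?thesis by linarith
  qed
  finally show ?thesis .
qed

theorem central_limit:
  "(\<lambda>n. expectation (\<lambda>x. cis ((\<Sum>t<n. d t x) / sqrt (real n)))) \<longlonglongrightarrow> of_real (exp (- step_var / 2))"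
proof -
  let ?c = "\<lambda>n x. cis ((\<Sum>t<n. d t x) / sqrt (real n))" and ?w = "of_real (exp (- step_var / 2)) :: complex"
  have "(\<lambda>n. expectation (\<lambda>x. ?c n x - ?w * compensated_prod n n x)) \<longlonglongrightarrow> 0"
  proof (rule expectation_tendsto_zero_if_tendsto_in_prob)
    show "norm (?c n x - ?w * compensated_prod n n x) \<le> 1 + exp (- step_var / 2) * exp ((step_var + 2) / 2)" for n x
      using cmod_compensated_prod_le[of n n x]
      by (intro order_trans[OF norm_triangle_ineq4] add_mono) (auto simp: norm_mult)
    show "tendsto_in_prob (\<lambda>n x. norm (?c n x - ?w * compensated_prod n n x)) 0"
      unfolding tendsto_in_prob_def
    proof (intro allI impI)
      fix \<epsilon> :: real assume \<epsilon>_pos: "\<epsilon> > 0"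
      define e where "e = min 1 (2 * ln (1 + \<epsilon>))"
      have e_pos: "e > 0" "e \<le> 1" "e / 2 \<le> ln (1 + \<epsilon>)" using \<epsilon>_pos by (auto simp: e_def)
      have "exp (e / 2) \<le> exp (ln (1 + \<epsilon>))" using e_pos(3) by (rule exp_le_cancel_iff[THEN iffD2])
      then have "exp (e / 2) - 1 \<le> \<epsilon>" using \<epsilon>_pos by simp
      moreover have "with_high_prob (\<lambda>n x. \<bar>trunc_var n n x - step_var\<bar> \<le> e)"
        using trunc_var_tendsto e_pos by (simp add: tendsto_in_prob_def)
      ultimately show "with_high_prob (\<lambda>n x. \<bar>norm (?c n x - ?w * compensated_prod n n x) - 0\<bar> \<le> \<epsilon>)"
        using cmod_cis_minus_compensated_prod_le[OF _ e_pos(2)]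
        by (elim with_high_prob_mono) (force intro!: always_eventually)
    qed
  qed measurable
  from tendsto_add[OF this tendsto_mult[OF tendsto_const[of ?w] expectation_compensated_prod_tendsto]]
  show ?thesis by (simp add: integrable_cis compensated_prod_integrable)
qed

end

section \<open>Convergence in distribution from characteristic functions\<close>

definition inner_on :: "'i set \<Rightarrow> ('i \<Rightarrow> real) \<Rightarrow> ('i \<Rightarrow> real) \<Rightarrow> real" where
  "inner_on S v w = (\<Sum>i\<in>S. v i * w i)"

lemma inner_on_commute: "inner_on S v w = inner_on S w v"
  by (simp add: inner_on_def mult.commute)

lemma inner_on_add_left: "inner_on S (\<lambda>i. v i + w i) x = inner_on S v x + inner_on S w x"
  by (simp add: inner_on_def distrib_right sum.distrib)

lemma inner_on_diff_left: "inner_on S (\<lambda>i. v i - w i) x = inner_on S v x - inner_on S w x"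
  by (simp add: inner_on_def left_diff_distrib sum_subtractf)

lemma inner_on_cong: "(\<And>i. i \<in> S \<Longrightarrow> v i = v' i) \<Longrightarrow> (\<And>i. i \<in> S \<Longrightarrow> w i = w' i) \<Longrightarrow> inner_on S v w = inner_on S v' w'"
  by (simp add: inner_on_def)

lemma inner_on_single:
  assumes "finite S" "i \<in> S"
  shows "inner_on S (\<lambda>j. if j = i then c else 0) x = c * x i"
  using assms by (simp add: inner_on_def if_distrib[of "\<lambda>u. u * _"] cong: if_cong)

lemma continuous_on_inner_on: "continuous_on A (inner_on S \<xi>)"
  unfolding inner_on_def
  by (intro continuous_on_sum continuous_on_mult continuous_on_const
      continuous_on_subset[OF continuous_on_product_coordinates]) simp

lemma borel_measurable_inner_on:
  assumes "\<And>i. i \<in> S \<Longrightarrow> (\<lambda>x. X x i) \<in> borel_measurable M"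
  shows "(\<lambda>x. inner_on S \<xi> (X x)) \<in> borel_measurable M"
  unfolding inner_on_def using assms by simp

inductive_set trig_poly :: "'i set \<Rightarrow> (('i \<Rightarrow> real) \<Rightarrow> real) set" for S where
  gen: "(\<lambda>x. a * cos (inner_on S \<xi> x) + b * sin (inner_on S \<xi> x)) \<in> trig_poly S"
| add: "f \<in> trig_poly S \<Longrightarrow> g \<in> trig_poly S \<Longrightarrow> (\<lambda>x. f x + g x) \<in> trig_poly S"

lemma trig_poly_const: "(\<lambda>x. c) \<in> trig_poly S"
  using trig_poly.gen[of c S "\<lambda>_. 0" 0] by (simp add: inner_on_def)

lemma trig_poly_mult:
  assumes "f \<in> trig_poly S" "g \<in> trig_poly S"
  shows "(\<lambda>x. f x * g x) \<in> trig_poly S"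
  using assms(1)
proof induction
  case (gen a \<xi> b)
  show ?case
    using assms(2)
  proof induction
    case (gen c \<eta> d)
    let ?s = "inner_on S (\<lambda>i. \<xi> i + \<eta> i)" and ?d = "inner_on S (\<lambda>i. \<xi> i - \<eta> i)"
    have "(\<lambda>x. ((a*c + b*d) / 2 * cos (?d x) + (b*c - a*d) / 2 * sin (?d x))
        + ((a*c - b*d) / 2 * cos (?s x) + (b*c + a*d) / 2 * sin (?s x))) \<in> trig_poly S"
      by (rule trig_poly.add[OF trig_poly.gen trig_poly.gen])
    then show ?case
      by (rule back_subst[of "\<lambda>h. h \<in> trig_poly S"])
         (simp add: inner_on_add_left inner_on_diff_left cos_add cos_diff sin_add sin_diff fun_eq_iff field_simps)
  next
    case (add g1 g2)
    then show ?case using trig_poly.add[OF add.IH] by (simp add: distrib_left)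
  qed
next
  case (add f1 f2)
  then show ?case using trig_poly.add[OF add.IH] by (simp add: distrib_right)
qed

lemma trig_poly_compose_polynomial:
  assumes "real_polynomial_function \<phi>" "f \<in> trig_poly S"
  shows "(\<lambda>x. \<phi> (f x)) \<in> trig_poly S"
  using assms(1)
proof induction
  case (linear h)
  then obtain c where "h = (\<lambda>x. x * c)" using real_bounded_linear by auto
  then show ?case using trig_poly_mult[OF assms(2) trig_poly_const] by simp
qed (auto intro: trig_poly_const trig_poly.add trig_poly_mult)

lemma trig_poly_bounded:
  assumes "f \<in> trig_poly S"
  shows "\<exists>B. \<forall>x. \<bar>f x\<bar> \<le> B"
  using assms
proof induction
  case (gen a \<xi> b)
  have "\<bar>a * cos t + b * sin t\<bar> \<le> \<bar>a\<bar> + \<bar>b\<bar>" for t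
    by (rule order_trans[OF abs_triangle_ineq]) (auto simp: abs_mult intro!: add_mono mult_left_le)
  then show ?case by blast
next
  case (add f g)
  then obtain B C where "\<forall>x. \<bar>f x\<bar> \<le> B" "\<forall>x. \<bar>g x\<bar> \<le> C" by blast
  then have "\<bar>f x + g x\<bar> \<le> B + C" for x by (meson abs_triangle_ineq add_mono order_trans)
  then show ?case by blast
qed

lemma trig_poly_continuous:
  fixes f :: "('i::countable \<Rightarrow> real) \<Rightarrow> real"
  assumes "f \<in> trig_poly S"
  shows "continuous_on A f"
  using assms
proof induction
  case (gen a \<xi> b)
  show ?case
    by (intro continuous_on_add continuous_on_mult continuous_on_const continuous_on_cos continuous_on_sin
        continuous_on_inner_on)
qed (rule continuous_on_add)

lemma trig_poly_separates_box:
  assumes fin: "finite S" and R_nonneg: "R \<ge> 0"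
    and x_box: "x \<in> PiE S (\<lambda>_. {-R..R})" and y_box: "y \<in> PiE S (\<lambda>_. {-R..R})" and "x \<noteq> y"
  shows "\<exists>h \<in> trig_poly S. h x \<noteq> h y"
proof -
  obtain i where differ: "i \<in> S" "x i \<noteq> y i"
    using x_box y_box \<open>x \<noteq> y\<close> by (metis PiE_ext)
  define \<xi> where "\<xi> j = (if j = i then 1 / (R + 1) else 0)" for j
  have inner_\<xi>: "inner_on S \<xi> z = z i / (R + 1)" for z
    using inner_on_single[OF fin differ(1)] by (simp add: \<xi>_def[abs_def])
  have range: "- (pi / 2) \<le> z i / (R + 1) \<and> z i / (R + 1) \<le> pi / 2" if "z \<in> PiE S (\<lambda>_. {-R..R})" for z
  proof -
    have "-R \<le> z i" "z i \<le> R" using that differ by auto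
    then have "-1 \<le> z i / (R + 1)" "z i / (R + 1) \<le> 1" using R_nonneg by (auto simp: field_simps)
    then show ?thesis using pi_gt3 by linarith
  qed
  have "x i / (R + 1) \<noteq> y i / (R + 1)" using differ R_nonneg by simp
  then have "sin (inner_on S \<xi> x) \<noteq> sin (inner_on S \<xi> y)"
    unfolding inner_\<xi> using range[OF x_box] range[OF y_box] sin_inj_pi by blast
  then show ?thesis by (intro bexI[OF _ trig_poly.gen[of 0 S \<xi> 1]]) simp
qed

lemma compact_PiE_box: "compact (PiE S (\<lambda>_. {-R..R::real}))"
proof -
  let ?T = "\<lambda>i. if i \<in> S then {-R..R} else {undefined::real}"
  have "PiE S (\<lambda>_. {-R..R}) = PiE UNIV ?T"
    by (auto simp: PiE_def extensional_def Pi_def split: if_splits)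
  moreover have "compactin (product_topology (\<lambda>_. euclidean) UNIV) (PiE UNIV ?T)"
    by (subst compactin_PiE) auto
  ultimately show ?thesis by (simp add: euclidean_product_topology)
qed

text \<open>Stone-Weierstrass only controls the approximant on the box. Composing it with a polynomial close to
  the truncation at level \<open>B\<close> keeps it a trigonometric polynomial and bounds it everywhere.\<close>
lemma trig_poly_dense:
  fixes f :: "('i::countable \<Rightarrow> real) \<Rightarrow> real"
  assumes f_continuous: "continuous_on (PiE S (\<lambda>_. {-R..R})) f" and R_nonneg: "R \<ge> 0" and e_pos: "e > 0"
    and f_bounded: "\<And>x. x \<in> PiE S (\<lambda>_. {-R..R}) \<Longrightarrow> \<bar>f x\<bar> \<le> B" and fin: "finite S"
  shows "\<exists>g \<in> trig_poly S. (\<forall>x \<in> PiE S (\<lambda>_. {-R..R}). \<bar>f x - g x\<bar> \<le> e) \<and> (\<forall>x. \<bar>g x\<bar> \<le> B + e)"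
proof -
  let ?K = "PiE S (\<lambda>_. {-R..R})"
  have "restrict (\<lambda>_. 0) S \<in> ?K" using R_nonneg by auto
  then have B_nonneg: "B \<ge> 0" using f_bounded abs_ge_zero order_trans by blast
  have "\<exists>g. g \<in> trig_poly S \<and> (\<forall>x\<in>?K. \<bar>f x - g x\<bar> < e / 2)"
  proof (rule Stone_Weierstrass_HOL[where P="\<lambda>g. g \<in> trig_poly S"])
    show "\<exists>h. h \<in> trig_poly S \<and> h x \<noteq> h y" if "x \<in> ?K \<and> y \<in> ?K \<and> x \<noteq> y" for x y
      using trig_poly_separates_box[OF fin R_nonneg, of x y] that by auto
  qed (use f_continuous e_pos in \<open>auto intro: compact_PiE_box trig_poly_const trig_poly_mult trig_poly.add
      trig_poly_continuous\<close>)
  then obtain g where g_trig: "g \<in> trig_poly S" "\<And>x. x \<in> ?K \<Longrightarrow> \<bar>f x - g x\<bar> < e / 2" by blast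
  obtain m where g_bounded: "\<And>x. \<bar>g x\<bar> \<le> m" using trig_poly_bounded[OF g_trig(1)] by blast
  define clamp where "clamp u = max (- B) (min u B)" for u :: real
  obtain \<phi> where \<phi>_polynomial: "real_polynomial_function \<phi>" "\<And>u. u \<in> {-m..m} \<Longrightarrow> \<bar>clamp u - \<phi> u\<bar> < e / 2"
    by (rule Stone_Weierstrass_real_polynomial_function[of "{-m..m}" clamp "e/2"])
       (use e_pos in \<open>auto simp: clamp_def intro!: continuous_intros\<close>)
  have close: "\<bar>clamp (g x) - \<phi> (g x)\<bar> < e / 2" for x
    using \<phi>_polynomial(2)[of "g x"] g_bounded[of x] by (simp add: abs_le_iff)
  show ?thesis
  proof (intro bexI conjI ballI allI)
    show "(\<lambda>x. \<phi> (g x)) \<in> trig_poly S" by (rule trig_poly_compose_polynomial[OF \<phi>_polynomial(1) g_trig(1)])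
    show "\<bar>f x - \<phi> (g x)\<bar> \<le> e" if "x \<in> ?K" for x
    proof -
      have "\<bar>f x - clamp (g x)\<bar> < e / 2"
        using g_trig(2)[OF that] f_bounded[OF that] B_nonneg unfolding clamp_def max_def min_def
        by (auto split: if_splits)
      then show ?thesis using close[of x] by linarith
    qed
    show "\<bar>\<phi> (g x)\<bar> \<le> B + e" for x
    proof -
      have "\<bar>clamp (g x)\<bar> \<le> B" using B_nonneg by (auto simp: clamp_def)
      then show ?thesis using close[of x] e_pos by linarith
    qed
  qed
qed

lemma trig_poly_expectation_tendsto:
  assumes "prob_space M" "prob_space \<mu>"
    and X_measurable: "\<And>n i. i \<in> S \<Longrightarrow> (\<lambda>\<omega>. Xs n \<omega> i) \<in> borel_measurable M"
    and \<mu>_measurable: "\<And>i. i \<in> S \<Longrightarrow> (\<lambda>x. x i) \<in> borel_measurable \<mu>"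
    and char: "\<And>\<xi>. (\<lambda>n. \<integral>\<omega>. cis (inner_on S \<xi> (Xs n \<omega>)) \<partial>M) \<longlonglongrightarrow> (\<integral>x. cis (inner_on S \<xi> x) \<partial>\<mu>)"
    and g_trig: "g \<in> trig_poly S"
  shows "(\<forall>n. integrable M (\<lambda>\<omega>. g (Xs n \<omega>))) \<and> integrable \<mu> g \<and>
    (\<lambda>n. \<integral>\<omega>. g (Xs n \<omega>) \<partial>M) \<longlonglongrightarrow> (\<integral>x. g x \<partial>\<mu>)"
  using g_trig
proof induction
  case (gen a \<xi> b)
  interpret M: prob_space M by fact
  interpret \<mu>: prob_space \<mu> by fact
  let ?l = "inner_on S \<xi>"
  have integrable_M: "integrable M (\<lambda>\<omega>. cis (?l (Xs n \<omega>)))" for n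
    by (intro M.integrable_cis borel_measurable_inner_on X_measurable)
  have integrable_\<mu>: "integrable \<mu> (\<lambda>x. cis (?l x))"
    by (intro \<mu>.integrable_cis borel_measurable_inner_on \<mu>_measurable)
  have "integrable M (\<lambda>\<omega>. cos (?l (Xs n \<omega>)))" "integrable M (\<lambda>\<omega>. sin (?l (Xs n \<omega>)))"
    "integrable \<mu> (\<lambda>x. cos (?l x))" "integrable \<mu> (\<lambda>x. sin (?l x))" for n
    using integrable_Re[OF integrable_M] integrable_Im[OF integrable_M]
      integrable_Re[OF integrable_\<mu>] integrable_Im[OF integrable_\<mu>] by auto
  moreover have "(\<lambda>n. \<integral>\<omega>. cos (?l (Xs n \<omega>)) \<partial>M) \<longlonglongrightarrow> (\<integral>x. cos (?l x) \<partial>\<mu>)"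
    using tendsto_Re[OF char[of \<xi>]] integral_Re[OF integrable_M] integral_Re[OF integrable_\<mu>] by simp
  moreover have "(\<lambda>n. \<integral>\<omega>. sin (?l (Xs n \<omega>)) \<partial>M) \<longlonglongrightarrow> (\<integral>x. sin (?l x) \<partial>\<mu>)"
    using tendsto_Im[OF char[of \<xi>]] integral_Im[OF integrable_M] integral_Im[OF integrable_\<mu>] by simp
  ultimately show ?case by (auto intro!: tendsto_add tendsto_mult_left)
next
  case (add f g)
  then show ?case using tendsto_add by auto
qed

lemma (in prob_space) ex_abs_tail_prob_less:
  fixes X :: "'a \<Rightarrow> real"
  assumes [measurable]: "X \<in> borel_measurable M" and "e > 0"
  shows "\<exists>R. prob {x \<in> space M. \<bar>X x\<bar> > R} < e"
proof -
  let ?T = "\<lambda>n::nat. {x \<in> space M. \<bar>X x\<bar> > real n}"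
  have "(\<lambda>n. prob (?T n)) \<longlonglongrightarrow> prob (\<Inter>n. ?T n)"
    by (rule finite_Lim_measure_decseq) (auto simp: decseq_def intro: le_less_trans[rotated])
  moreover have "(\<Inter>n. ?T n) = {}"
  proof -
    have "\<exists>n::nat. \<not> \<bar>X x\<bar> > real n" for x using real_arch_simple[of "\<bar>X x\<bar>"] by (auto simp: not_less)
    then show ?thesis by blast
  qed
  ultimately have "(\<lambda>n. prob (?T n)) \<longlonglongrightarrow> 0" by simp
  from order_tendstoD(2)[OF this \<open>e > 0\<close>] show ?thesis
    using eventually_happens'[OF sequentially_bot] by blast
qed

lemma char_distr:
  assumes "X \<in> borel_measurable M"
  shows "char (distr M borel X) t = (\<integral>x. cis (t * X x) \<partial>M)"
  using assms by (simp add: char_def integral_distr cis_conv_exp)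

lemma (in prob_space) bounded_in_prob_if_char_tendsto:
  assumes X_measurable[measurable]: "\<And>n. X n \<in> borel_measurable M" and "real_distribution \<nu>"
    and char: "\<And>t. (\<lambda>n. expectation (\<lambda>x. cis (t * X n x))) \<longlonglongrightarrow> char \<nu> t"
  shows "bounded_in_prob X"
  unfolding bounded_in_prob_def
proof (intro allI impI)
  fix e :: real assume e_pos: "e > 0"
  interpret \<nu>: real_distribution \<nu> by fact
  have weak: "weak_conv_m (\<lambda>n. distr M borel (X n)) \<nu>"
    using char \<open>real_distribution \<nu>\<close> by (intro levy_continuity) (simp_all add: char_distr)
  obtain R where tail_small: "\<nu>.prob {x. \<bar>x\<bar> > R} < e"
    using \<nu>.ex_abs_tail_prob_less[of "\<lambda>x. x"] e_pos by auto
  define ramp where "ramp x = min 1 (max 0 (\<bar>x\<bar> - R))" for x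
  have ramp[measurable]: "ramp \<in> borel_measurable borel" unfolding ramp_def by measurable
  have "(\<lambda>n. \<integral>x. ramp x \<partial>distr M borel (X n)) \<longlonglongrightarrow> (\<integral>x. ramp x \<partial>\<nu>)"
    using \<open>real_distribution \<nu>\<close>
    by (intro weak_conv_imp_integral_bdd_continuous_conv[OF _ _ weak, where B=1])
       (auto simp: ramp_def intro!: continuous_intros)
  then have "(\<lambda>n. expectation (\<lambda>x. ramp (X n x))) \<longlonglongrightarrow> (\<integral>x. ramp x \<partial>\<nu>)"
    by (simp add: integral_distr)
  moreover have "(\<integral>x. ramp x \<partial>\<nu>) \<le> (\<integral>x. indicator {x. \<bar>x\<bar> > R} x \<partial>\<nu>)"
    by (intro integral_mono \<nu>.integrable_const_bound[of _ 1])
       (auto simp: ramp_def indicator_def)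
  then have "(\<integral>x. ramp x \<partial>\<nu>) < e" using tail_small by simp
  ultimately have "\<forall>\<^sub>F n in sequentially. expectation (\<lambda>x. ramp (X n x)) < e"
    by (rule order_tendstoD(2))
  then have "eventually_except e (\<lambda>n x. \<bar>X n x\<bar> \<le> R + 1)"
    unfolding eventually_except_def
  proof eventually_elim
    case (elim n)
    let ?E = "{x \<in> space M. \<bar>X n x\<bar> > R + 1}"
    have "prob ?E = expectation (indicator ?E)" by simp
    also have "\<dots> \<le> expectation (\<lambda>x. ramp (X n x))"
      by (intro integral_mono integrable_const_bound[of _ 1])
         (auto simp: ramp_def indicator_def)
    finally show ?case using elim by (intro bexI[of _ ?E]) auto
  qed
  then show "\<exists>R. eventually_except e (\<lambda>n x. \<bar>X n x\<bar> \<le> R)" by blast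
qed

lemma (in prob_space) coordinate_bounded_in_prob_if_char_tendsto:
  assumes "prob_space \<mu>" and coord: "(\<lambda>x. x i) \<in> borel_measurable \<mu>"
    and X_measurable: "\<And>n. (\<lambda>x. X n x i) \<in> borel_measurable M" and "finite S" "i \<in> S"
    and char: "\<And>\<xi>. (\<lambda>n. expectation (\<lambda>x. cis (inner_on S \<xi> (X n x)))) \<longlonglongrightarrow> (\<integral>x. cis (inner_on S \<xi> x) \<partial>\<mu>)"
  shows "bounded_in_prob (\<lambda>n x. X n x i)"
proof -
  interpret \<mu>: prob_space \<mu> by fact
  show ?thesis
  proof (rule bounded_in_prob_if_char_tendsto[OF X_measurable \<mu>.real_distribution_distr[OF coord]])
    show "(\<lambda>n. expectation (\<lambda>x. cis (t * X n x i))) \<longlonglongrightarrow> char (distr \<mu> borel (\<lambda>x. x i)) t" for t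
      using char[of "\<lambda>j. if j = i then t else 0"] assms(4,5) by (simp add: inner_on_single char_distr[OF coord])
  qed
qed

lemma (in prob_space) bounded_in_prob_constant:
  assumes X: "X \<in> borel_measurable M"
  shows "bounded_in_prob (\<lambda>n. X)"
  unfolding bounded_in_prob_def
proof (intro allI impI)
  fix e :: real assume "e > 0"
  then obtain R where "prob {x \<in> space M. \<bar>X x\<bar> > R} < e" using ex_abs_tail_prob_less[OF X] by blast
  then show "\<exists>R. eventually_except e (\<lambda>n x. \<bar>X x\<bar> \<le> R)"
    unfolding eventually_except_def using X
    by (intro exI[of _ R] always_eventually allI bexI[of _ "{x \<in> space M. \<bar>X x\<bar> > R}"]) auto
qed

lemma (in prob_space) bounded_in_prob_uniform:
  assumes fin: "finite S" and X_bounded: "\<And>i. i \<in> S \<Longrightarrow> bounded_in_prob (\<lambda>n x. X n x i)" and e_pos: "e > 0"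
  shows "\<exists>R. eventually_except e (\<lambda>n x. \<forall>i\<in>S. \<bar>X n x i\<bar> \<le> R)"
proof -
  have "\<exists>R. eventually_except (e / real (card S)) (\<lambda>n x. \<bar>X n x i\<bar> \<le> R)" if "i \<in> S" for i
    using X_bounded[OF that] e_pos that fin card_gt_0_iff[of S] unfolding bounded_in_prob_def by fastforce
  then obtain r where r_bound: "\<And>i. i \<in> S \<Longrightarrow> eventually_except (e / real (card S)) (\<lambda>n x. \<bar>X n x i\<bar> \<le> r i)"
    by metis
  have r_le: "r i \<le> (\<Sum>i\<in>S. \<bar>r i\<bar>)" if "i \<in> S" for i
    using member_le_sum[of i S "\<lambda>i. \<bar>r i\<bar>"] that fin by simp
  have "eventually_except e (\<lambda>n x. \<forall>i\<in>S. \<bar>X n x i\<bar> \<le> r i)"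
    by (rule eventually_except_ball_finite[OF fin e_pos r_bound])
  then have "eventually_except e (\<lambda>n x. \<forall>i\<in>S. \<bar>X n x i\<bar> \<le> (\<Sum>i\<in>S. \<bar>r i\<bar>))"
    by (rule eventually_except_mono) (use r_le order_trans in \<open>blast intro: always_eventually\<close>)
  then show ?thesis by blast
qed

lemma borel_measurable_continuous_on_PiE:
  fixes X :: "'a \<Rightarrow> 'i::countable \<Rightarrow> real" and f :: "('i \<Rightarrow> real) \<Rightarrow> real"
  assumes f_continuous: "continuous_on (PiE S (\<lambda>_. UNIV)) f"
    and X_measurable: "\<And>i. i \<in> S \<Longrightarrow> (\<lambda>\<omega>. X \<omega> i) \<in> borel_measurable N"
    and ext: "\<And>\<omega>. \<omega> \<in> space N \<Longrightarrow> X \<omega> \<in> PiE S (\<lambda>_. UNIV)"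
  shows "(\<lambda>\<omega>. f (X \<omega>)) \<in> borel_measurable N"
proof (rule measurable_compose[where g=f])
  show "f \<in> borel_measurable (restrict_space borel (PiE S (\<lambda>_. UNIV)))"
    using f_continuous by (rule borel_measurable_continuous_on_restrict)
  have "(\<lambda>\<omega>. X \<omega> i) \<in> borel_measurable N" for i
  proof (cases "i \<in> S")
    case False
    then have "(\<lambda>\<omega>. X \<omega> i) \<in> borel_measurable N \<longleftrightarrow> (\<lambda>_. undefined :: real) \<in> borel_measurable N"
      using ext by (intro measurable_cong) (auto simp: PiE_def extensional_def)
    then show ?thesis by simp
  qed (rule X_measurable)
  then show "X \<in> measurable N (restrict_space borel (PiE S (\<lambda>_. UNIV)))"
    using ext by (intro measurable_restrict_space2 measurable_coordinatewise_then_product) auto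
qed

lemma (in prob_space) abs_expectation_diff_le:
  fixes f g :: "'a \<Rightarrow> real"
  assumes [measurable]: "f \<in> borel_measurable M" "g \<in> borel_measurable M"
    and f_bounded: "\<And>x. x \<in> space M \<Longrightarrow> \<bar>f x\<bar> \<le> C" "\<And>x. x \<in> space M \<Longrightarrow> \<bar>g x\<bar> \<le> C"
    and E_event: "E \<in> events" "prob E < e" "\<And>x. x \<in> space M - E \<Longrightarrow> \<bar>f x - g x\<bar> \<le> e"
  shows "\<bar>expectation f - expectation g\<bar> \<le> (2 * C + 1) * e"
proof -
  have integrable_f: "integrable M f" "integrable M g"
    using f_bounded by (auto intro: integrable_const_bound[of _ C])
  have C_nonneg: "0 \<le> C" using f_bounded not_empty abs_ge_zero order_trans by blast
  have "0 \<le> e" using E_event(2) measure_nonneg[of M E] by linarith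
  have diff: "\<bar>f x - g x\<bar> \<le> 2 * C" if "x \<in> space M" for x
    using f_bounded[OF that] by linarith
  have "\<bar>expectation f - expectation g\<bar> = norm (expectation (\<lambda>x. f x - g x))"
    using integrable_f by simp
  also have "\<dots> \<le> e + 2 * C * prob E"
    using E_event(1,3) diff \<open>0 \<le> e\<close> by (intro norm_expectation_le_off_event) auto
  also have "\<dots> \<le> e + 2 * C * e" using E_event(2) C_nonneg by (intro add_left_mono mult_left_mono) auto
  finally show ?thesis by (simp add: algebra_simps)
qed

lemma tendsto_if_approximable:
  fixes a :: "nat \<Rightarrow> real"
  assumes "\<And>e. e > 0 \<Longrightarrow> \<exists>b m. b \<longlonglongrightarrow> m \<and> (\<forall>\<^sub>F n in sequentially. \<bar>a n - b n\<bar> \<le> e) \<and> \<bar>l - m\<bar> \<le> e"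
  shows "a \<longlonglongrightarrow> l"
proof (rule tendstoI)
  fix \<delta> :: real assume "\<delta> > 0"
  then obtain b m where b_tendsto: "b \<longlonglongrightarrow> m" "\<forall>\<^sub>F n in sequentially. \<bar>a n - b n\<bar> \<le> \<delta> / 4" "\<bar>l - m\<bar> \<le> \<delta> / 4"
    using assms[of "\<delta> / 4"] by auto
  have "\<forall>\<^sub>F n in sequentially. dist (b n) m < \<delta> / 4" using tendstoD[OF b_tendsto(1), of "\<delta> / 4"] \<open>\<delta> > 0\<close> by simp
  with b_tendsto(2) show "\<forall>\<^sub>F n in sequentially. dist (a n) l < \<delta>"
  proof eventually_elim
    case (elim n)
    then show ?case using b_tendsto(3) \<open>\<delta> > 0\<close> unfolding dist_real_def by linarith
  qed
qed

context
  fixes M :: "'a measure" and \<mu> :: "(nat \<Rightarrow> real) measure" and S :: "nat set" and Xs :: "nat \<Rightarrow> 'a \<Rightarrow> nat \<Rightarrow> real"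
  assumes prob_M: "prob_space M" and prob_\<mu>: "prob_space \<mu>" and fin: "finite S"
    and ext: "\<And>n \<omega>. Xs n \<omega> \<in> extensional S"
    and meas: "\<And>n i. i \<in> S \<Longrightarrow> (\<lambda>\<omega>. Xs n \<omega> i) \<in> borel_measurable M"
    and sets_\<mu>: "sets \<mu> = sets (Pi\<^sub>M S (\<lambda>_. borel))"
    and char: "\<And>\<xi>. (\<lambda>n. \<integral>\<omega>. cis (inner_on S \<xi> (Xs n \<omega>)) \<partial>M) \<longlonglongrightarrow> (\<integral>x. cis (inner_on S \<xi> x) \<partial>\<mu>)"
begin

interpretation M: prob_space M by (rule prob_M)

interpretation \<mu>: prob_space \<mu> by (rule prob_\<mu>)

lemma coordinate_measurable: "i \<in> S \<Longrightarrow> (\<lambda>x. x i) \<in> borel_measurable \<mu>"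
  by (simp add: measurable_cong_sets[OF sets_\<mu> refl])

lemma coordinate_bounded_in_prob: "i \<in> S \<Longrightarrow> M.bounded_in_prob (\<lambda>n \<omega>. Xs n \<omega> i)"
  by (rule M.coordinate_bounded_in_prob_if_char_tendsto[OF prob_\<mu> coordinate_measurable meas fin _ char])

lemma Xs_in_PiE: "Xs n \<omega> \<in> PiE S (\<lambda>_. UNIV)"
  using ext by (simp add: PiE_def)

lemma space_\<mu>: "space \<mu> = PiE S (\<lambda>_. UNIV)"
  using sets_eq_imp_space_eq[OF sets_\<mu>] by (simp add: space_PiM)

lemma continuous_on_PiE_measurable:
  fixes h :: "(nat \<Rightarrow> real) \<Rightarrow> real"
  assumes "continuous_on (PiE S (\<lambda>_. UNIV)) h"
  shows "(\<lambda>\<omega>. h (Xs n \<omega>)) \<in> borel_measurable M" "h \<in> borel_measurable \<mu>"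
  using borel_measurable_continuous_on_PiE[OF assms meas Xs_in_PiE]
    borel_measurable_continuous_on_PiE[OF assms coordinate_measurable, of "\<lambda>x. x"] space_\<mu> by auto

lemma trig_poly_approximates_in_prob:
  assumes f_continuous: "continuous_on (PiE S (\<lambda>_. UNIV)) f" and f_bounded: "\<And>x. x \<in> PiE S (\<lambda>_. UNIV) \<Longrightarrow> \<bar>f x\<bar> \<le> B"
    and e_pos: "0 < e" "e \<le> 1"
  shows "\<exists>g \<in> trig_poly S. (\<forall>\<^sub>F n in sequentially. \<bar>(\<integral>\<omega>. f (Xs n \<omega>) \<partial>M) - (\<integral>\<omega>. g (Xs n \<omega>) \<partial>M)\<bar> \<le> (2 * B + 3) * e) \<and>
    \<bar>(\<integral>x. f x \<partial>\<mu>) - (\<integral>x. g x \<partial>\<mu>)\<bar> \<le> (2 * B + 3) * e"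
proof -
  let ?E = "PiE S (\<lambda>_. UNIV :: real set)"
  obtain R1 where X_bounded: "M.eventually_except e (\<lambda>n \<omega>. \<forall>i\<in>S. \<bar>Xs n \<omega> i\<bar> \<le> R1)"
    using M.bounded_in_prob_uniform[OF fin, of Xs] coordinate_bounded_in_prob e_pos(1) by blast
  obtain R2 where "\<mu>.eventually_except e (\<lambda>n x. \<forall>i\<in>S. \<bar>x i\<bar> \<le> R2)"
    using \<mu>.bounded_in_prob_uniform[OF fin, of "\<lambda>_ x. x"]
      \<mu>.bounded_in_prob_constant[OF coordinate_measurable] e_pos(1) by blast
  then obtain A where A_event: "A \<in> \<mu>.events" "\<mu>.prob A < e" "\<And>x. x \<in> space \<mu> - A \<Longrightarrow> \<forall>i\<in>S. \<bar>x i\<bar> \<le> R2"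
    unfolding \<mu>.eventually_except_def eventually_const_iff by auto
  define R where "R = max \<bar>R1\<bar> \<bar>R2\<bar>"
  let ?K = "PiE S (\<lambda>_. {-R..R})"
  have in_cube: "x \<in> ?K" if "x \<in> ?E" "\<forall>i\<in>S. \<bar>x i\<bar> \<le> R1 \<or> \<bar>x i\<bar> \<le> R2" for x
    using that by (force simp: PiE_iff R_def)
  have "continuous_on ?K f" by (rule continuous_on_subset[OF f_continuous]) auto
  moreover have "0 \<le> R" "\<And>x. x \<in> ?K \<Longrightarrow> \<bar>f x\<bar> \<le> B" using f_bounded by (auto simp: R_def)
  ultimately obtain g where g_trig: "g \<in> trig_poly S" "\<And>x. x \<in> ?K \<Longrightarrow> \<bar>f x - g x\<bar> \<le> e" "\<And>x. \<bar>g x\<bar> \<le> B + e"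
    using trig_poly_dense[OF _ _ e_pos(1) _ fin, of R f B] by blast
  have bounds: "\<bar>g x\<bar> \<le> B + 1" "x \<in> ?E \<Longrightarrow> \<bar>f x\<bar> \<le> B + 1" for x
    using g_trig(3)[of x] f_bounded[of x] e_pos(2) by auto
  have cont_g: "continuous_on ?E g" by (rule trig_poly_continuous[OF g_trig(1)])
  note f_meas = continuous_on_PiE_measurable[OF f_continuous] and g_meas = continuous_on_PiE_measurable[OF cont_g]
  have "\<bar>(\<integral>x. f x \<partial>\<mu>) - (\<integral>x. g x \<partial>\<mu>)\<bar> \<le> (2 * (B + 1) + 1) * e"
    by (rule \<mu>.abs_expectation_diff_le[OF f_meas(2) g_meas(2) _ _ A_event(1,2)])
       (use bounds g_trig(2) in_cube A_event(3) space_\<mu> in auto)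
  moreover have "\<forall>\<^sub>F n in sequentially. \<bar>(\<integral>\<omega>. f (Xs n \<omega>) \<partial>M) - (\<integral>\<omega>. g (Xs n \<omega>) \<partial>M)\<bar> \<le> (2 * (B + 1) + 1) * e"
    using X_bounded unfolding M.eventually_except_def
  proof eventually_elim
    case (elim n)
    then obtain A where A_event: "A \<in> M.events" "M.prob A < e" "\<forall>\<omega>\<in>space M - A. \<forall>i\<in>S. \<bar>Xs n \<omega> i\<bar> \<le> R1" by blast
    show ?case
      by (rule M.abs_expectation_diff_le[OF f_meas(1) g_meas(1) _ _ A_event(1,2)])
         (use bounds g_trig(2) in_cube A_event(3) Xs_in_PiE in auto)
  qed
  ultimately show ?thesis using g_trig(1) by (auto simp: algebra_simps)
qed

text \<open>Tightness comes from the one-dimensional continuity theorem applied to the coordinates.\<close>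
theorem levy_continuity_PiM: "conv_dist_to M S Xs \<mu>"
  unfolding conv_dist_to_def
proof (intro allI impI tendsto_if_approximable)
  fix f :: "(nat \<Rightarrow> real) \<Rightarrow> real" and \<delta> :: real
  assume f_bounded_continuous: "continuous_on (PiE S (\<lambda>_. UNIV)) f \<and> bounded (f ` PiE S (\<lambda>_. UNIV))"
    and \<delta>_pos: "\<delta> > 0"
  obtain B where "B > 0" "\<forall>y \<in> f ` PiE S (\<lambda>_. UNIV). norm y \<le> B"
    using f_bounded_continuous bounded_pos by blast
  then have f_bound: "B \<ge> 0" "\<And>x. x \<in> PiE S (\<lambda>_. UNIV) \<Longrightarrow> \<bar>f x\<bar> \<le> B" by auto
  define e where "e = min 1 (\<delta> / (2 * B + 3))"
  have e_pos: "0 < e" "e \<le> 1" "(2 * B + 3) * e \<le> \<delta>"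
    using \<delta>_pos f_bound(1) mult_left_mono[of e "\<delta> / (2 * B + 3)" "2 * B + 3"] by (auto simp: e_def)
  obtain g where g_trig: "g \<in> trig_poly S"
    "\<forall>\<^sub>F n in sequentially. \<bar>(\<integral>\<omega>. f (Xs n \<omega>) \<partial>M) - (\<integral>\<omega>. g (Xs n \<omega>) \<partial>M)\<bar> \<le> (2 * B + 3) * e"
    "\<bar>(\<integral>x. f x \<partial>\<mu>) - (\<integral>x. g x \<partial>\<mu>)\<bar> \<le> (2 * B + 3) * e"
    using trig_poly_approximates_in_prob[OF conjunct1[OF f_bounded_continuous] f_bound(2) e_pos(1,2)] by blast
  have "(\<lambda>n. \<integral>\<omega>. g (Xs n \<omega>) \<partial>M) \<longlonglongrightarrow> (\<integral>x. g x \<partial>\<mu>)"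
    using trig_poly_expectation_tendsto[OF prob_M prob_\<mu> meas coordinate_measurable char g_trig(1)] by blast
  moreover have "\<forall>\<^sub>F n in sequentially. \<bar>(\<integral>\<omega>. f (Xs n \<omega>) \<partial>M) - (\<integral>\<omega>. g (Xs n \<omega>) \<partial>M)\<bar> \<le> \<delta>"
    using g_trig(2) by eventually_elim (use e_pos(3) in linarith)
  ultimately show "\<exists>b m. b \<longlonglongrightarrow> m \<and> (\<forall>\<^sub>F n in sequentially. \<bar>(\<integral>\<omega>. f (Xs n \<omega>) \<partial>M) - b n\<bar> \<le> \<delta>) \<and>
      \<bar>(\<integral>x. f x \<partial>\<mu>) - m\<bar> \<le> \<delta>"
    using g_trig(3) e_pos(3) by (meson order_trans)
qed

end

section \<open>Positive definite matrices and Gaussian measures\<close>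

definition mat_vec :: "'i set \<Rightarrow> ('i \<Rightarrow> 'i \<Rightarrow> real) \<Rightarrow> ('i \<Rightarrow> real) \<Rightarrow> 'i \<Rightarrow> real" where
  "mat_vec S A v i = (\<Sum>j\<in>S. A i j * v j)"

definition quad_form :: "'i set \<Rightarrow> ('i \<Rightarrow> 'i \<Rightarrow> real) \<Rightarrow> ('i \<Rightarrow> real) \<Rightarrow> real" where
  "quad_form S A v = (\<Sum>i\<in>S. \<Sum>j\<in>S. v i * A i j * v j)"

definition l1_norm :: "'i set \<Rightarrow> ('i \<Rightarrow> real) \<Rightarrow> real" where
  "l1_norm S v = (\<Sum>i\<in>S. \<bar>v i\<bar>)"

definition symmetric_on :: "'i set \<Rightarrow> ('i \<Rightarrow> 'i \<Rightarrow> real) \<Rightarrow> bool" where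
  "symmetric_on S A \<longleftrightarrow> (\<forall>i\<in>S. \<forall>j\<in>S. A i j = A j i)"

lemma symmetric_onD: "symmetric_on S A \<Longrightarrow> i \<in> S \<Longrightarrow> j \<in> S \<Longrightarrow> A i j = A j i"
  by (simp add: symmetric_on_def)

lemma l1_norm_nonneg: "0 \<le> l1_norm S v"
  by (simp add: l1_norm_def sum_nonneg)

lemma abs_le_l1_norm: "finite S \<Longrightarrow> i \<in> S \<Longrightarrow> \<bar>v i\<bar> \<le> l1_norm S v"
  unfolding l1_norm_def by (intro member_le_sum) auto

lemma mat_vec_cong:
  "(\<And>j. j \<in> S \<Longrightarrow> A i j = A' i j) \<Longrightarrow> (\<And>j. j \<in> S \<Longrightarrow> v j = v' j) \<Longrightarrow> mat_vec S A v i = mat_vec S A' v' i"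
  by (simp add: mat_vec_def)

lemma abs_mat_vec_le:
  assumes "\<And>j. j \<in> S \<Longrightarrow> \<bar>A i j\<bar> \<le> a"
  shows "\<bar>mat_vec S A v i\<bar> \<le> a * l1_norm S v"
proof -
  have "\<bar>mat_vec S A v i\<bar> \<le> (\<Sum>j\<in>S. \<bar>A i j * v j\<bar>)" unfolding mat_vec_def by (rule sum_abs)
  also have "\<dots> \<le> (\<Sum>j\<in>S. a * \<bar>v j\<bar>)"
    using assms by (intro sum_mono) (auto simp: abs_mult intro!: mult_right_mono)
  finally show ?thesis by (simp add: l1_norm_def sum_distrib_left)
qed

lemma quad_form_eq_inner_on: "quad_form S A v = inner_on S v (mat_vec S A v)"
  by (simp add: quad_form_def inner_on_def mat_vec_def sum_distrib_left mult.assoc)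

lemma quad_form_cong: "(\<And>i. i \<in> S \<Longrightarrow> v i = w i) \<Longrightarrow> quad_form S A v = quad_form S A w"
  by (simp add: quad_form_def)

lemma quad_form_scale: "quad_form S A (\<lambda>i. c * v i) = c\<^sup>2 * quad_form S A v"
  by (simp add: quad_form_def power2_eq_square sum_distrib_left mult_ac)

lemma quad_form_identity:
  assumes "finite S"
  shows "quad_form S (\<lambda>i j. if i = j then 1 else 0) v = (\<Sum>i\<in>S. (v i)\<^sup>2)"
proof -
  have "(\<Sum>j\<in>S. v i * (if i = j then 1 else 0) * v j) = (v i)\<^sup>2" if "i \<in> S" for i
  proof -
    have "(\<Sum>j\<in>S. v i * (if i = j then 1 else 0) * v j) = (\<Sum>j\<in>S. if j = i then (v i)\<^sup>2 else 0)"
      by (intro sum.cong) (auto simp: power2_eq_square)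
    then show ?thesis using assms that by simp
  qed
  then show ?thesis unfolding quad_form_def by (rule sum.cong[OF refl])
qed

lemma symmetric_on_subset: "symmetric_on S A \<Longrightarrow> R \<subseteq> S \<Longrightarrow> symmetric_on R A"
  by (auto simp: symmetric_on_def)

lemma inner_on_mat_vec_symmetric:
  assumes "symmetric_on S A"
  shows "inner_on S v (mat_vec S A w) = inner_on S w (mat_vec S A v)"
proof -
  have "inner_on S v (mat_vec S A w) = (\<Sum>i\<in>S. \<Sum>j\<in>S. v i * A i j * w j)"
    by (simp add: inner_on_def mat_vec_def sum_distrib_left mult.assoc)
  also have "\<dots> = (\<Sum>j\<in>S. \<Sum>i\<in>S. v i * A i j * w j)" by (rule sum.swap)
  also have "\<dots> = inner_on S w (mat_vec S A v)"
    unfolding inner_on_def mat_vec_def sum_distrib_left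
    by (intro sum.cong refl) (simp add: symmetric_onD[OF assms] mult_ac)
  finally show ?thesis .
qed

lemma quad_form_add:
  assumes "symmetric_on S A"
  shows "quad_form S A (\<lambda>i. v i + w i) = quad_form S A v + 2 * inner_on S w (mat_vec S A v) + quad_form S A w"
proof -
  have "quad_form S A (\<lambda>i. v i + w i) = quad_form S A v + inner_on S v (mat_vec S A w)
      + (inner_on S w (mat_vec S A v) + quad_form S A w)"
    by (simp add: quad_form_eq_inner_on inner_on_add_left mat_vec_def distrib_left sum.distrib
        inner_on_def)
  then show ?thesis using inner_on_mat_vec_symmetric[OF assms, of v w] by simp
qed

lemma quad_form_perturb:
  assumes "\<And>i j. i \<in> S \<Longrightarrow> j \<in> S \<Longrightarrow> \<bar>A i j - C i j\<bar> \<le> \<delta>"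
  shows "quad_form S C v - \<delta> * (l1_norm S v)\<^sup>2 \<le> quad_form S A v"
proof -
  have "v i * C i j * v j - \<delta> * (\<bar>v i\<bar> * \<bar>v j\<bar>) \<le> v i * A i j * v j" if "i \<in> S" "j \<in> S" for i j
  proof -
    have "\<bar>v i * (A i j - C i j) * v j\<bar> \<le> \<delta> * (\<bar>v i\<bar> * \<bar>v j\<bar>)"
      using mult_right_mono[OF assms[OF that], of "\<bar>v i\<bar> * \<bar>v j\<bar>"] by (simp add: abs_mult mult_ac)
    then show ?thesis by (simp add: algebra_simps abs_le_iff)
  qed
  then have "(\<Sum>i\<in>S. \<Sum>j\<in>S. v i * C i j * v j - \<delta> * (\<bar>v i\<bar> * \<bar>v j\<bar>)) \<le> quad_form S A v"
    unfolding quad_form_def by (intro sum_mono)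
  moreover have "\<delta> * (l1_norm S v)\<^sup>2 = (\<Sum>i\<in>S. \<Sum>j\<in>S. \<delta> * (\<bar>v i\<bar> * \<bar>v j\<bar>))"
    unfolding l1_norm_def power2_eq_square sum_product by (simp only: sum_distrib_left)
  ultimately show ?thesis by (simp add: quad_form_def sum_subtractf)
qed

lemma posdef_on_iff:
  "posdef_on S A \<longleftrightarrow> symmetric_on S A \<and> (\<forall>v. (\<exists>i\<in>S. v i \<noteq> 0) \<longrightarrow> 0 < quad_form S A v)"
  by (simp add: posdef_on_def symmetric_on_def quad_form_def)

lemma posdef_on_symmetric: "posdef_on S A \<Longrightarrow> symmetric_on S A"
  by (simp add: posdef_on_iff)

lemma posdef_on_quad_form_pos: "posdef_on S A \<Longrightarrow> i \<in> S \<Longrightarrow> v i \<noteq> 0 \<Longrightarrow> 0 < quad_form S A v"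
  unfolding posdef_on_iff by blast

lemma inner_on_zero_extend:
  assumes "R \<subseteq> S" "finite S"
  shows "inner_on S (\<lambda>i. if i \<in> R then v i else 0) w = inner_on R v w"
  unfolding inner_on_def using assms by (intro sum.mono_neutral_cong_right) auto

lemma quad_form_zero_extend:
  assumes "R \<subseteq> S" "finite S"
  shows "quad_form S A (\<lambda>i. if i \<in> R then v i else 0) = quad_form R A v"
  unfolding quad_form_def using assms
  by (intro sum.mono_neutral_cong_right ballI sum.neutral) (auto intro!: sum.mono_neutral_cong_right)

lemma posdef_on_subset:
  assumes A_posdef: "posdef_on S A" and "R \<subseteq> S" "finite S"
  shows "posdef_on R A"
  unfolding posdef_on_iff
proof (intro conjI allI impI)
  fix v :: "nat \<Rightarrow> real" assume "\<exists>i\<in>R. v i \<noteq> 0"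
  then obtain i where "i \<in> R" "v i \<noteq> 0" by blast
  then have "0 < quad_form S A (\<lambda>i. if i \<in> R then v i else 0)"
    using \<open>R \<subseteq> S\<close> by (intro posdef_on_quad_form_pos[OF A_posdef, of i]) auto
  then show "0 < quad_form R A v" by (simp add: quad_form_zero_extend assms(2,3))
qed (use symmetric_on_subset[OF posdef_on_symmetric[OF A_posdef] \<open>R \<subseteq> S\<close>] in simp)

lemma posdef_on_diag_pos:
  assumes "posdef_on S A" "finite S" "a \<in> S"
  shows "0 < A a a"
  using posdef_on_quad_form_pos[OF posdef_on_subset[OF assms(1), of "{a}"], of a "\<lambda>_. 1"] assms
  by (simp add: quad_form_def)

lemma compact_l1_sphere:
  fixes S :: "'i set"
  shows "compact (PiE S (\<lambda>_. {-1..1}) \<inter> {v. l1_norm S v = 1})"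
proof -
  have "continuous_on UNIV (l1_norm S :: ('i \<Rightarrow> real) \<Rightarrow> real)"
    unfolding l1_norm_def by (intro continuous_on_sum continuous_on_rabs continuous_on_product_coordinates)
  then show ?thesis
    by (intro compact_Int_closed[OF compact_PiE_box] closed_Collect_eq continuous_on_const)
qed

lemma ex_quad_form_minimizer_l1_sphere:
  assumes fin: "finite S" and "S \<noteq> {}"
  shows "\<exists>v\<^sub>0 :: nat \<Rightarrow> real. l1_norm S v\<^sub>0 = 1 \<and> (\<forall>v. l1_norm S v = 1 \<longrightarrow> quad_form S A v\<^sub>0 \<le> quad_form S A v)"
proof -
  define K where "K = PiE S (\<lambda>_. {-1..1}) \<inter> {v :: nat \<Rightarrow> real. l1_norm S v = 1}"
  obtain a where a_in_S: "a \<in> S" using \<open>S \<noteq> {}\<close> by blast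
  have "restrict (\<lambda>i. if i = a then 1 else 0) S \<in> K"
    unfolding K_def l1_norm_def using a_in_S fin by (auto simp: if_distrib[of abs] cong: if_cong sum.cong)
  then have nonempty: "K \<noteq> {}" by blast
  have "continuous_on K (quad_form S A)"
    unfolding quad_form_def by (intro continuous_on_sum continuous_on_mult continuous_on_const
        continuous_on_subset[OF continuous_on_product_coordinates]) auto
  then obtain v\<^sub>0 where v\<^sub>0_minimal: "v\<^sub>0 \<in> K" "\<And>v. v \<in> K \<Longrightarrow> quad_form S A v\<^sub>0 \<le> quad_form S A v"
    using continuous_attains_inf[OF compact_l1_sphere[of S, folded K_def] nonempty] by blast
  have "quad_form S A v\<^sub>0 \<le> quad_form S A v" if "l1_norm S v = 1" for v
  proof -
    have "\<bar>v i\<bar> \<le> 1" if "i \<in> S" for i using abs_le_l1_norm[OF fin that, of v] \<open>l1_norm S v = 1\<close> by simp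
    then have "restrict v S \<in> K" using that by (auto simp: K_def l1_norm_def abs_le_iff minus_le_iff)
    then have "quad_form S A v\<^sub>0 \<le> quad_form S A (restrict v S)" by (rule v\<^sub>0_minimal)
    also have "\<dots> = quad_form S A v" by (rule quad_form_cong) simp
    finally show ?thesis .
  qed
  then show ?thesis using v\<^sub>0_minimal(1) by (auto simp: K_def)
qed

lemma posdef_on_l1_lower_bound:
  assumes A_posdef: "posdef_on S A" and fin: "finite S"
  shows "\<exists>\<kappa>>0. \<forall>v. \<kappa> * (l1_norm S v)\<^sup>2 \<le> quad_form S A v"
proof (cases "S = {}")
  case True
  then show ?thesis by (auto simp: l1_norm_def quad_form_def intro: exI[of _ 1])
next
  case False
  then obtain v\<^sub>0 :: "nat \<Rightarrow> real" where v\<^sub>0_sphere: "l1_norm S v\<^sub>0 = 1"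
    and v\<^sub>0_minimal: "\<And>v. l1_norm S v = 1 \<Longrightarrow> quad_form S A v\<^sub>0 \<le> quad_form S A v"
    using ex_quad_form_minimizer_l1_sphere[OF fin] by blast
  have "quad_form S A v\<^sub>0 * (l1_norm S v)\<^sup>2 \<le> quad_form S A v" for v
  proof (cases "l1_norm S v = 0")
    case True
    then have "quad_form S A v = 0"
      using abs_le_l1_norm[OF fin, of _ v] by (simp add: quad_form_def)
    then show ?thesis using True by simp
  next
    case False
    define n where "n = l1_norm S v"
    have n_pos: "n > 0" using False l1_norm_nonneg[of S v] by (simp add: n_def)
    then have "l1_norm S (\<lambda>i. 1 / n * v i) = 1" by (simp add: l1_norm_def n_def flip: sum_divide_distrib)
    then have "quad_form S A v\<^sub>0 \<le> quad_form S A (\<lambda>i. 1 / n * v i)" by (rule v\<^sub>0_minimal)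
    also have "\<dots> = quad_form S A v / n\<^sup>2" unfolding quad_form_scale by (simp add: power_divide)
    finally show ?thesis using n_pos by (simp add: n_def[symmetric] pos_le_divide_eq)
  qed
  moreover have "\<exists>i\<in>S. v\<^sub>0 i \<noteq> 0" using v\<^sub>0_sphere by (auto simp: l1_norm_def intro: ccontr)
  then have "0 < quad_form S A v\<^sub>0" using posdef_on_quad_form_pos[OF A_posdef] by blast
  ultimately show ?thesis by blast
qed

definition schur_complement :: "'i \<Rightarrow> ('i \<Rightarrow> 'i \<Rightarrow> real) \<Rightarrow> 'i \<Rightarrow> 'i \<Rightarrow> real" where
  "schur_complement a A i j = A i j - A i a * A a j / A a a"

lemma sum_column_eq_mat_vec:
  assumes "symmetric_on (insert a S) A"
  shows "(\<Sum>i\<in>S. v i * A i a) = mat_vec S A v a"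
  unfolding mat_vec_def by (intro sum.cong refl) (simp add: symmetric_onD[OF assms, of _ a] mult.commute)

lemma quad_form_insert:
  assumes sym: "symmetric_on (insert a S) A" and "finite S" "a \<notin> S"
  shows "quad_form (insert a S) A v = (v a)\<^sup>2 * A a a + 2 * v a * mat_vec S A v a + quad_form S A v"
proof -
  have "quad_form (insert a S) A v
      = v a * A a a * v a + v a * mat_vec S A v a + ((\<Sum>i\<in>S. v i * A i a) * v a + quad_form S A v)"
    using assms(2,3) unfolding quad_form_def mat_vec_def
    by (simp add: sum.distrib sum_distrib_left sum_distrib_right mult.assoc)
  then show ?thesis by (simp add: sum_column_eq_mat_vec[OF sym] power2_eq_square)
qed

lemma mat_vec_schur_complement:
  "mat_vec S (schur_complement a A) v i = mat_vec S A v i - A i a / A a a * mat_vec S A v a"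
  by (simp add: mat_vec_def schur_complement_def left_diff_distrib sum_subtractf sum_distrib_left mult.assoc)

lemma quad_form_schur_complement:
  assumes sym: "symmetric_on (insert a S) A"
  shows "quad_form S (schur_complement a A) v = quad_form S A v - (mat_vec S A v a)\<^sup>2 / A a a"
proof -
  define c where "c = mat_vec S A v a / A a a"
  have "mat_vec S (schur_complement a A) v i = mat_vec S A v i - A i a * c" for i
    by (simp add: mat_vec_schur_complement c_def)
  then have "quad_form S (schur_complement a A) v = quad_form S A v - (\<Sum>i\<in>S. v i * A i a) * c"
    by (simp add: quad_form_eq_inner_on inner_on_def right_diff_distrib sum_subtractf sum_distrib_right mult.assoc)
  then show ?thesis by (simp add: sum_column_eq_mat_vec[OF sym] c_def power2_eq_square)
qed

lemma posdef_on_schur_complement: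
  assumes A_posdef: "posdef_on (insert a S) A" and fin: "finite S" and a_notin: "a \<notin> S"
  shows "posdef_on S (schur_complement a A)"
  unfolding posdef_on_iff
proof (intro conjI allI impI)
  note sym = posdef_on_symmetric[OF A_posdef]
  have pivot_pos: "A a a > 0" using posdef_on_diag_pos[OF A_posdef] fin by simp
  have "schur_complement a A i j = schur_complement a A j i" if "i \<in> S" "j \<in> S" for i j
    using symmetric_onD[OF sym, of i j] symmetric_onD[OF sym, of i a] symmetric_onD[OF sym, of j a] that
    by (simp add: schur_complement_def)
  then show "symmetric_on S (schur_complement a A)" unfolding symmetric_on_def by blast
  fix v :: "nat \<Rightarrow> real" assume "\<exists>i\<in>S. v i \<noteq> 0"
  then obtain i where nonzero: "i \<in> S" "v i \<noteq> 0" by blast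
  let ?r = "mat_vec S A v a"
  let ?w = "v(a := - ?r / A a a)"
  have mat_vec_at_a: "mat_vec S A ?w a = ?r" "quad_form S A ?w = quad_form S A v"
    using a_notin by (auto intro!: mat_vec_cong quad_form_cong)
  have "0 < quad_form (insert a S) A ?w"
    using nonzero a_notin by (intro posdef_on_quad_form_pos[OF A_posdef, of i]) auto
  also have "\<dots> = quad_form S (schur_complement a A) v"
    unfolding quad_form_insert[OF sym fin a_notin] quad_form_schur_complement[OF sym] mat_vec_at_a
    using pivot_pos by (simp add: power2_eq_square field_simps)
  finally show "0 < quad_form S (schur_complement a A) v" .
qed

lemma posdef_on_solvable:
  assumes "finite S" "posdef_on S A"
  shows "\<exists>v. \<forall>i\<in>S. mat_vec S A v i = b i"
  using assms
proof (induction S arbitrary: A b rule: finite_induct)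
  case (insert a S)
  have pivot_pos: "A a a > 0" using posdef_on_diag_pos[OF insert.prems] insert.hyps by simp
  obtain w where w_solves: "\<forall>i\<in>S. mat_vec S (schur_complement a A) w i = b i - A i a * b a / A a a"
    using insert.IH[OF posdef_on_schur_complement[OF insert.prems insert.hyps],
        of "\<lambda>i. b i - A i a * b a / A a a"] by blast
  let ?v = "w(a := (b a - mat_vec S A w a) / A a a)"
  have expand: "mat_vec (insert a S) A ?v i = A i a * ?v a + mat_vec S A w i" for i
  proof -
    have "mat_vec S A ?v i = mat_vec S A w i" using insert.hyps by (intro mat_vec_cong) auto
    then show ?thesis using insert.hyps by (simp add: mat_vec_def)
  qed
  have "mat_vec (insert a S) A ?v i = b i" if "i \<in> insert a S" for i
  proof (cases "i = a")
    case False
    then have "mat_vec S A w i - A i a / A a a * mat_vec S A w a = b i - A i a * b a / A a a"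
      using that w_solves by (simp add: mat_vec_schur_complement)
    then show ?thesis unfolding expand by (simp add: diff_divide_distrib right_diff_distrib)
  qed (use pivot_pos in \<open>simp add: expand\<close>)
  then show ?case by blast
qed simp

lemma posdef_on_cholesky:
  assumes "finite S" "posdef_on S A"
  shows "\<exists>L. \<forall>v. quad_form S A v = (\<Sum>k\<in>S. (\<Sum>i\<in>S. L i k * v i)\<^sup>2)"
  using assms
proof (induction S arbitrary: A rule: finite_induct)
  case empty
  then show ?case by (simp add: quad_form_def)
next
  case (insert a S)
  have pivot_pos: "A a a > 0" using posdef_on_diag_pos[OF insert.prems] insert.hyps by simp
  note sym = posdef_on_symmetric[OF insert.prems]
  obtain L where L_factor: "\<And>v. quad_form S (schur_complement a A) v = (\<Sum>k\<in>S. (\<Sum>i\<in>S. L i k * v i)\<^sup>2)"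
    using insert.IH[OF posdef_on_schur_complement[OF insert.prems insert.hyps]] by blast
  define L' where "L' i k = (if k = a then A a i / sqrt (A a a) else if i = a then 0 else L i k)" for i k
  have "quad_form (insert a S) A v = (\<Sum>k\<in>insert a S. (\<Sum>i\<in>insert a S. L' i k * v i)\<^sup>2)" for v
  proof -
    have "(\<Sum>i\<in>insert a S. L' i k * v i) = (\<Sum>i\<in>S. L i k * v i)" if "k \<in> S" for k
      using insert.hyps that by (auto simp: L'_def intro!: sum.cong)
    then have square_sum: "(\<Sum>k\<in>insert a S. (\<Sum>i\<in>insert a S. L' i k * v i)\<^sup>2)
        = (\<Sum>i\<in>insert a S. L' i a * v i)\<^sup>2 + quad_form S (schur_complement a A) v"
      using insert.hyps by (simp add: L_factor)
    have "(\<Sum>i\<in>insert a S. L' i a * v i) = (A a a * v a + mat_vec S A v a) / sqrt (A a a)"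
      using insert.hyps by (simp add: L'_def mat_vec_def add_divide_distrib sum_divide_distrib)
    then have "(\<Sum>i\<in>insert a S. L' i a * v i)\<^sup>2 = (A a a * v a + mat_vec S A v a)\<^sup>2 / A a a"
      using pivot_pos by (simp add: power_divide)
    then show ?thesis
      unfolding square_sum quad_form_insert[OF sym insert.hyps] quad_form_schur_complement[OF sym]
      using pivot_pos by (simp add: power2_eq_square field_simps)
  qed
  then show ?case by blast
qed

lemma posdef_on_kernel_trivial:
  assumes "posdef_on S A" "\<And>i. i \<in> S \<Longrightarrow> mat_vec S A v i = 0" "i \<in> S"
  shows "v i = 0"
proof (rule ccontr)
  assume "v i \<noteq> 0"
  then have "0 < quad_form S A v" using posdef_on_quad_form_pos[OF assms(1,3)] by blast
  then show False using assms(2) by (simp add: quad_form_eq_inner_on inner_on_def)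
qed

lemma inv_on_right_inverse:
  assumes fin: "finite S" and A_posdef: "posdef_on S A" and "i \<in> S" "j \<in> S"
  shows "mat_vec S A (\<lambda>k. inv_on S A k j) i = (if i = j then 1 else 0)"
proof -
  let ?P = "\<lambda>B. (\<forall>i\<in>S. \<forall>j\<in>S. (\<Sum>k\<in>S. A i k * B k j) = (if i = j then 1 else 0)) \<and>
    (\<forall>i j. i \<notin> S \<or> j \<notin> S \<longrightarrow> B i j = (0::real))"
  have "\<exists>!B. ?P B"
  proof (rule ex_ex1I)
    have "\<forall>j. \<exists>v. \<forall>i\<in>S. mat_vec S A v i = (if i = j then 1 else 0)"
      by (intro allI posdef_on_solvable[OF fin A_posdef])
    then obtain V where V_columns: "\<And>j i. i \<in> S \<Longrightarrow> (\<Sum>k\<in>S. A i k * V j k) = (if i = j then 1 else 0)"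
      unfolding mat_vec_def by metis
    show "\<exists>B. ?P B"
      by (rule exI[of _ "\<lambda>i j. if i \<in> S \<and> j \<in> S then V j i else 0"]) (auto simp: V_columns cong: sum.cong)
  next
    fix B C assume B_inverse: "?P B" and C_inverse: "?P C"
    show "B = C"
    proof (intro ext)
      fix i j
      show "B i j = C i j"
      proof (cases "i \<in> S \<and> j \<in> S")
        case True
        have "B i j - C i j = 0"
          by (rule posdef_on_kernel_trivial[OF A_posdef, of "\<lambda>k. B k j - C k j"])
             (use B_inverse C_inverse True in \<open>auto simp: mat_vec_def right_diff_distrib sum_subtractf\<close>)
        then show ?thesis by simp
      qed (use B_inverse C_inverse in auto)
    qed
  qed
  then have "?P (inv_on S A)" unfolding inv_on_def by (rule theI')
  then show ?thesis using assms(3,4) by (simp add: mat_vec_def)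
qed

lemma mat_vec_inv_on:
  assumes "finite S" "posdef_on S A" "i \<in> S"
  shows "mat_vec S A (mat_vec S (inv_on S A) v) i = v i"
proof -
  have "mat_vec S A (mat_vec S (inv_on S A) v) i = (\<Sum>k\<in>S. \<Sum>j\<in>S. A i k * (inv_on S A k j * v j))"
    by (simp add: mat_vec_def sum_distrib_left)
  also have "\<dots> = (\<Sum>j\<in>S. \<Sum>k\<in>S. A i k * (inv_on S A k j * v j))" by (rule sum.swap)
  also have "\<dots> = (\<Sum>j\<in>S. mat_vec S A (\<lambda>k. inv_on S A k j) i * v j)"
    by (simp add: mat_vec_def sum_distrib_right mult.assoc)
  also have "\<dots> = (\<Sum>j\<in>S. (if i = j then 1 else 0) * v j)"
    using inv_on_right_inverse[OF assms(1-3)] by (intro sum.cong) auto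
  finally show ?thesis using assms(1,3) by (simp add: if_distrib[of "\<lambda>u. u * _"] cong: if_cong)
qed

lemma inner_on_inv_on_mat_vec:
  assumes "finite S" "posdef_on S A"
  shows "inner_on S (mat_vec S (inv_on S A) v) (mat_vec S A w) = inner_on S v w"
proof -
  have "inner_on S (mat_vec S (inv_on S A) v) (mat_vec S A w)
      = inner_on S w (mat_vec S A (mat_vec S (inv_on S A) v))"
    by (rule inner_on_mat_vec_symmetric[OF posdef_on_symmetric[OF assms(2)]])
  also have "\<dots> = inner_on S w v" using mat_vec_inv_on[OF assms] by (intro inner_on_cong) auto
  finally show ?thesis by (simp add: inner_on_commute)
qed

lemma symmetric_on_inv_on:
  assumes "finite S" "posdef_on S A"
  shows "symmetric_on S (inv_on S A)"
  unfolding symmetric_on_def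
proof (intro ballI)
  have col: "inner_on S v (mat_vec S A (\<lambda>k. inv_on S A k j)) = v j" if "j \<in> S" for v j
  proof -
    have "inner_on S v (mat_vec S A (\<lambda>k. inv_on S A k j)) = inner_on S (\<lambda>i. if i = j then 1 else 0) v"
      unfolding inner_on_commute[of S v] using inv_on_right_inverse[OF assms _ that] by (intro inner_on_cong) auto
    then show ?thesis using inner_on_single[OF assms(1) that] by simp
  qed
  show "inv_on S A i j = inv_on S A j i" if "i \<in> S" "j \<in> S" for i j
    using col[OF that(1)] col[OF that(2)] inner_on_mat_vec_symmetric[OF posdef_on_symmetric[OF assms(2)]] by metis
qed

lemma mat_vec_sandwich:
  "mat_vec S (sandwich S A B) v i = mat_vec S (inv_on S A) (mat_vec S B (mat_vec S (inv_on S A) v)) i"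
proof -
  let ?t = "\<lambda>j k l. inv_on S A i k * B k l * inv_on S A l j * v j"
  have "mat_vec S (sandwich S A B) v i = (\<Sum>j\<in>S. \<Sum>k\<in>S. \<Sum>l\<in>S. ?t j k l)"
    by (simp add: mat_vec_def sandwich_def sum_distrib_right)
  also have "\<dots> = (\<Sum>k\<in>S. \<Sum>j\<in>S. \<Sum>l\<in>S. ?t j k l)" by (rule sum.swap)
  also have "\<dots> = (\<Sum>k\<in>S. \<Sum>l\<in>S. \<Sum>j\<in>S. ?t j k l)" by (intro sum.cong refl sum.swap)
  finally show ?thesis by (simp add: mat_vec_def sum_distrib_left mult.assoc)
qed

lemma quad_form_sandwich:
  assumes "finite S" "posdef_on S A"
  shows "quad_form S (sandwich S A B) v = quad_form S B (mat_vec S (inv_on S A) v)"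
proof -
  let ?w = "mat_vec S (inv_on S A) v"
  have "quad_form S (sandwich S A B) v = inner_on S v (mat_vec S (inv_on S A) (mat_vec S B ?w))"
    by (simp add: quad_form_eq_inner_on mat_vec_sandwich[abs_def] inner_on_def)
  also have "\<dots> = inner_on S (mat_vec S B ?w) ?w"
    by (rule inner_on_mat_vec_symmetric[OF symmetric_on_inv_on[OF assms]])
  finally show ?thesis by (simp add: quad_form_eq_inner_on inner_on_commute)
qed

lemma gaussian_on_iff:
  "gaussian_on S V \<mu> \<longleftrightarrow> prob_space \<mu> \<and> sets \<mu> = sets (Pi\<^sub>M S (\<lambda>_. borel)) \<and>
    (\<forall>\<xi>. (\<integral>x. cis (inner_on S \<xi> x) \<partial>\<mu>) = of_real (exp (- quad_form S V \<xi> / 2)))"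
  by (simp add: gaussian_on_def inner_on_def quad_form_def)

lemma borel_measurable_cis_inner_on:
  assumes "sets \<mu> = sets (Pi\<^sub>M S (\<lambda>_. borel))"
  shows "(\<lambda>x. cis (inner_on S \<xi> x)) \<in> borel_measurable \<mu>"
  unfolding measurable_cong_sets[OF assms refl]
  by (rule measurable_compose[OF borel_measurable_inner_on borel_measurable_cis]) simp

lemma gaussian_on_linear_image:
  assumes \<mu>_gaussian: "gaussian_on S V \<mu>"
    and W_eq: "\<And>\<xi>. quad_form S W \<xi> = quad_form S V (\<lambda>k. \<Sum>i\<in>S. L i k * \<xi> i)"
  shows "gaussian_on S W (distr \<mu> (Pi\<^sub>M S (\<lambda>_. borel)) (\<lambda>x. \<lambda>i\<in>S. mat_vec S L x i))"
proof -
  let ?h = "\<lambda>x. \<lambda>i\<in>S. mat_vec S L x i" and ?P = "Pi\<^sub>M S (\<lambda>_. borel) :: (nat \<Rightarrow> real) measure"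
  have \<mu>': "prob_space \<mu>" "sets \<mu> = sets ?P"
    "\<And>\<xi>. (\<integral>x. cis (inner_on S \<xi> x) \<partial>\<mu>) = of_real (exp (- quad_form S V \<xi> / 2))"
    using \<mu>_gaussian unfolding gaussian_on_iff by blast+
  have h_measurable: "?h \<in> measurable \<mu> ?P"
    unfolding measurable_cong_sets[OF \<mu>'(2) refl] mat_vec_def by measurable
  have adjoint: "inner_on S \<xi> (?h x) = inner_on S (\<lambda>k. \<Sum>i\<in>S. L i k * \<xi> i) x" for \<xi> x
  proof -
    have "inner_on S \<xi> (?h x) = (\<Sum>i\<in>S. \<Sum>k\<in>S. L i k * \<xi> i * x k)"
      by (simp add: inner_on_def mat_vec_def sum_distrib_left mult_ac)
    also have "\<dots> = (\<Sum>k\<in>S. \<Sum>i\<in>S. L i k * \<xi> i * x k)" by (rule sum.swap)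
    finally show ?thesis by (simp add: inner_on_def sum_distrib_right)
  qed
  have "(\<integral>x. cis (inner_on S \<xi> x) \<partial>distr \<mu> ?P ?h) = of_real (exp (- quad_form S W \<xi> / 2))" for \<xi>
    using integral_distr[OF h_measurable borel_measurable_cis_inner_on[OF refl]] by (simp add: adjoint \<mu>'(3) W_eq)
  then show ?thesis
    unfolding gaussian_on_iff using prob_space.prob_space_distr[OF \<mu>'(1) h_measurable] by simp
qed

lemma cis_sum: "cis (\<Sum>i\<in>S. f i) = (\<Prod>i\<in>S. cis (f i))"
  by (induction S rule: infinite_finite_induct) (auto simp: cis_mult[symmetric])

lemma gaussian_on_std:
  assumes fin: "finite S"
  shows "gaussian_on S (\<lambda>i j. if i = j then 1 else 0) (Pi\<^sub>M S (\<lambda>_. std_normal_distribution))"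
proof -
  let ?N = std_normal_distribution
  interpret N: prob_space ?N by (rule prob_space_normal_density) simp
  interpret P: product_prob_space "\<lambda>_. ?N" S
    by (intro product_prob_space.intro product_prob_space_axioms.intro product_sigma_finite.intro
        N.prob_space_axioms prob_space_imp_sigma_finite)
  have "(\<integral>x. cis (inner_on S \<xi> x) \<partial>Pi\<^sub>M S (\<lambda>_. ?N))
      = of_real (exp (- quad_form S (\<lambda>i j. if i = j then 1 else 0) \<xi> / 2))" for \<xi>
  proof -
    have "(\<integral>x. cis (inner_on S \<xi> x) \<partial>Pi\<^sub>M S (\<lambda>_. ?N)) = (\<integral>x. (\<Prod>i\<in>S. cis (\<xi> i * x i)) \<partial>Pi\<^sub>M S (\<lambda>_. ?N))"
      by (simp add: inner_on_def cis_sum)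
    also have "\<dots> = (\<Prod>i\<in>S. \<integral>u. cis (\<xi> i * u) \<partial>?N)"
      by (intro P.product_integral_prod fin N.integrable_cis) simp
    also have "\<dots> = (\<Prod>i\<in>S. char ?N (\<xi> i))" by (simp add: char_def cis_conv_exp)
    also have "\<dots> = of_real (exp (- (\<Sum>i\<in>S. (\<xi> i)\<^sup>2) / 2))"
      using fin by (simp add: char_std_normal_distribution exp_sum[symmetric] sum_negf sum_divide_distrib
          flip: of_real_prod)
    finally show ?thesis by (simp add: quad_form_identity[OF fin])
  qed
  moreover have "sets (Pi\<^sub>M S (\<lambda>_. ?N)) = sets (Pi\<^sub>M S (\<lambda>_. borel))" by (intro sets_PiM_cong) auto
  ultimately show ?thesis unfolding gaussian_on_iff using P.prob_space_axioms by blast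
qed

lemma ex_gaussian_on:
  assumes "finite S" "posdef_on S V"
  shows "\<exists>\<mu>. gaussian_on S V \<mu>"
proof -
  obtain L where L_factor: "\<And>v. quad_form S V v = (\<Sum>k\<in>S. (\<Sum>i\<in>S. L i k * v i)\<^sup>2)"
    using posdef_on_cholesky[OF assms] by blast
  have "quad_form S V \<xi> = quad_form S (\<lambda>i j. if i = j then 1 else 0) (\<lambda>k. \<Sum>i\<in>S. L i k * \<xi> i)" for \<xi>
    by (simp add: L_factor quad_form_identity[OF assms(1)])
  then show ?thesis using gaussian_on_linear_image[OF gaussian_on_std[OF assms(1)]] by blast
qed

lemma ex_gaussian_on_sandwich:
  assumes "finite S" "posdef_on S A" "posdef_on S B"
  shows "\<exists>\<mu>. gaussian_on S (sandwich S A B) \<mu>"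
proof -
  obtain \<mu> where \<mu>_gaussian: "gaussian_on S B \<mu>" using ex_gaussian_on[OF assms(1,3)] by blast
  have "mat_vec S (inv_on S A) \<xi> k = (\<Sum>i\<in>S. inv_on S A i k * \<xi> i)" if "k \<in> S" for k \<xi>
    unfolding mat_vec_def
    by (intro sum.cong refl) (simp add: symmetric_onD[OF symmetric_on_inv_on[OF assms(1,2)], of k] that)
  then have "quad_form S (sandwich S A B) \<xi> = quad_form S B (\<lambda>k. \<Sum>i\<in>S. inv_on S A i k * \<xi> i)" for \<xi>
    unfolding quad_form_sandwich[OF assms(1,2)] by (rule quad_form_cong)
  then show ?thesis using gaussian_on_linear_image[OF \<mu>_gaussian] by blast
qed

section \<open>The adaptive lasso for a quadratic objective\<close>

lemma abs_le_if_linear_dominates: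
  fixes D b c \<epsilon> :: real
  assumes "\<epsilon> > 0" and dominates: "\<And>e. \<bar>e\<bar> < \<epsilon> \<Longrightarrow> 0 \<le> 2 * e * D + e\<^sup>2 * c + b * \<bar>e\<bar>"
  shows "\<bar>D\<bar> \<le> b / 2"
proof -
  have "0 \<le> b + 2 * s * D" if "s = 1 \<or> s = -1" for s
  proof (rule tendsto_lowerbound)
    show "((\<lambda>e. b + 2 * s * D + e * c) \<longlongrightarrow> b + 2 * s * D) (at_right 0)" by (auto intro!: tendsto_eq_intros)
    show "\<forall>\<^sub>F e in at_right 0. 0 \<le> b + 2 * s * D + e * c"
      using eventually_at_right_real[OF \<open>\<epsilon> > 0\<close>]
    proof eventually_elim
      case (elim e)
      have "\<bar>s * e\<bar> = e" "(s * e)\<^sup>2 = e\<^sup>2" using that elim by auto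
      then have "0 \<le> e * (b + 2 * s * D + e * c)"
        using dominates[of "s * e"] elim by (simp add: power2_eq_square algebra_simps)
      then show ?case using elim by (simp add: zero_le_mult_iff)
    qed
  qed simp
  from this[of 1] this[of "-1"] show ?thesis by auto
qed

text \<open>Bounds the \<open>l\<^sub>1\<close> distance of a minimizer from \<open>\<theta>\<^sub>0\<close> when the quadratic part is at least \<open>\<kappa>\<close> times the
  squared norm, the gradient at \<open>\<theta>\<^sub>0\<close> is at most \<open>2 g\<close> and the penalty has Lipschitz constant \<open>l\<close>.\<close>
definition lasso_radius :: "real \<Rightarrow> real \<Rightarrow> real \<Rightarrow> real" where
  "lasso_radius \<kappa> g l = (2 * g + l) / \<kappa>"

lemma lasso_radius_nonneg: "\<kappa> > 0 \<Longrightarrow> g \<ge> 0 \<Longrightarrow> l \<ge> 0 \<Longrightarrow> 0 \<le> lasso_radius \<kappa> g l"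
  by (simp add: lasso_radius_def)

lemma lasso_radius_mono: "\<kappa> > 0 \<Longrightarrow> l \<le> l' \<Longrightarrow> lasso_radius \<kappa> g l \<le> lasso_radius \<kappa> g l'"
  by (simp add: lasso_radius_def divide_right_mono)

locale quadratic_objective =
  fixes p :: nat and A :: "nat \<Rightarrow> nat \<Rightarrow> real" and G \<theta>\<^sub>0 :: "nat \<Rightarrow> real" and obj :: "(nat \<Rightarrow> real) \<Rightarrow> real"
  assumes symmetric_A: "symmetric_on {..<p} A"
    and quadratic: "obj \<theta> = obj \<theta>\<^sub>0 - 2 * inner_on {..<p} (\<theta> - \<theta>\<^sub>0) G + quad_form {..<p} A (\<theta> - \<theta>\<^sub>0)"
begin

lemma l1_norm_le_if_obj_le:
  assumes coercive: "\<kappa> * (l1_norm {..<p} (\<theta> - \<theta>\<^sub>0))\<^sup>2 \<le> quad_form {..<p} A (\<theta> - \<theta>\<^sub>0)"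
    and G_bound: "\<And>i. i < p \<Longrightarrow> \<bar>G i\<bar> \<le> g"
    and obj: "obj \<theta> \<le> obj \<theta>\<^sub>0 + l * l1_norm {..<p} (\<theta> - \<theta>\<^sub>0)" and pos: "\<kappa> > 0" "g \<ge> 0" "l \<ge> 0"
  shows "l1_norm {..<p} (\<theta> - \<theta>\<^sub>0) \<le> lasso_radius \<kappa> g l"
proof -
  let ?h = "\<theta> - \<theta>\<^sub>0"
  define n where "n = l1_norm {..<p} ?h"
  have "inner_on {..<p} ?h G \<le> (\<Sum>i<p. \<bar>?h i\<bar> * g)"
    unfolding inner_on_def
  proof (rule sum_mono)
    fix i assume "i \<in> {..<p}"
    then have "\<bar>?h i * G i\<bar> \<le> \<bar>?h i\<bar> * g" unfolding abs_mult by (intro mult_left_mono G_bound) auto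
    then show "?h i * G i \<le> \<bar>?h i\<bar> * g" by linarith
  qed
  also have "\<dots> = n * g" by (simp add: n_def l1_norm_def sum_distrib_right)
  finally have "\<kappa> * n * n \<le> (2 * g + l) * n"
    using coercive obj unfolding quadratic[of \<theta>] n_def[symmetric] by (simp add: power2_eq_square algebra_simps)
  then have "\<kappa> * n \<le> 2 * g + l"
    using l1_norm_nonneg[of "{..<p}" ?h] pos unfolding n_def[symmetric] by (cases "n = 0") auto
  then show ?thesis using pos by (simp add: lasso_radius_def n_def pos_le_divide_eq mult.commute)
qed

lemma obj_coord_update:
  assumes j_less: "j < p"
  shows "obj (\<theta>(j := \<theta> j + e)) = obj \<theta> + 2 * e * (mat_vec {..<p} A (\<theta> - \<theta>\<^sub>0) j - G j) + e\<^sup>2 * A j j"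
proof -
  define d where "d i = (if i = j then e else 0)" for i
  have single: "inner_on {..<p} d w = e * w j" for w
    using inner_on_single[of "{..<p}" j e w] j_less by (simp add: d_def[abs_def])
  have "mat_vec {..<p} A d j = e * A j j"
    using single[of "\<lambda>i. A j i"] by (simp add: mat_vec_def inner_on_def mult.commute)
  then have quad_d: "quad_form {..<p} A d = e\<^sup>2 * A j j"
    by (simp add: quad_form_eq_inner_on single power2_eq_square)
  define h where "h = \<theta> - \<theta>\<^sub>0"
  have upd: "\<theta>(j := \<theta> j + e) - \<theta>\<^sub>0 = (\<lambda>i. h i + d i)" by (auto simp: d_def h_def)
  show ?thesis
    unfolding quadratic[of "\<theta>(j := \<theta> j + e)"] quadratic[of \<theta>] upd inner_on_add_left
      quad_form_add[OF symmetric_A] single quad_d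
    by (simp add: algebra_simps flip: h_def)
qed

end

definition well_tuned :: "real \<Rightarrow> real \<Rightarrow> real \<Rightarrow> real \<Rightarrow> real \<Rightarrow> real \<Rightarrow> real \<Rightarrow> bool" where
  "well_tuned \<kappa> a g m r \<gamma> lam \<longleftrightarrow> lasso_radius \<kappa> g 0 \<le> m / 2 \<and>
    lasso_radius \<kappa> g (lam * (m / 2) powr (- \<gamma>)) < r \<and>
    lasso_radius \<kappa> g 0 powr \<gamma> * (2 * g + 3 * a * lasso_radius \<kappa> g (lam * (m / 2) powr (- \<gamma>))) < lam"

text \<open>A junk value: \<open>adapt_pen\<close> puts weight 0, not \<open>\<infinity>\<close>, on the coordinates with \<open>\<theta>t j = 0\<close>; the
  constraint of \<open>hat_min\<close> excludes them instead.\<close>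
locale adaptive_lasso = quadratic_objective +
  fixes \<Theta> :: "(nat \<Rightarrow> real) set" and \<theta>t \<theta>h :: "nat \<Rightarrow> real" and lam \<gamma> r \<kappa> a g m :: real
  assumes coercive: "\<kappa> * (l1_norm {..<p} h)\<^sup>2 \<le> quad_form {..<p} A h" and \<kappa>_pos: "\<kappa> > 0"
    and A_bound: "i < p \<Longrightarrow> k < p \<Longrightarrow> \<bar>A i k\<bar> \<le> a"
    and G_bound: "i < p \<Longrightarrow> \<bar>G i\<bar> \<le> g" and g_nonneg: "g \<ge> 0" and a_nonneg: "a \<ge> 0"
    and \<theta>\<^sub>0_Rp: "\<theta>\<^sub>0 \<in> Rp p" and \<Theta>_Rp: "\<Theta> \<subseteq> Rp p"
    and box_\<Theta>: "\<theta> \<in> Rp p \<Longrightarrow> (\<And>i. i < p \<Longrightarrow> \<bar>\<theta> i - \<theta>\<^sub>0 i\<bar> < r) \<Longrightarrow> \<theta> \<in> \<Theta>"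
    and signal: "j < p \<Longrightarrow> \<theta>\<^sub>0 j \<noteq> 0 \<Longrightarrow> m \<le> \<bar>\<theta>\<^sub>0 j\<bar>" and m_pos: "m > 0"
    and lam_pos: "lam > 0" and \<gamma>_pos: "\<gamma> > 0"
    and tilde_min: "is_arg_min obj (\<lambda>\<theta>. \<theta> \<in> \<Theta>) \<theta>t"
    and hat_min: "is_arg_min (\<lambda>\<theta>. obj \<theta> + lam * adapt_pen p \<gamma> \<theta>t \<theta>)
      (\<lambda>\<theta>. \<theta> \<in> \<Theta> \<and> (\<forall>j<p. \<theta>t j = 0 \<longrightarrow> \<theta> j = 0)) \<theta>h"
    and tuned: "well_tuned \<kappa> a g m r \<gamma> lam"
begin

abbreviation "max_weight \<equiv> (m / 2) powr (- \<gamma>)"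
abbreviation "tilde_radius \<equiv> lasso_radius \<kappa> g 0"
abbreviation "hat_radius \<equiv> lasso_radius \<kappa> g (lam * max_weight)"

lemma tilde_radius_le: "tilde_radius \<le> m / 2"
  and hat_radius_less: "hat_radius < r"
  and penalty_dominates: "tilde_radius powr \<gamma> * (2 * g + 3 * a * hat_radius) < lam"
  using tuned by (simp_all add: well_tuned_def)

lemma r_pos: "r > 0"
  using lasso_radius_nonneg[of \<kappa> g "lam * max_weight"] hat_radius_less \<kappa>_pos g_nonneg lam_pos by simp

lemma \<theta>\<^sub>0_in_\<Theta>: "\<theta>\<^sub>0 \<in> \<Theta>"
  by (rule box_\<Theta>[OF \<theta>\<^sub>0_Rp]) (use r_pos in simp)

lemma abs_tilde_error_le:
  assumes "j < p"
  shows "\<bar>\<theta>t j - \<theta>\<^sub>0 j\<bar> \<le> tilde_radius"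
proof -
  have "l1_norm {..<p} (\<theta>t - \<theta>\<^sub>0) \<le> tilde_radius"
    using tilde_min \<theta>\<^sub>0_in_\<Theta> g_nonneg \<kappa>_pos
    by (intro l1_norm_le_if_obj_le coercive G_bound) (auto simp: is_arg_min_linorder)
  then show ?thesis using abs_le_l1_norm[of "{..<p}" j "\<theta>t - \<theta>\<^sub>0"] assms by simp
qed

lemma abs_tilde_ge:
  assumes "j < p" "\<theta>\<^sub>0 j \<noteq> 0"
  shows "m / 2 \<le> \<bar>\<theta>t j\<bar>"
  using abs_tilde_error_le[OF assms(1)] signal[OF assms] tilde_radius_le by linarith

lemma penalty_diff_le:
  assumes "j < p" "\<theta>\<^sub>0 j \<noteq> 0"
  shows "\<bar>x\<bar> / \<bar>\<theta>t j\<bar> powr \<gamma> - \<bar>y\<bar> / \<bar>\<theta>t j\<bar> powr \<gamma> \<le> max_weight * \<bar>x - y\<bar>"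
proof -
  have "1 / \<bar>\<theta>t j\<bar> powr \<gamma> \<le> 1 / (m / 2) powr \<gamma>"
    using abs_tilde_ge[OF assms] m_pos \<gamma>_pos by (intro divide_left_mono powr_mono2) auto
  also have "\<dots> = max_weight" by (simp add: powr_minus inverse_eq_divide)
  finally have weight: "1 / \<bar>\<theta>t j\<bar> powr \<gamma> \<le> max_weight" .
  have "\<bar>x\<bar> / \<bar>\<theta>t j\<bar> powr \<gamma> - \<bar>y\<bar> / \<bar>\<theta>t j\<bar> powr \<gamma> = (\<bar>x\<bar> - \<bar>y\<bar>) * (1 / \<bar>\<theta>t j\<bar> powr \<gamma>)"
    by (simp add: diff_divide_distrib)
  also have "\<dots> \<le> \<bar>x - y\<bar> * max_weight" using weight by (intro mult_mono) auto
  finally show ?thesis by (simp add: mult.commute)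
qed

lemma l1_norm_hat_error_le: "l1_norm {..<p} (\<theta>h - \<theta>\<^sub>0) \<le> hat_radius"
proof -
  have "\<theta>\<^sub>0 j = 0" if "j < p" "\<theta>t j = 0" for j
    using abs_tilde_ge[OF that(1)] that(2) m_pos by (cases "\<theta>\<^sub>0 j = 0") auto
  then have "obj \<theta>h + lam * adapt_pen p \<gamma> \<theta>t \<theta>h \<le> obj \<theta>\<^sub>0 + lam * adapt_pen p \<gamma> \<theta>t \<theta>\<^sub>0"
    using hat_min \<theta>\<^sub>0_in_\<Theta> unfolding is_arg_min_linorder by blast
  moreover have "adapt_pen p \<gamma> \<theta>t \<theta>\<^sub>0 - adapt_pen p \<gamma> \<theta>t \<theta>h \<le> max_weight * l1_norm {..<p} (\<theta>h - \<theta>\<^sub>0)"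
    unfolding adapt_pen_def l1_norm_def sum_subtractf[symmetric] sum_distrib_left
  proof (rule sum_mono)
    fix j assume "j \<in> {..<p}"
    then show "\<bar>\<theta>\<^sub>0 j\<bar> / \<bar>\<theta>t j\<bar> powr \<gamma> - \<bar>\<theta>h j\<bar> / \<bar>\<theta>t j\<bar> powr \<gamma> \<le> max_weight * \<bar>(\<theta>h - \<theta>\<^sub>0) j\<bar>"
      using penalty_diff_le[of j "\<theta>\<^sub>0 j" "\<theta>h j"]
      by (cases "\<theta>\<^sub>0 j = 0") (auto simp: abs_minus_commute intro: order_trans[of _ 0])
  qed
  then have "lam * (adapt_pen p \<gamma> \<theta>t \<theta>\<^sub>0 - adapt_pen p \<gamma> \<theta>t \<theta>h) \<le> lam * (max_weight * l1_norm {..<p} (\<theta>h - \<theta>\<^sub>0))"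
    using lam_pos by (intro mult_left_mono) auto
  ultimately have "obj \<theta>h \<le> obj \<theta>\<^sub>0 + lam * max_weight * l1_norm {..<p} (\<theta>h - \<theta>\<^sub>0)"
    by (simp add: algebra_simps)
  then show ?thesis
    using lam_pos g_nonneg \<kappa>_pos by (intro l1_norm_le_if_obj_le coercive G_bound) auto
qed

lemma coord_update_in_\<Theta>:
  assumes "j < p" "\<bar>y - \<theta>\<^sub>0 j\<bar> < r"
  shows "\<theta>h(j := y) \<in> \<Theta>"
proof (rule box_\<Theta>)
  show "\<theta>h(j := y) \<in> Rp p" using hat_min \<Theta>_Rp assms(1) by (auto simp: is_arg_min_linorder Rp_def)
  show "\<bar>(\<theta>h(j := y)) i - \<theta>\<^sub>0 i\<bar> < r" if "i < p" for i
    using abs_le_l1_norm[of "{..<p}" i "\<theta>h - \<theta>\<^sub>0"] that l1_norm_hat_error_le hat_radius_less assms(2) by auto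
qed

lemma adapt_pen_coord_update:
  assumes "j < p"
  shows "adapt_pen p \<gamma> \<theta>t (\<theta>(j := y)) = adapt_pen p \<gamma> \<theta>t \<theta> + (\<bar>y\<bar> / \<bar>\<theta>t j\<bar> powr \<gamma> - \<bar>\<theta> j\<bar> / \<bar>\<theta>t j\<bar> powr \<gamma>)"
proof -
  have "adapt_pen p \<gamma> \<theta>t (\<theta>(j := y)) = (\<Sum>i<p. \<bar>\<theta> i\<bar> / \<bar>\<theta>t i\<bar> powr \<gamma> +
      (if i = j then \<bar>y\<bar> / \<bar>\<theta>t j\<bar> powr \<gamma> - \<bar>\<theta> j\<bar> / \<bar>\<theta>t j\<bar> powr \<gamma> else 0))"
    unfolding adapt_pen_def by (intro sum.cong) auto
  then show ?thesis using assms by (simp add: sum.distrib adapt_pen_def)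
qed

lemma coord_optimality:
  assumes j_less: "j < p" and "\<theta>t j \<noteq> 0" and "\<bar>\<theta>h j + e - \<theta>\<^sub>0 j\<bar> < r"
  shows "lam * (\<bar>\<theta>h j\<bar> / \<bar>\<theta>t j\<bar> powr \<gamma> - \<bar>\<theta>h j + e\<bar> / \<bar>\<theta>t j\<bar> powr \<gamma>)
    \<le> 2 * e * (mat_vec {..<p} A (\<theta>h - \<theta>\<^sub>0) j - G j) + e\<^sup>2 * A j j"
proof -
  let ?\<theta> = "\<theta>h(j := \<theta>h j + e)"
  have "?\<theta> \<in> \<Theta>" by (rule coord_update_in_\<Theta>[OF j_less assms(3)])
  moreover have "\<forall>i<p. \<theta>t i = 0 \<longrightarrow> ?\<theta> i = 0"
    using hat_min assms(2) by (auto simp: is_arg_min_linorder)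
  ultimately have "obj \<theta>h + lam * adapt_pen p \<gamma> \<theta>t \<theta>h \<le> obj ?\<theta> + lam * adapt_pen p \<gamma> \<theta>t ?\<theta>"
    using hat_min unfolding is_arg_min_linorder by blast
  then show ?thesis
    unfolding obj_coord_update[OF j_less] adapt_pen_coord_update[OF j_less] by (simp add: algebra_simps)
qed

theorem hat_eq_zero:
  assumes j_inactive: "j < p" "\<theta>\<^sub>0 j = 0"
  shows "\<theta>h j = 0"
proof (rule ccontr)
  assume nonzero: "\<theta>h j \<noteq> 0"
  then have tnz: "\<theta>t j \<noteq> 0" using hat_min j_inactive(1) by (auto simp: is_arg_min_linorder)
  define n where "n = l1_norm {..<p} (\<theta>h - \<theta>\<^sub>0)"
  define D where "D = mat_vec {..<p} A (\<theta>h - \<theta>\<^sub>0) j - G j"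
  have D_bound: "\<bar>D\<bar> \<le> a * n + g"
    using abs_mat_vec_le[of "{..<p}" A j a "\<theta>h - \<theta>\<^sub>0"] A_bound[OF j_inactive(1)] G_bound[OF j_inactive(1)]
    by (auto simp: n_def D_def)
  have coord_bound: "\<bar>\<theta>h j\<bar> \<le> n" using abs_le_l1_norm[of "{..<p}" j "\<theta>h - \<theta>\<^sub>0"] j_inactive by (simp add: n_def)
  have "lam * (\<bar>\<theta>h j\<bar> / \<bar>\<theta>t j\<bar> powr \<gamma>) \<le> 2 * (- \<theta>h j) * D + (\<theta>h j)\<^sup>2 * A j j"
    using coord_optimality[OF j_inactive(1) tnz, of "- \<theta>h j"] j_inactive(2) r_pos by (simp add: D_def)
  also have "\<dots> \<le> \<bar>\<theta>h j\<bar> * (2 * (a * n + g)) + \<bar>\<theta>h j\<bar> * (n * a)"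
  proof (rule add_mono)
    have "2 * (- \<theta>h j) * D \<le> \<bar>\<theta>h j\<bar> * (2 * \<bar>D\<bar>)"
      using abs_ge_self[of "2 * (- \<theta>h j) * D"] by (simp add: abs_mult mult_ac)
    also have "\<dots> \<le> \<bar>\<theta>h j\<bar> * (2 * (a * n + g))" using D_bound by (intro mult_left_mono) auto
    finally show "2 * (- \<theta>h j) * D \<le> \<bar>\<theta>h j\<bar> * (2 * (a * n + g))" .
    have "(\<theta>h j)\<^sup>2 * A j j \<le> \<bar>\<theta>h j\<bar> * (\<bar>\<theta>h j\<bar> * \<bar>A j j\<bar>)"
      using abs_ge_self[of "(\<theta>h j)\<^sup>2 * A j j"] by (simp add: abs_mult power2_eq_square)
    also have "\<dots> \<le> \<bar>\<theta>h j\<bar> * (n * a)"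
      using coord_bound A_bound[OF j_inactive(1) j_inactive(1)] by (intro mult_left_mono mult_mono) auto
    finally show "(\<theta>h j)\<^sup>2 * A j j \<le> \<bar>\<theta>h j\<bar> * (n * a)" .
  qed
  finally have "\<bar>\<theta>h j\<bar> * (lam / \<bar>\<theta>t j\<bar> powr \<gamma>) \<le> \<bar>\<theta>h j\<bar> * (2 * g + 3 * a * n)"
    by (simp add: algebra_simps)
  then have "lam / \<bar>\<theta>t j\<bar> powr \<gamma> \<le> 2 * g + 3 * a * n" by (rule mult_left_le_imp_le) (use nonzero in simp)
  then have "lam \<le> \<bar>\<theta>t j\<bar> powr \<gamma> * (2 * g + 3 * a * n)" using tnz by (simp add: pos_divide_le_eq mult.commute)
  also have "\<dots> \<le> tilde_radius powr \<gamma> * (2 * g + 3 * a * hat_radius)"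
    using abs_tilde_error_le[OF j_inactive(1)] j_inactive(2) l1_norm_hat_error_le
      l1_norm_nonneg[of "{..<p}" "\<theta>h - \<theta>\<^sub>0"] \<gamma>_pos g_nonneg a_nonneg unfolding n_def[symmetric]
    by (intro mult_mono powr_mono2 add_left_mono mult_left_mono add_nonneg_nonneg mult_nonneg_nonneg) auto
  finally show False using penalty_dominates by simp
qed

theorem hat_first_order:
  assumes j_active: "j < p" "\<theta>\<^sub>0 j \<noteq> 0"
  shows "\<bar>mat_vec {..<p} A (\<theta>h - \<theta>\<^sub>0) j - G j\<bar> \<le> lam * max_weight / 2"
proof (rule abs_le_if_linear_dominates)
  let ?n = "l1_norm {..<p} (\<theta>h - \<theta>\<^sub>0)"
  show "r - ?n > 0" using l1_norm_hat_error_le hat_radius_less by linarith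
  fix e assume e_small: "\<bar>e\<bar> < r - ?n"
  have "\<bar>\<theta>h j + e - \<theta>\<^sub>0 j\<bar> < r"
    using e_small abs_le_l1_norm[of "{..<p}" j "\<theta>h - \<theta>\<^sub>0"] j_active by auto
  moreover have "\<theta>t j \<noteq> 0" using abs_tilde_ge[OF j_active] m_pos by auto
  ultimately have "lam * (\<bar>\<theta>h j\<bar> / \<bar>\<theta>t j\<bar> powr \<gamma> - \<bar>\<theta>h j + e\<bar> / \<bar>\<theta>t j\<bar> powr \<gamma>)
    \<le> 2 * e * (mat_vec {..<p} A (\<theta>h - \<theta>\<^sub>0) j - G j) + e\<^sup>2 * A j j"
    by (intro coord_optimality j_active)
  moreover have "lam * (\<bar>\<theta>h j + e\<bar> / \<bar>\<theta>t j\<bar> powr \<gamma> - \<bar>\<theta>h j\<bar> / \<bar>\<theta>t j\<bar> powr \<gamma>) \<le> lam * (max_weight * \<bar>e\<bar>)"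
    using penalty_diff_le[OF j_active, of "\<theta>h j + e" "\<theta>h j"] lam_pos by (intro mult_left_mono) auto
  ultimately show "0 \<le> 2 * e * (mat_vec {..<p} A (\<theta>h - \<theta>\<^sub>0) j - G j) + e\<^sup>2 * A j j + lam * max_weight * \<bar>e\<bar>"
    by (simp add: right_diff_distrib mult.assoc)
qed

end

section \<open>Asymptotics of the adaptive lasso\<close>

context prob_space
begin

lemma tendsto_in_prob_cong_with_high_prob:
  assumes X_tendsto: "tendsto_in_prob X c" and X_eq_Y: "with_high_prob (\<lambda>n x. X n x = Y n x)"
  shows "tendsto_in_prob Y c"
  unfolding tendsto_in_prob_def
proof (intro allI impI)
  fix d :: real assume "d > 0"
  then have "with_high_prob (\<lambda>n x. \<bar>X n x - c\<bar> \<le> d \<and> X n x = Y n x)"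
    using X_tendsto X_eq_Y by (intro with_high_prob_conj) (simp_all add: tendsto_in_prob_def)
  then show "with_high_prob (\<lambda>n x. \<bar>Y n x - c\<bar> \<le> d)"
    by (rule with_high_prob_mono) (auto intro: always_eventually)
qed

lemma tendsto_in_prob_zero_if_le:
  assumes X_le: "with_high_prob (\<lambda>n x. \<bar>X n x\<bar> \<le> b n)" and b_tendsto: "b \<longlonglongrightarrow> 0"
  shows "tendsto_in_prob X 0"
  unfolding tendsto_in_prob_def
proof (intro allI impI)
  fix d :: real assume "d > 0"
  then have "\<forall>\<^sub>F n in sequentially. b n < d" by (intro order_tendstoD(2)[OF b_tendsto])
  then have "\<forall>\<^sub>F n in sequentially. \<forall>x\<in>space M. \<bar>X n x\<bar> \<le> b n \<longrightarrow> \<bar>X n x - 0\<bar> \<le> d"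
    by eventually_elim auto
  with X_le show "with_high_prob (\<lambda>n x. \<bar>X n x - 0\<bar> \<le> d)" by (rule with_high_prob_mono)
qed

end

lemma lasso_radius_scaled:
  assumes "t > 0" "\<kappa> > 0"
  shows "lasso_radius (\<kappa> * (t * t)) (R * t) (c * t) = (2 * R + c) / \<kappa> / t"
  using assms by (simp add: lasso_radius_def field_simps)

lemma tuning_bound_scaled:
  fixes t R a c \<kappa> \<gamma> :: real
  assumes "t > 0" "R > 0" "\<kappa> > 0"
  shows "(2 * R / \<kappa> / t) powr \<gamma> * (2 * (R * t) + 3 * (a * (t * t)) * (c / t))
    = (2 * R / \<kappa>) powr \<gamma> * (2 * R + 3 * a * c) * t powr (1 - \<gamma>)"
proof -
  have "(2 * R / \<kappa> / t) powr \<gamma> = (2 * R / \<kappa>) powr \<gamma> / t powr \<gamma>"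
    using powr_divide[of "2 * R / \<kappa>" t \<gamma>] assms by simp
  moreover have "2 * (R * t) + 3 * (a * (t * t)) * (c / t) = (2 * R + 3 * a * c) * t"
    using assms by (simp add: distrib_right)
  ultimately show ?thesis using assms(1) by (simp add: powr_diff)
qed

lemma eventually_well_tuned:
  fixes lam :: "nat \<Rightarrow> real"
  assumes lam_pos: "\<And>T. lam T > 0" and lam_small: "(\<lambda>T. lam T / sqrt (real T)) \<longlonglongrightarrow> 0"
    and lam_large: "filterlim (\<lambda>T. lam T * real T powr ((\<gamma> - 1) / 2)) at_top sequentially"
    and pos: "\<kappa> > 0" "a \<ge> 0" "R > 0" "m > 0" "r > 0"
  shows "\<forall>\<^sub>F T in sequentially. well_tuned (\<kappa> * real T) (a * real T) (R * sqrt (real T)) m r \<gamma> (lam T) \<and>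
    lasso_radius (\<kappa> * real T) (R * sqrt (real T)) (lam T * (m / 2) powr (- \<gamma>)) \<le> (2 * R + 1) / \<kappa> / sqrt (real T)"
proof -
  define w where "w = (m / 2) powr (- \<gamma>)"
  define c where "c = (2 * R + 1) / \<kappa>"
  have "w \<ge> 0" by (simp add: w_def)
  have "\<forall>\<^sub>F T in sequentially. 2 * R / \<kappa> / sqrt (real T) < m / 2"
    using pos by (intro order_tendstoD(2)[OF const_over_sqrt_tendsto]) auto
  moreover have "\<forall>\<^sub>F T in sequentially. lam T / sqrt (real T) < 1 / (w + 1)"
    using \<open>w \<ge> 0\<close> by (intro order_tendstoD(2)[OF lam_small]) auto
  moreover have "\<forall>\<^sub>F T in sequentially. c / sqrt (real T) < r"
    using pos by (intro order_tendstoD(2)[OF const_over_sqrt_tendsto]) auto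
  moreover have "\<forall>\<^sub>F T in sequentially.
      (2 * R / \<kappa>) powr \<gamma> * (2 * R + 3 * a * c) < lam T * real T powr ((\<gamma> - 1) / 2)"
    using lam_large unfolding filterlim_at_top_dense by blast
  ultimately show ?thesis
    using eventually_gt_at_top[of 0]
  proof eventually_elim
    case (elim T)
    define t where "t = sqrt (real T)"
    have t_pos: "t > 0" and T_eq: "real T = t * t" using elim(5) by (auto simp: t_def)
    have tilde: "lasso_radius (\<kappa> * real T) (R * t) 0 = 2 * R / \<kappa> / t"
      using lasso_radius_scaled[OF t_pos pos(1), of R 0] by (simp add: T_eq)
    have "lam T * (w + 1) < t" using elim(2) t_pos \<open>w \<ge> 0\<close> by (simp add: t_def[symmetric] field_simps)
    then have "lam T * w \<le> 1 * t" using lam_pos[of T] by (simp add: distrib_left)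
    then have hat: "lasso_radius (\<kappa> * real T) (R * t) (lam T * w) \<le> c / t"
      using lasso_radius_mono[of "\<kappa> * real T" "lam T * w" "1 * t" "R * t"]
        lasso_radius_scaled[OF t_pos pos(1), of R 1] pos(1) t_pos by (simp add: T_eq c_def)
    have "(2 * R / \<kappa> / t) powr \<gamma> * (2 * (R * t) + 3 * (a * real T) * lasso_radius (\<kappa> * real T) (R * t) (lam T * w))
        \<le> (2 * R / \<kappa> / t) powr \<gamma> * (2 * (R * t) + 3 * (a * (t * t)) * (c / t))"
      using hat pos by (simp only: T_eq) (intro mult_left_mono add_left_mono, auto)
    also have "\<dots> < lam T * real T powr ((\<gamma> - 1) / 2) * t powr (1 - \<gamma>)"
      unfolding tuning_bound_scaled[OF t_pos pos(3,1)] using elim(4) t_pos by (intro mult_strict_right_mono) auto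
    also have "real T powr ((\<gamma> - 1) / 2) = t powr (\<gamma> - 1)"
      using t_pos by (simp add: T_eq powr_mult flip: powr_add)
    also have "lam T * t powr (\<gamma> - 1) * t powr (1 - \<gamma>) = lam T"
      using t_pos by (simp add: mult.assoc flip: powr_add)
    finally show ?case
      using elim(1,3) hat unfolding well_tuned_def t_def[symmetric] w_def[symmetric] tilde c_def by simp
  qed
qed

locale adaptive_lasso_asymptotics = prob_space M for M :: "'a measure" +
  fixes p :: nat and A :: "nat \<Rightarrow> 'a \<Rightarrow> nat \<Rightarrow> nat \<Rightarrow> real" and G \<theta>t \<theta>h :: "nat \<Rightarrow> 'a \<Rightarrow> nat \<Rightarrow> real"
    and obj :: "nat \<Rightarrow> 'a \<Rightarrow> (nat \<Rightarrow> real) \<Rightarrow> real" and \<theta>\<^sub>0 :: "nat \<Rightarrow> real"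
    and C B :: "nat \<Rightarrow> nat \<Rightarrow> real" and \<Theta> :: "(nat \<Rightarrow> real) set" and lam :: "nat \<Rightarrow> real" and \<gamma> r :: real
  assumes objective: "\<omega> \<in> space M \<Longrightarrow> quadratic_objective p (A T \<omega>) (G T \<omega>) \<theta>\<^sub>0 (obj T \<omega>)"
    and posdef_C: "posdef_on {..<p} C" and posdef_B: "posdef_on {..<p} B"
    and A_lln: "i < p \<Longrightarrow> k < p \<Longrightarrow> tendsto_in_prob (\<lambda>T \<omega>. A T \<omega> i k / real T) (C i k)"
    and G_measurable: "i < p \<Longrightarrow> (\<lambda>\<omega>. G T \<omega> i) \<in> borel_measurable M"
    and G_clt: "(\<lambda>T. expectation (\<lambda>\<omega>. cis (inner_on {..<p} \<xi> (G T \<omega>) / sqrt (real T))))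
      \<longlonglongrightarrow> of_real (exp (- quad_form {..<p} B \<xi> / 2))"
    and hat_measurable: "(\<lambda>\<omega>. \<theta>h T \<omega> i) \<in> borel_measurable M"
    and \<theta>\<^sub>0_Rp: "\<theta>\<^sub>0 \<in> Rp p" and \<Theta>_Rp: "\<Theta> \<subseteq> Rp p" and r_pos: "r > 0"
    and box_\<Theta>: "\<theta> \<in> Rp p \<Longrightarrow> (\<And>i. i < p \<Longrightarrow> \<bar>\<theta> i - \<theta>\<^sub>0 i\<bar> < r) \<Longrightarrow> \<theta> \<in> \<Theta>"
    and \<gamma>_pos: "\<gamma> > 0" and lam_pos: "lam T > 0"
    and lam_small: "(\<lambda>T. lam T / sqrt (real T)) \<longlonglongrightarrow> 0"
    and lam_large: "filterlim (\<lambda>T. lam T * real T powr ((\<gamma> - 1) / 2)) at_top sequentially"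
    and tilde_min: "\<omega> \<in> space M \<Longrightarrow> is_arg_min (obj T \<omega>) (\<lambda>\<theta>. \<theta> \<in> \<Theta>) (\<theta>t T \<omega>)"
    and hat_min: "\<omega> \<in> space M \<Longrightarrow> is_arg_min (\<lambda>\<theta>. obj T \<omega> \<theta> + lam T * adapt_pen p \<gamma> (\<theta>t T \<omega>) \<theta>)
      (\<lambda>\<theta>. \<theta> \<in> \<Theta> \<and> (\<forall>j<p. \<theta>t T \<omega> j = 0 \<longrightarrow> \<theta> j = 0)) (\<theta>h T \<omega>)"
begin

definition S :: "nat set" where
  "S = {i. i < p \<and> \<theta>\<^sub>0 i \<noteq> 0}"

definition min_signal :: real where
  "min_signal = Min (insert 1 ((\<lambda>j. \<bar>\<theta>\<^sub>0 j\<bar>) ` S))"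

definition error :: "nat \<Rightarrow> 'a \<Rightarrow> nat \<Rightarrow> real" where
  "error T \<omega> = \<theta>h T \<omega> - \<theta>\<^sub>0"

abbreviation "max_weight \<equiv> (min_signal / 2) powr (- \<gamma>)"

lemma finite_S: "finite S" and S_subset: "S \<subseteq> {..<p}"
  by (auto simp: S_def)

lemma min_signal_pos: "0 < min_signal"
  unfolding min_signal_def using finite_S by (subst Min_gr_iff) (auto simp: S_def)

lemma min_signal_le: "j < p \<Longrightarrow> \<theta>\<^sub>0 j \<noteq> 0 \<Longrightarrow> min_signal \<le> \<bar>\<theta>\<^sub>0 j\<bar>"
  unfolding min_signal_def using finite_S by (intro Min_le) (auto simp: S_def)

lemma G_bounded_in_prob:
  assumes "i < p"
  shows "bounded_in_prob (\<lambda>T \<omega>. G T \<omega> i / sqrt (real T))"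
proof -
  obtain \<mu> where \<mu>_gaussian: "gaussian_on {..<p} B \<mu>" using ex_gaussian_on[OF _ posdef_B] by blast
  show ?thesis
  proof (rule coordinate_bounded_in_prob_if_char_tendsto[where S="{..<p}" and \<mu>=\<mu>])
    show "prob_space \<mu>" "(\<lambda>x. x i) \<in> borel_measurable \<mu>"
      using \<mu>_gaussian assms by (simp_all add: gaussian_on_def measurable_cong_sets[of \<mu> "Pi\<^sub>M {..<p} (\<lambda>_. borel)"])
    show "(\<lambda>\<omega>. G T \<omega> i / sqrt (real T)) \<in> borel_measurable M" for T using G_measurable[OF assms] by simp
    have "inner_on {..<p} \<xi> (\<lambda>i. G T \<omega> i / sqrt (real T)) = inner_on {..<p} \<xi> (G T \<omega>) / sqrt (real T)" for \<xi> T \<omega>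
      by (simp add: inner_on_def sum_divide_distrib)
    then show "(\<lambda>T. expectation (\<lambda>\<omega>. cis (inner_on {..<p} \<xi> (\<lambda>i. G T \<omega> i / sqrt (real T)))))
        \<longlonglongrightarrow> (\<integral>x. cis (inner_on {..<p} \<xi> x) \<partial>\<mu>)" for \<xi>
      using G_clt[of \<xi>] \<mu>_gaussian by (simp add: gaussian_on_iff)
  qed (use assms in simp_all)
qed

lemma A_close_with_high_prob:
  assumes "\<delta> > 0"
  shows "with_high_prob (\<lambda>T \<omega>. \<forall>i<p. \<forall>k<p. \<bar>A T \<omega> i k / real T - C i k\<bar> \<le> \<delta>)"
  unfolding with_high_prob_def
proof (intro allI impI)
  fix e :: real assume e_pos: "e > 0"
  let ?I = "{..<p} \<times> {..<p}"
  have "eventually_except e (\<lambda>T \<omega>. \<forall>ik\<in>?I. \<bar>A T \<omega> (fst ik) (snd ik) / real T - C (fst ik) (snd ik)\<bar> \<le> \<delta>)"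
  proof (rule eventually_except_ball_finite[OF _ e_pos])
    fix ik assume ik_in: "ik \<in> ?I"
    then have "card ?I > 0" using card_gt_0_iff by blast
    then have "e / real (card ?I) > 0" using e_pos by (intro divide_pos_pos) auto
    moreover have "with_high_prob (\<lambda>T \<omega>. \<bar>A T \<omega> (fst ik) (snd ik) / real T - C (fst ik) (snd ik)\<bar> \<le> \<delta>)"
      using A_lln[of "fst ik" "snd ik"] ik_in \<open>\<delta> > 0\<close> by (auto simp: tendsto_in_prob_def)
    ultimately show "eventually_except (e / real (card ?I))
        (\<lambda>T \<omega>. \<bar>A T \<omega> (fst ik) (snd ik) / real T - C (fst ik) (snd ik)\<bar> \<le> \<delta>)"
      by (simp add: with_high_prob_def)
  qed simp
  then show "eventually_except e (\<lambda>T \<omega>. \<forall>i<p. \<forall>k<p. \<bar>A T \<omega> i k / real T - C i k\<bar> \<le> \<delta>)"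
    by (rule eventually_except_mono) (auto intro: always_eventually)
qed

definition well_conditioned :: "real \<Rightarrow> real \<Rightarrow> nat \<Rightarrow> 'a \<Rightarrow> bool" where
  "well_conditioned \<kappa> R T \<omega> \<longleftrightarrow> (\<forall>i<p. \<forall>k<p. \<bar>A T \<omega> i k / real T - C i k\<bar> \<le> \<kappa>) \<and>
    (\<forall>i<p. \<bar>G T \<omega> i / sqrt (real T)\<bar> \<le> R)"

definition oracle_bounds :: "real \<Rightarrow> nat \<Rightarrow> 'a \<Rightarrow> bool" where
  "oracle_bounds b T \<omega> \<longleftrightarrow> (\<forall>j<p. \<theta>\<^sub>0 j = 0 \<longrightarrow> \<theta>h T \<omega> j = 0) \<and>
    sqrt (real T) * l1_norm {..<p} (error T \<omega>) \<le> b \<and>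
    (\<forall>j\<in>S. \<bar>mat_vec {..<p} (A T \<omega>) (error T \<omega>) j - G T \<omega> j\<bar> \<le> lam T * max_weight / 2)"

lemma adaptive_lasso_if_well_conditioned:
  assumes coercive: "\<And>h. 2 * \<kappa> * (l1_norm {..<p} h)\<^sup>2 \<le> quad_form {..<p} C h"
    and C_bound: "\<And>i k. i < p \<Longrightarrow> k < p \<Longrightarrow> \<bar>C i k\<bar> + \<kappa> \<le> a" "a \<ge> 0" and \<kappa>_pos: "\<kappa> > 0" and R_pos: "R > 0"
    and T_pos: "T > 0" and \<omega>_space: "\<omega> \<in> space M" and well: "well_conditioned \<kappa> R T \<omega>"
    and tuned: "well_tuned (\<kappa> * real T) (a * real T) (R * sqrt (real T)) min_signal r \<gamma> (lam T)"
  shows "adaptive_lasso p (A T \<omega>) (G T \<omega>) \<theta>\<^sub>0 (obj T \<omega>) \<Theta> (\<theta>t T \<omega>) (\<theta>h T \<omega>) (lam T) \<gamma> r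
    (\<kappa> * real T) (a * real T) (R * sqrt (real T)) min_signal"
proof -
  have A_close: "\<bar>A T \<omega> i k / real T - C i k\<bar> \<le> \<kappa>" if "i < p" "k < p" for i k
    using well that by (simp add: well_conditioned_def)
  have "\<kappa> * real T * (l1_norm {..<p} h)\<^sup>2 \<le> quad_form {..<p} (A T \<omega>) h" for h
  proof -
    have "\<kappa> * (l1_norm {..<p} h)\<^sup>2 \<le> quad_form {..<p} C h - \<kappa> * (l1_norm {..<p} h)\<^sup>2"
      using coercive[of h] by simp
    also have "\<dots> \<le> quad_form {..<p} (\<lambda>i k. A T \<omega> i k / real T) h"
      by (rule quad_form_perturb) (use A_close in auto)
    also have "\<dots> = quad_form {..<p} (A T \<omega>) h / real T"
      by (simp add: quad_form_def sum_divide_distrib)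
    finally show ?thesis using T_pos by (simp add: pos_le_divide_eq mult_ac)
  qed
  moreover have "\<bar>A T \<omega> i k\<bar> \<le> a * real T" if "i < p" "k < p" for i k
  proof -
    have "\<bar>A T \<omega> i k / real T\<bar> \<le> a" using A_close[OF that] C_bound(1)[OF that] by linarith
    then show ?thesis using T_pos by (simp add: abs_divide pos_divide_le_eq)
  qed
  moreover have "\<bar>G T \<omega> i\<bar> \<le> R * sqrt (real T)" if "i < p" for i
    using well that T_pos by (simp add: well_conditioned_def abs_divide pos_divide_le_eq)
  ultimately show ?thesis
    using C_bound(2) \<kappa>_pos R_pos T_pos tuned
    by (intro adaptive_lasso.intro objective[OF \<omega>_space] adaptive_lasso_axioms.intro \<theta>\<^sub>0_Rp \<Theta>_Rp box_\<Theta> min_signal_le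
        min_signal_pos lam_pos \<gamma>_pos tilde_min[OF \<omega>_space] hat_min[OF \<omega>_space]) auto
qed

lemma eventually_oracle_bounds:
  assumes coercive: "\<And>h. 2 * \<kappa> * (l1_norm {..<p} h)\<^sup>2 \<le> quad_form {..<p} C h" and \<kappa>_pos: "\<kappa> > 0" and R_pos: "R > 0"
  shows "\<forall>\<^sub>F T in sequentially. \<forall>\<omega>\<in>space M. well_conditioned \<kappa> R T \<omega> \<longrightarrow> oracle_bounds ((2 * R + 1) / \<kappa>) T \<omega>"
proof -
  define a where "a = l1_norm {..<p} (\<lambda>i. l1_norm {..<p} (C i)) + \<kappa>"
  have a_nonneg: "a \<ge> 0" using \<kappa>_pos by (simp add: a_def l1_norm_nonneg add_nonneg_nonneg)
  have C_le: "\<bar>C i k\<bar> + \<kappa> \<le> a" if "i < p" "k < p" for i k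
    using abs_le_l1_norm[of "{..<p}" k "C i"] abs_le_l1_norm[of "{..<p}" i "\<lambda>i. l1_norm {..<p} (C i)"] that
    by (simp add: a_def)
  from eventually_well_tuned[OF lam_pos lam_small lam_large \<kappa>_pos a_nonneg R_pos min_signal_pos r_pos]
  show ?thesis
    using eventually_gt_at_top[of 0]
  proof eventually_elim
    case (elim T)
    show ?case
    proof (intro ballI impI)
      fix \<omega> assume \<omega>_space: "\<omega> \<in> space M" "well_conditioned \<kappa> R T \<omega>"
      interpret lasso: adaptive_lasso p "A T \<omega>" "G T \<omega>" \<theta>\<^sub>0 "obj T \<omega>" \<Theta> "\<theta>t T \<omega>" "\<theta>h T \<omega>" "lam T" \<gamma> r
        "\<kappa> * real T" "a * real T" "R * sqrt (real T)" min_signal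
        using elim
        by (intro adaptive_lasso_if_well_conditioned[OF coercive C_le a_nonneg \<kappa>_pos R_pos _ \<omega>_space]) auto
      have "l1_norm {..<p} (error T \<omega>) \<le> (2 * R + 1) / \<kappa> / sqrt (real T)"
        using lasso.l1_norm_hat_error_le elim unfolding error_def by linarith
      moreover have "0 < sqrt (real T)" using elim by simp
      ultimately have "sqrt (real T) * l1_norm {..<p} (error T \<omega>) \<le> (2 * R + 1) / \<kappa>"
        by (simp only: pos_le_divide_eq mult.commute)
      then show "oracle_bounds ((2 * R + 1) / \<kappa>) T \<omega>"
        unfolding oracle_bounds_def using lasso.hat_eq_zero lasso.hat_first_order by (auto simp: S_def error_def)
    qed
  qed
qed

lemma oracle_bounds_in_prob:
  assumes e_pos: "e > 0"
  shows "\<exists>b. eventually_except e (oracle_bounds b)"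
proof -
  obtain \<kappa>' where "\<kappa>' > 0" "\<And>h. \<kappa>' * (l1_norm {..<p} h)\<^sup>2 \<le> quad_form {..<p} C h"
    using posdef_on_l1_lower_bound[OF posdef_C] by blast
  then obtain \<kappa> where \<kappa>_bound: "\<kappa> > 0" "\<And>h. 2 * \<kappa> * (l1_norm {..<p} h)\<^sup>2 \<le> quad_form {..<p} C h"
    by (metis half_gt_zero mult.commute nonzero_divide_eq_eq zero_neq_numeral)
  have "0 < e / 2" using e_pos by simp
  then obtain R where G_le_R: "eventually_except (e / 2) (\<lambda>T \<omega>. \<forall>i\<in>{..<p}. \<bar>G T \<omega> i / sqrt (real T)\<bar> \<le> R)"
    using bounded_in_prob_uniform[of "{..<p}" "\<lambda>T \<omega> i. G T \<omega> i / sqrt (real T)" "e / 2"] G_bounded_in_prob by auto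
  have "eventually_except (e / 2) (\<lambda>T \<omega>. \<forall>i<p. \<forall>k<p. \<bar>A T \<omega> i k / real T - C i k\<bar> \<le> \<kappa>)"
    using A_close_with_high_prob[OF \<kappa>_bound(1)] e_pos by (simp add: with_high_prob_def)
  from eventually_except_conj[OF this G_le_R] have "eventually_except e (well_conditioned \<kappa> (\<bar>R\<bar> + 1))"
    by (rule eventually_except_mono) (auto simp: well_conditioned_def intro!: always_eventually intro: order_trans)
  then have "eventually_except e (oracle_bounds ((2 * (\<bar>R\<bar> + 1) + 1) / \<kappa>))"
    by (rule eventually_except_mono) (use eventually_oracle_bounds[OF \<kappa>_bound(2,1), of "\<bar>R\<bar> + 1"] in simp)
  then show ?thesis by blast
qed

lemma with_high_prob_oracle:
  "with_high_prob (\<lambda>T \<omega>. (\<forall>j<p. \<theta>\<^sub>0 j = 0 \<longrightarrow> \<theta>h T \<omega> j = 0) \<and>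
    (\<forall>j\<in>S. \<bar>mat_vec {..<p} (A T \<omega>) (error T \<omega>) j - G T \<omega> j\<bar> \<le> lam T * max_weight / 2))"
  unfolding with_high_prob_def
proof (intro allI impI)
  fix e :: real assume "e > 0"
  then obtain b where "eventually_except e (oracle_bounds b)" using oracle_bounds_in_prob by blast
  then show "eventually_except e (\<lambda>T \<omega>. (\<forall>j<p. \<theta>\<^sub>0 j = 0 \<longrightarrow> \<theta>h T \<omega> j = 0) \<and>
    (\<forall>j\<in>S. \<bar>mat_vec {..<p} (A T \<omega>) (error T \<omega>) j - G T \<omega> j\<bar> \<le> lam T * max_weight / 2))"
    by (rule eventually_except_mono) (simp add: oracle_bounds_def always_eventually)
qed

theorem selection_consistency: "(\<lambda>T. prob {\<omega> \<in> space M. \<forall>i<p. i \<notin> S \<longrightarrow> \<theta>h T \<omega> i = 0}) \<longlonglongrightarrow> 1"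
proof (rule prob_tendsto_one_if_with_high_prob)
  show "with_high_prob (\<lambda>T \<omega>. \<forall>i<p. i \<notin> S \<longrightarrow> \<theta>h T \<omega> i = 0)"
    by (rule with_high_prob_mono[OF with_high_prob_oracle]) (auto simp: S_def)
  have "{\<omega> \<in> space M. \<forall>i<p. i \<notin> S \<longrightarrow> \<theta>h T \<omega> i = 0} = {\<omega> \<in> space M. \<forall>i\<in>{..<p} - S. \<theta>h T \<omega> i = 0}" for T
    by auto
  also have "\<dots> T \<in> events" for T using hat_measurable by measurable
  finally show "{\<omega> \<in> space M. \<forall>i<p. i \<notin> S \<longrightarrow> \<theta>h T \<omega> i = 0} \<in> events" for T .
qed

lemma error_bounded_in_prob:
  assumes i_less: "i < p"
  shows "bounded_in_prob (\<lambda>T \<omega>. sqrt (real T) * error T \<omega> i)"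
  unfolding bounded_in_prob_def
proof (intro allI impI)
  fix e :: real assume "e > 0"
  then obtain b where b_bounds: "eventually_except e (oracle_bounds b)" using oracle_bounds_in_prob by blast
  have "\<bar>sqrt (real T) * error T \<omega> i\<bar> \<le> b" if "oracle_bounds b T \<omega>" for T \<omega>
  proof -
    have "sqrt (real T) * \<bar>error T \<omega> i\<bar> \<le> sqrt (real T) * l1_norm {..<p} (error T \<omega>)"
      using i_less by (intro mult_left_mono abs_le_l1_norm) auto
    then show ?thesis using that by (simp add: oracle_bounds_def abs_mult)
  qed
  then have "eventually_except e (\<lambda>T \<omega>. \<bar>sqrt (real T) * error T \<omega> i\<bar> \<le> b)"
    by (intro eventually_except_mono[OF b_bounds] always_eventually) blast
  then show "\<exists>b. eventually_except e (\<lambda>T \<omega>. \<bar>sqrt (real T) * error T \<omega> i\<bar> \<le> b)" by blast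
qed

lemma linearization:
  assumes k_in_S: "k \<in> S"
  shows "tendsto_in_prob (\<lambda>T \<omega>. mat_vec S C (\<lambda>l. sqrt (real T) * error T \<omega> l) k - G T \<omega> k / sqrt (real T)) 0"
proof -
  let ?X = "\<lambda>T \<omega>. \<Sum>l<p. (C k l - A T \<omega> k l / real T) * (sqrt (real T) * error T \<omega> l)"
  let ?Y = "\<lambda>T \<omega>. (mat_vec {..<p} (A T \<omega>) (error T \<omega>) k - G T \<omega> k) / sqrt (real T)"
  have k_less: "k < p" using k_in_S by (simp add: S_def)
  have C_A: "tendsto_in_prob (\<lambda>T \<omega>. C k l - A T \<omega> k l / real T) 0" if "l < p" for l
    using A_lln[OF k_less that] by (simp add: tendsto_in_prob_def abs_minus_commute)
  have "tendsto_in_prob ?X (\<Sum>l<p. 0)"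
    by (intro tendsto_in_prob_sum tendsto_in_prob_zero_mult_bounded C_A error_bounded_in_prob) auto
  moreover have "tendsto_in_prob ?Y 0"
  proof (rule tendsto_in_prob_zero_if_le)
    have "(\<lambda>T. max_weight / 2 * (lam T / sqrt (real T))) \<longlonglongrightarrow> 0"
      by (rule tendsto_mult_right_zero[OF lam_small])
    then show "(\<lambda>T. lam T * max_weight / 2 / sqrt (real T)) \<longlonglongrightarrow> 0" by (simp add: mult_ac)
    show "with_high_prob (\<lambda>T \<omega>. \<bar>?Y T \<omega>\<bar> \<le> lam T * max_weight / 2 / sqrt (real T))"
      using k_in_S by (intro with_high_prob_mono[OF with_high_prob_oracle] always_eventually)
        (auto simp: abs_divide intro!: divide_right_mono simp del: divide_divide_eq_left)
  qed
  ultimately have "tendsto_in_prob (\<lambda>T \<omega>. ?X T \<omega> + ?Y T \<omega>) 0" using tendsto_in_prob_add by fastforce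
  then show ?thesis
  proof (rule tendsto_in_prob_cong_with_high_prob, intro with_high_prob_mono[OF with_high_prob_oracle])
    show "\<forall>\<^sub>F T in sequentially. \<forall>\<omega>\<in>space M. (\<forall>j<p. \<theta>\<^sub>0 j = 0 \<longrightarrow> \<theta>h T \<omega> j = 0) \<and>
        (\<forall>j\<in>S. \<bar>mat_vec {..<p} (A T \<omega>) (error T \<omega>) j - G T \<omega> j\<bar> \<le> lam T * max_weight / 2) \<longrightarrow>
      ?X T \<omega> + ?Y T \<omega> = mat_vec S C (\<lambda>l. sqrt (real T) * error T \<omega> l) k - G T \<omega> k / sqrt (real T)"
      using eventually_gt_at_top[of 0]
    proof (eventually_elim, intro ballI impI, elim conjE)
      fix T :: nat and \<omega> assume T_pos: "T > 0" and sparse: "\<forall>j<p. \<theta>\<^sub>0 j = 0 \<longrightarrow> \<theta>h T \<omega> j = 0"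
      have "mat_vec S C (\<lambda>l. sqrt (real T) * error T \<omega> l) k = mat_vec {..<p} C (\<lambda>l. sqrt (real T) * error T \<omega> l) k"
        unfolding mat_vec_def using sparse S_subset by (intro sum.mono_neutral_left) (auto simp: S_def error_def)
      moreover have "a / real T * (sqrt (real T) * x) = a * x / sqrt (real T)" for a x
        using T_pos real_div_sqrt[of "real T"] by (simp add: divide_eq_eq eq_divide_eq)
      then have "(\<Sum>l<p. A T \<omega> k l / real T * (sqrt (real T) * error T \<omega> l))
          = mat_vec {..<p} (A T \<omega>) (error T \<omega>) k / sqrt (real T)"
        by (simp only: mat_vec_def sum_divide_distrib)
      ultimately show "?X T \<omega> + ?Y T \<omega> = mat_vec S C (\<lambda>l. sqrt (real T) * error T \<omega> l) k - G T \<omega> k / sqrt (real T)"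
        by (simp add: left_diff_distrib sum_subtractf diff_divide_distrib mat_vec_def[of "{..<p}" C])
    qed
  qed
qed

lemma error_char_tendsto:
  "(\<lambda>T. expectation (\<lambda>\<omega>. cis (inner_on S \<xi> (\<lambda>i. sqrt (real T) * error T \<omega> i))))
    \<longlonglongrightarrow> of_real (exp (- quad_form S (sandwich S C B) \<xi> / 2))"
proof (rule char_tendsto_if_diff_tendsto_in_prob)
  have C_S: "posdef_on S C" by (rule posdef_on_subset[OF posdef_C S_subset]) simp
  define \<eta> where "\<eta> = mat_vec S (inv_on S C) \<xi>"
  define \<eta>' where "\<eta>' k = (if k \<in> S then \<eta> k else 0)" for k
  have extend: "inner_on {..<p} \<eta>' w = inner_on S \<eta> w" "quad_form {..<p} B \<eta>' = quad_form S B \<eta>" for w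
    unfolding \<eta>'_def using S_subset by (simp_all add: inner_on_zero_extend quad_form_zero_extend)
  show "(\<lambda>\<omega>. inner_on S \<xi> (\<lambda>i. sqrt (real T) * error T \<omega> i)) \<in> borel_measurable M" for T
    using hat_measurable by (intro borel_measurable_inner_on) (simp add: error_def)
  show "(\<lambda>\<omega>. inner_on {..<p} \<eta>' (G T \<omega>) / sqrt (real T)) \<in> borel_measurable M" for T
    using G_measurable by (intro borel_measurable_divide borel_measurable_inner_on) auto
  have "inner_on S \<xi> w = inner_on S \<eta> (mat_vec S C w)" for w
    by (simp add: \<eta>_def inner_on_inv_on_mat_vec[OF finite_S C_S])
  then have "inner_on S \<xi> (\<lambda>i. sqrt (real T) * error T \<omega> i) - inner_on {..<p} \<eta>' (G T \<omega>) / sqrt (real T)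
      = (\<Sum>k\<in>S. \<eta> k * (mat_vec S C (\<lambda>l. sqrt (real T) * error T \<omega> l) k - G T \<omega> k / sqrt (real T)))" for T \<omega>
    unfolding extend by (simp add: inner_on_def right_diff_distrib sum_subtractf sum_divide_distrib)
  moreover have "tendsto_in_prob (\<lambda>T \<omega>. \<Sum>k\<in>S. \<eta> k *
      (mat_vec S C (\<lambda>l. sqrt (real T) * error T \<omega> l) k - G T \<omega> k / sqrt (real T))) (\<Sum>k\<in>S. 0)"
    by (intro tendsto_in_prob_sum tendsto_in_prob_cmult_zero linearization)
  ultimately show "tendsto_in_prob (\<lambda>T \<omega>. inner_on S \<xi> (\<lambda>i. sqrt (real T) * error T \<omega> i)
      - inner_on {..<p} \<eta>' (G T \<omega>) / sqrt (real T)) 0" by simp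
  show "(\<lambda>T. expectation (\<lambda>\<omega>. cis (inner_on {..<p} \<eta>' (G T \<omega>) / sqrt (real T))))
      \<longlonglongrightarrow> of_real (exp (- quad_form S (sandwich S C B) \<xi> / 2))"
    using G_clt[of \<eta>'] by (simp add: extend quad_form_sandwich[OF finite_S C_S] \<eta>_def)
qed

theorem asymptotic_normality:
  "\<exists>\<mu>. gaussian_on S (sandwich S C B) \<mu> \<and>
    conv_dist_to M S (\<lambda>T \<omega>. \<lambda>i\<in>S. sqrt (real T) * (\<theta>h T \<omega> i - \<theta>\<^sub>0 i)) \<mu>"
proof -
  have "posdef_on S C" "posdef_on S B"
    using posdef_on_subset[OF posdef_C S_subset] posdef_on_subset[OF posdef_B S_subset] by simp_all
  then obtain \<mu> where \<mu>_gaussian: "gaussian_on S (sandwich S C B) \<mu>"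
    using ex_gaussian_on_sandwich[OF finite_S] by blast
  have "conv_dist_to M S (\<lambda>T \<omega>. \<lambda>i\<in>S. sqrt (real T) * (\<theta>h T \<omega> i - \<theta>\<^sub>0 i)) \<mu>"
  proof (rule levy_continuity_PiM[OF prob_space_axioms _ finite_S restrict_extensional])
    show "(\<lambda>T. \<integral>\<omega>. cis (inner_on S \<xi> (\<lambda>i\<in>S. sqrt (real T) * (\<theta>h T \<omega> i - \<theta>\<^sub>0 i))) \<partial>M)
        \<longlonglongrightarrow> (\<integral>x. cis (inner_on S \<xi> x) \<partial>\<mu>)" for \<xi>
    proof -
      have "inner_on S \<xi> (\<lambda>i\<in>S. sqrt (real T) * (\<theta>h T \<omega> i - \<theta>\<^sub>0 i))
          = inner_on S \<xi> (\<lambda>i. sqrt (real T) * error T \<omega> i)"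
        for T \<omega> by (rule inner_on_cong) (simp_all add: error_def)
      then show ?thesis using error_char_tendsto[of \<xi>] \<mu>_gaussian by (simp add: gaussian_on_iff)
    qed
  qed (use \<mu>_gaussian hat_measurable in \<open>simp_all add: gaussian_on_def\<close>)
  then show ?thesis using \<mu>_gaussian by blast
qed

end

section \<open>The interval-valued regression model\<close>

subsection \<open>The least squares objective\<close>

lemma innerK_expand:
  "innerK K A B = K (-1) (-1) * fst A * fst B - K (-1) 1 * fst A * snd B - K 1 (-1) * snd A * fst B
    + K 1 1 * snd A * snd B"
  by (simp add: innerK_def supp_def)

lemma innerK_commute: "kernel_pd K \<Longrightarrow> innerK K A B = innerK K B A"
  by (simp add: innerK_expand kernel_pd_def)

lemma innerK_ilin_left: "innerK K (ilin p A h) B = (\<Sum>i<p. h i * innerK K (A i) B)"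
  by (simp add: innerK_expand ilin_def sum.distrib sum_subtractf sum_distrib_left sum_distrib_right algebra_simps)

lemma innerK_ilin_right: "kernel_pd K \<Longrightarrow> innerK K B (ilin p A h) = (\<Sum>i<p. innerK K B (A i) * h i)"
  by (simp add: innerK_commute[of K B] innerK_ilin_left mult.commute)

lemma normK2_isub: "kernel_pd K \<Longrightarrow> normK2 K (isub A B) = normK2 K A - 2 * innerK K B A + normK2 K B"
  by (simp add: normK2_def innerK_expand isub_def kernel_pd_def algebra_simps)

lemma normK2_ilin: "kernel_pd K \<Longrightarrow> normK2 K (ilin p A h) = quad_form {..<p} (\<lambda>i k. innerK K (A i) (A k)) h"
  by (simp add: normK2_def innerK_ilin_left innerK_ilin_right quad_form_def sum_distrib_left mult.assoc)

lemma resid_eq_isub: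
  "resid q s J Y X \<theta> t \<omega> =
    isub (resid q s J Y X \<theta>\<^sub>0 t \<omega>) (ilin (dimZ q s J) (Zvec q s J Y X t \<omega>) (\<theta> - \<theta>\<^sub>0))"
  by (simp add: resid_def isub_def ilin_def left_diff_distrib sum_subtractf)

definition gram :: "(int \<Rightarrow> int \<Rightarrow> real) \<Rightarrow> nat \<Rightarrow> nat \<Rightarrow> nat \<Rightarrow> (int \<Rightarrow> 'a \<Rightarrow> interval)
   \<Rightarrow> (nat \<Rightarrow> int \<Rightarrow> 'a \<Rightarrow> interval) \<Rightarrow> nat \<Rightarrow> 'a \<Rightarrow> nat \<Rightarrow> nat \<Rightarrow> real" where
  "gram K q s J Y X T \<omega> i k =
    (\<Sum>t=1..T. innerK K (Zvec q s J Y X (int t) \<omega> i) (Zvec q s J Y X (int t) \<omega> k))"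

definition cross_moment :: "(int \<Rightarrow> int \<Rightarrow> real) \<Rightarrow> nat \<Rightarrow> nat \<Rightarrow> nat \<Rightarrow> (int \<Rightarrow> 'a \<Rightarrow> interval)
   \<Rightarrow> (nat \<Rightarrow> int \<Rightarrow> 'a \<Rightarrow> interval) \<Rightarrow> (nat \<Rightarrow> real) \<Rightarrow> nat \<Rightarrow> 'a \<Rightarrow> nat \<Rightarrow> real" where
  "cross_moment K q s J Y X \<theta> T \<omega> i =
    (\<Sum>t=1..T. innerK K (Zvec q s J Y X (int t) \<omega> i) (resid q s J Y X \<theta> (int t) \<omega>))"

lemma quadratic_objective_DKobj:
  assumes kern: "kernel_pd K"
  shows "quadratic_objective (dimZ q s J) (gram K q s J Y X T \<omega>) (cross_moment K q s J Y X \<theta>\<^sub>0 T \<omega>) \<theta>\<^sub>0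
    (DKobj K q s J Y X T \<omega>)"
proof
  let ?p = "dimZ q s J" and ?Z = "\<lambda>t. Zvec q s J Y X t \<omega>" and ?u = "\<lambda>t. resid q s J Y X \<theta>\<^sub>0 t \<omega>"
  show "symmetric_on {..<?p} (gram K q s J Y X T \<omega>)"
    unfolding symmetric_on_def gram_def by (intro ballI sum.cong refl innerK_commute kern)
  fix \<theta>
  let ?h = "\<theta> - \<theta>\<^sub>0" and ?N = "\<lambda>t. quad_form {..<?p} (\<lambda>i k. innerK K (?Z t i) (?Z t k)) (\<theta> - \<theta>\<^sub>0)"
  have "normK2 K (resid q s J Y X \<theta> t \<omega>)
      = normK2 K (?u t) - 2 * (\<Sum>i<?p. ?h i * innerK K (?Z t i) (?u t)) + ?N t" for t
    unfolding resid_eq_isub[of q s J Y X \<theta> t \<omega> \<theta>\<^sub>0] normK2_isub[OF kern] normK2_ilin[OF kern] innerK_ilin_left ..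
  then have "DKobj K q s J Y X T \<omega> \<theta> = DKobj K q s J Y X T \<omega> \<theta>\<^sub>0
      - 2 * (\<Sum>t=1..T. \<Sum>i<?p. ?h i * innerK K (?Z (int t) i) (?u (int t))) + (\<Sum>t=1..T. ?N (int t))"
    by (simp add: DKobj_def sum.distrib sum_subtractf flip: sum_distrib_left)
  moreover have "(\<Sum>t=1..T. \<Sum>i<?p. ?h i * innerK K (?Z (int t) i) (?u (int t)))
      = inner_on {..<?p} ?h (cross_moment K q s J Y X \<theta>\<^sub>0 T \<omega>)"
    unfolding inner_on_def cross_moment_def sum_distrib_left by (rule sum.swap)
  moreover have "(\<Sum>t=1..T. ?N (int t)) = quad_form {..<?p} (gram K q s J Y X T \<omega>) ?h"
  proof -
    have "(\<Sum>t=1..T. ?N (int t)) = (\<Sum>i<?p. \<Sum>t=1..T. \<Sum>k<?p. ?h i * innerK K (?Z (int t) i) (?Z (int t) k) * ?h k)"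
      unfolding quad_form_def by (rule sum.swap)
    also have "\<dots> = (\<Sum>i<?p. \<Sum>k<?p. \<Sum>t=1..T. ?h i * innerK K (?Z (int t) i) (?Z (int t) k) * ?h k)"
      by (intro sum.cong refl sum.swap)
    finally show ?thesis by (simp add: quad_form_def gram_def sum_distrib_left sum_distrib_right)
  qed
  ultimately show "DKobj K q s J Y X T \<omega> \<theta> = DKobj K q s J Y X T \<omega> \<theta>\<^sub>0
      - 2 * inner_on {..<?p} ?h (cross_moment K q s J Y X \<theta>\<^sub>0 T \<omega>) + quad_form {..<?p} (gram K q s J Y X T \<omega>) ?h"
    by simp
qed

lemma box_in_relative_neighbourhood:
  assumes U_open: "openin (top_of_set (Rp p)) U" and \<theta>_in_U: "\<theta> \<in> U"
  shows "\<exists>r>0. \<forall>\<theta>'\<in>Rp p. (\<forall>i<p. \<bar>\<theta>' i - \<theta> i\<bar> < r) \<longrightarrow> \<theta>' \<in> U"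
proof -
  obtain V where V_open: "open V" "U = Rp p \<inter> V" using U_open by (auto simp: openin_open)
  then have \<theta>R: "\<theta> \<in> Rp p" "\<theta> \<in> V" using \<theta>_in_U by auto
  have "openin (product_topology (\<lambda>_. euclidean) UNIV) V" using V_open(1) by (simp add: euclidean_product_topology)
  from product_topology_open_contains_basis[OF this \<theta>R(2)]
  obtain B where B_basis: "\<theta> \<in> PiE UNIV B" "\<And>i. open (B i)" "PiE UNIV B \<subseteq> V" by auto
  have "\<exists>r>0. ball (\<theta> i) r \<subseteq> B i" for i
    using B_basis(1) B_basis(2)[of i] by (auto simp: open_contains_ball PiE_iff)
  then obtain r where r_ball: "\<And>i. r i > 0" "\<And>i. ball (\<theta> i) (r i) \<subseteq> B i" by metis
  define r\<^sub>0 where "r\<^sub>0 = Min (insert 1 (r ` {..<p}))"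
  have "r\<^sub>0 > 0" using r_ball(1) by (auto simp: r\<^sub>0_def)
  moreover have "\<theta>' \<in> U" if "\<theta>' \<in> Rp p" "\<forall>i<p. \<bar>\<theta>' i - \<theta> i\<bar> < r\<^sub>0" for \<theta>'
  proof -
    have "\<theta>' i \<in> ball (\<theta> i) (r i)" for i
    proof (cases "i < p")
      case True
      then have "r\<^sub>0 \<le> r i" unfolding r\<^sub>0_def by (intro Min_le) auto
      then show ?thesis using that True by (fastforce simp: dist_real_def)
    next
      case False
      then show ?thesis using that(1) \<theta>R(1) r_ball(1) by (simp add: Rp_def)
    qed
    then show ?thesis using r_ball(2) B_basis(3) V_open(2) that(1) by blast
  qed
  ultimately show ?thesis by blast
qed

subsection \<open>The process on path space\<close>

definition canonical_Y :: "int \<Rightarrow> (int \<times> nat \<Rightarrow> real) \<Rightarrow> interval" where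
  "canonical_Y t x = (x (t, 0), x (t, 1))"

definition canonical_X :: "nat \<Rightarrow> int \<Rightarrow> (int \<times> nat \<Rightarrow> real) \<Rightarrow> interval" where
  "canonical_X j t x = (x (t, 2 + 2 * j), x (t, 3 + 2 * j))"

abbreviation "canonical_Z q s J \<equiv> Zvec q s J canonical_Y canonical_X"
abbreviation "canonical_resid q s J \<equiv> resid q s J canonical_Y canonical_X"

lemma canonical_path:
  "canonical_Y t (path Y X J \<omega>) = Y t \<omega>"
  "j < J \<Longrightarrow> canonical_X j t (path Y X J \<omega>) = X j t \<omega>"
  by (simp_all add: canonical_Y_def canonical_X_def path_def coord_def)

lemma Zvec_X_index: "i < dimZ q s J \<Longrightarrow> \<not> i < 2 + q \<Longrightarrow> (i - (2 + q)) mod J < J"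
  by (cases J) (auto simp: dimZ_def)

lemma Zvec_cases:
  fixes Y :: "int \<Rightarrow> 'a \<Rightarrow> interval" and X :: "nat \<Rightarrow> int \<Rightarrow> 'a \<Rightarrow> interval"
  assumes "i < dimZ q s J"
  obtains (deterministic) c where "\<And>t \<omega>. Zvec q s J Y X t \<omega> i = c"
  | (lagged_Y) l where "\<And>t \<omega>. Zvec q s J Y X t \<omega> i = Y (t - 1 - int l) \<omega>"
  | (lagged_X) j l where "j < J" "\<And>t \<omega>. Zvec q s J Y X t \<omega> i = X j (t - int l) \<omega>"
proof -
  consider (intercept) "i = 0 \<or> i = 1" | (endogenous) "i \<noteq> 0" "i \<noteq> 1" "i < 2 + q"
    | (exogenous) "i \<noteq> 0" "i \<noteq> 1" "\<not> i < 2 + q" by blast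
  then show thesis
  proof cases
    case endogenous
    then have "t - int (i - 1) = t - 1 - int (i - 2)" for t by linarith
    with endogenous show thesis by (intro lagged_Y[of "i - 2"]) (simp only: Zvec_def if_False if_True)
  next
    case exogenous
    then show thesis
      using Zvec_X_index[OF assms exogenous(3)]
      by (intro lagged_X[of "(i - (2 + q)) mod J" "(i - (2 + q)) div J"]) (simp_all add: Zvec_def)
  qed (auto intro: deterministic simp: Zvec_def)
qed

lemma Zvec_path:
  "i < dimZ q s J \<Longrightarrow> canonical_Z q s J t (path Y X J \<omega>) i = Zvec q s J Y X t \<omega> i"
  using Zvec_X_index[of i q s J] by (simp add: Zvec_def canonical_path)

lemma resid_path:
  "canonical_resid q s J \<theta> t (path Y X J \<omega>) = resid q s J Y X \<theta> t \<omega>"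
  by (simp add: resid_def ilin_def canonical_path Zvec_path)

lemma canonical_shift1:
  "canonical_Y t (shift1 x) = canonical_Y (t + 1) x" "canonical_X j t (shift1 x) = canonical_X j (t + 1) x"
  by (simp_all add: canonical_Y_def canonical_X_def shift1_def)

lemma Zvec_shift1:
  "canonical_Z q s J t (shift1 x) i = canonical_Z q s J (t + 1) x i"
  by (simp add: Zvec_def canonical_shift1 algebra_simps)

lemma resid_shift1:
  "canonical_resid q s J \<theta> t (shift1 x) = canonical_resid q s J \<theta> (t + 1) x"
  by (simp add: resid_def ilin_def canonical_shift1 Zvec_shift1)

lemma shift1_funpow:
  "canonical_Z q s J t ((shift1 ^^ k) x) i = canonical_Z q s J (t + int k) x i"
  "canonical_resid q s J \<theta> t ((shift1 ^^ k) x) = canonical_resid q s J \<theta> (t + int k) x"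
  by (induction k arbitrary: t) (simp_all add: Zvec_shift1 resid_shift1 algebra_simps)

lemma measurable_PS_iff: "f \<in> measurable M PS \<longleftrightarrow> (\<forall>t c. (\<lambda>\<omega>. f \<omega> (t, c)) \<in> borel_measurable M)"
proof
  assume "f \<in> measurable M PS"
  then show "\<forall>t c. (\<lambda>\<omega>. f \<omega> (t, c)) \<in> borel_measurable M"
    unfolding PS_def by (auto intro: measurable_compose[OF _ measurable_component_singleton])
next
  assume "\<forall>t c. (\<lambda>\<omega>. f \<omega> (t, c)) \<in> borel_measurable M"
  then have "(\<lambda>\<omega>. \<lambda>i\<in>UNIV. f \<omega> i) \<in> measurable M (Pi\<^sub>M UNIV (\<lambda>_. borel))"
    by (intro measurable_restrict) auto
  then show "f \<in> measurable M PS" by (simp add: PS_def restrict_UNIV)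
qed

lemma coordinate_measurable_PS[measurable]: "(\<lambda>x. x (t, c)) \<in> borel_measurable PS"
  using measurable_PS_iff[of "\<lambda>x. x" PS] by simp

lemma shift1_measurable[measurable]: "shift1 \<in> measurable PS PS"
  by (simp add: measurable_PS_iff shift1_def)

lemma canonical_measurable[measurable]:
  "(\<lambda>x. fst (canonical_Y t x)) \<in> borel_measurable PS" "(\<lambda>x. snd (canonical_Y t x)) \<in> borel_measurable PS"
  "(\<lambda>x. fst (canonical_X j t x)) \<in> borel_measurable PS" "(\<lambda>x. snd (canonical_X j t x)) \<in> borel_measurable PS"
  by (simp_all add: canonical_Y_def canonical_X_def)

lemma Zvec_canonical_measurable[measurable]:
  "(\<lambda>x. fst (canonical_Z q s J t x i)) \<in> borel_measurable PS"
  "(\<lambda>x. snd (canonical_Z q s J t x i)) \<in> borel_measurable PS"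
  by (cases "i = 0"; cases "i = 1"; cases "i < 2 + q"; simp add: Zvec_def)+

lemma resid_canonical_measurable[measurable]:
  "(\<lambda>x. fst (canonical_resid q s J \<theta> t x)) \<in> borel_measurable PS"
  "(\<lambda>x. snd (canonical_resid q s J \<theta> t x)) \<in> borel_measurable PS"
  unfolding resid_def isub_def ilin_def by simp_all

locale stationary_ergodic_process = prob_space M for M :: "'a measure" +
  fixes Y :: "int \<Rightarrow> 'a \<Rightarrow> interval" and X :: "nat \<Rightarrow> int \<Rightarrow> 'a \<Rightarrow> interval" and J :: nat
  assumes meas: "process_measurable M Y X J"
    and stat: "strictly_stationary M Y X J"
    and erg: "ergodic M Y X J"
begin

lemma path_measurable[measurable]: "path Y X J \<in> measurable M PS"
  unfolding measurable_PS_iff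
proof (intro allI)
  show "(\<lambda>\<omega>. path Y X J \<omega> (t, c)) \<in> borel_measurable M" for t c
    using meas by (cases "c < 2 + 2 * J") (auto simp: path_def process_measurable_def)
qed

lemma sets_law: "sets (law M Y X J) = sets PS"
  by (simp add: law_def)

lemma ergodic_system_law: "ergodic_system (law M Y X J) shift1"
proof (intro ergodic_system.intro ergodic_system_axioms.intro)
  let ?L = "law M Y X J"
  show "prob_space ?L" unfolding law_def by (rule prob_space_distr[OF path_measurable])
  show "shift1 \<in> measurable ?L ?L" using measurable_cong_sets[OF sets_law sets_law] shift1_measurable by blast
  have "distr ?L ?L shift1 = distr ?L PS shift1" by (rule distr_cong) (auto simp: sets_law)
  then show "distr ?L ?L shift1 = ?L" using stat by (simp add: strictly_stationary_def)
  show "measure ?L A = 0 \<or> measure ?L A = 1" if "A \<in> sets ?L" "shift1 -` A \<inter> space ?L = A" for A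
    using erg that unfolding ergodic_def sets_law by (simp add: law_def)
qed

lemma distr_shift1_funpow:
  fixes \<Phi> :: "_ \<Rightarrow> real"
  assumes \<Phi>_measurable: "\<Phi> \<in> borel_measurable PS"
  shows "distr M borel (\<lambda>\<omega>. \<Phi> ((shift1 ^^ k) (path Y X J \<omega>))) = distr M borel (\<lambda>\<omega>. \<Phi> (path Y X J \<omega>))"
proof -
  interpret L: ergodic_system "law M Y X J" shift1 by (rule ergodic_system_law)
  have \<Phi>_law_measurable: "\<Phi> \<in> borel_measurable (law M Y X J)"
    using \<Phi>_measurable by (simp add: measurable_cong_sets[OF sets_law refl])
  have law: "distr M borel (\<lambda>\<omega>. \<Psi> (path Y X J \<omega>)) = distr (law M Y X J) borel \<Psi>"
    if "\<Psi> \<in> borel_measurable PS" for \<Psi> :: "_ \<Rightarrow> real"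
    unfolding law_def using that by (subst distr_distr) (auto simp: comp_def)
  have "(\<lambda>x. \<Phi> ((shift1 ^^ k) x)) \<in> borel_measurable (law M Y X J)"
    using measurable_compose[OF L.measurable_funpow \<Phi>_law_measurable] .
  then have "distr M borel (\<lambda>\<omega>. \<Phi> ((shift1 ^^ k) (path Y X J \<omega>)))
      = distr (law M Y X J) borel (\<Phi> \<circ> (shift1 ^^ k))"
    using law[of "\<lambda>x. \<Phi> ((shift1 ^^ k) x)"] by (simp add: measurable_cong_sets[OF sets_law refl] comp_def)
  also have "\<dots> = distr (law M Y X J) borel \<Phi>"
    using distr_distr[OF \<Phi>_law_measurable L.measurable_funpow] by (simp add: L.invariant_funpow)
  finally show ?thesis by (simp add: law[OF \<Phi>_measurable])
qed

lemma process_lln: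
  assumes [measurable]: "\<Phi> \<in> borel_measurable PS"
    and integrable_\<Phi>: "integrable M (\<lambda>\<omega>. \<Phi> (path Y X J \<omega>))"
  shows "tendsto_in_prob (\<lambda>n \<omega>. (\<Sum>k<n. \<Phi> ((shift1 ^^ k) (path Y X J \<omega>))) / real n)
    (expectation (\<lambda>\<omega>. \<Phi> (path Y X J \<omega>)))"
proof (rule tendsto_in_prob_if_AE_tendsto)
  let ?L = "law M Y X J"
  have "integrable ?L \<Phi>" unfolding law_def using integrable_\<Phi> by (subst integrable_distr_eq) auto
  then have "AE x in ?L. (\<lambda>n. (\<Sum>k<n. \<Phi> ((shift1 ^^ k) x)) / real n) \<longlonglongrightarrow> (\<integral>x. \<Phi> x \<partial>?L)"
    using ergodic_system.birkhoff_average_tendsto[OF ergodic_system_law] by (simp add: birkhoff_sum_def)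
  moreover have "(\<integral>x. \<Phi> x \<partial>?L) = expectation (\<lambda>\<omega>. \<Phi> (path Y X J \<omega>))"
    unfolding law_def by (rule integral_distr) auto
  ultimately show "AE \<omega> in M. (\<lambda>n. (\<Sum>k<n. \<Phi> ((shift1 ^^ k) (path Y X J \<omega>))) / real n)
      \<longlonglongrightarrow> expectation (\<lambda>\<omega>. \<Phi> (path Y X J \<omega>))"
    unfolding law_def by (auto dest: AE_distrD[OF path_measurable])
  have "shift1 ^^ k \<in> measurable PS PS" for k by (induction k) (auto intro: measurable_comp)
  then show "(\<lambda>\<omega>. (\<Sum>k<n. \<Phi> ((shift1 ^^ k) (path Y X J \<omega>))) / real n) \<in> borel_measurable M" for n
    by measurable
qed

end

subsection \<open>The information sets\<close>

lemma subset_info_generator: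
  "{coord Y X c r -` B \<inter> space M | c r B. B \<in> sets borel \<and>
        ((c < 2 \<and> r \<le> t - 1) \<or> (2 \<le> c \<and> c < 2 + 2 * J \<and> r \<le> t))} \<subseteq> Pow (space M)"
  by auto

lemma space_info: "space (info M Y X J t) = space M"
  unfolding info_def by (rule space_measure_of[OF subset_info_generator])

lemma sets_info: "sets (info M Y X J t) = sigma_sets (space M) {coord Y X c r -` B \<inter> space M | c r B.
    B \<in> sets borel \<and> ((c < 2 \<and> r \<le> t - 1) \<or> (2 \<le> c \<and> c < 2 + 2 * J \<and> r \<le> t))}"
  unfolding info_def by (rule sets_measure_of[OF subset_info_generator])

lemma coord_info_measurable:
  assumes "(c < 2 \<and> r \<le> t - 1) \<or> (2 \<le> c \<and> c < 2 + 2 * J \<and> r \<le> t)"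
  shows "coord Y X c r \<in> borel_measurable (info M Y X J t)"
proof (rule measurableI)
  show "coord Y X c r -` B \<inter> space (info M Y X J t) \<in> sets (info M Y X J t)" if "B \<in> sets borel" for B
    unfolding sets_info space_info by (rule sigma_sets.Basic) (use assms that in blast)
qed simp

lemma Y_info_measurable:
  assumes "r < t"
  shows "(\<lambda>\<omega>. fst (Y r \<omega>)) \<in> borel_measurable (info M Y X J t)"
    "(\<lambda>\<omega>. snd (Y r \<omega>)) \<in> borel_measurable (info M Y X J t)"
  using coord_info_measurable[of 0 r t J Y X M] coord_info_measurable[of 1 r t J Y X M] assms
  by (simp_all add: coord_def[abs_def])

lemma X_info_measurable:
  assumes "j < J" "r \<le> t"
  shows "(\<lambda>\<omega>. fst (X j r \<omega>)) \<in> borel_measurable (info M Y X J t)"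
    "(\<lambda>\<omega>. snd (X j r \<omega>)) \<in> borel_measurable (info M Y X J t)"
  using coord_info_measurable[of "2 + 2 * j" r t J Y X M]
    coord_info_measurable[of "3 + 2 * j" r t J Y X M] assms
  by (simp_all add: coord_def[abs_def])

lemma Zvec_info_measurable:
  assumes "i < dimZ q s J"
  shows "(\<lambda>\<omega>. fst (Zvec q s J Y X t \<omega> i)) \<in> borel_measurable (info M Y X J t)"
    "(\<lambda>\<omega>. snd (Zvec q s J Y X t \<omega> i)) \<in> borel_measurable (info M Y X J t)"
  by - (rule Zvec_cases[OF assms, of Y X]; simp add: Y_info_measurable X_info_measurable)+

lemma info_mono:
  assumes "t \<le> t'"
  shows "sets (info M Y X J t) \<subseteq> sets (info M Y X J t')"
  unfolding sets_info by (rule sigma_sets_mono') (use assms in force)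

lemma info_subalgebra_info:
  assumes "t \<le> t'"
  shows "subalgebra (info M Y X J t') (info M Y X J t)"
  using info_mono[OF assms] by (simp add: subalgebra_def space_info)

lemma info_subalgebra:
  assumes "process_measurable M Y X J"
  shows "subalgebra M (info M Y X J t)"
  unfolding subalgebra_def space_info sets_info
proof (intro conjI refl sets.sigma_sets_subset subsetI)
  fix A assume "A \<in> {coord Y X c r -` B \<inter> space M | c r B. B \<in> sets borel \<and>
        ((c < 2 \<and> r \<le> t - 1) \<or> (2 \<le> c \<and> c < 2 + 2 * J \<and> r \<le> t))}"
  then obtain c r B where "A = coord Y X c r -` B \<inter> space M" "B \<in> sets borel" "c < 2 + 2 * J" by auto
  then show "A \<in> sets M" using assms by (auto simp: process_measurable_def intro: measurable_sets)
qed

lemma resid_info_measurable: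
  assumes "t < t'"
  shows "(\<lambda>\<omega>. fst (resid q s J Y X \<theta> t \<omega>)) \<in> borel_measurable (info M Y X J t')"
    "(\<lambda>\<omega>. snd (resid q s J Y X \<theta> t \<omega>)) \<in> borel_measurable (info M Y X J t')"
proof -
  have "t \<le> t'" using assms by simp
  note up = measurable_from_subalg[OF info_subalgebra_info[OF this]]
  show "(\<lambda>\<omega>. fst (resid q s J Y X \<theta> t \<omega>)) \<in> borel_measurable (info M Y X J t')"
    "(\<lambda>\<omega>. snd (resid q s J Y X \<theta> t \<omega>)) \<in> borel_measurable (info M Y X J t')"
    unfolding resid_def isub_def ilin_def fst_conv snd_conv
    using Y_info_measurable[OF assms] up[OF Zvec_info_measurable(1)] up[OF Zvec_info_measurable(2)]
    by (auto intro!: borel_measurable_diff borel_measurable_sum borel_measurable_times)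
qed

subsection \<open>Moments of random intervals\<close>

definition finite_interval_moment :: "'a measure \<Rightarrow> nat \<Rightarrow> ('a \<Rightarrow> interval) \<Rightarrow> bool" where
  "finite_interval_moment M k A \<longleftrightarrow> finite_moment M k (\<lambda>\<omega>. fst (A \<omega>)) \<and> finite_moment M k (\<lambda>\<omega>. snd (A \<omega>))"

lemma finite_interval_moment_isub:
  "finite_interval_moment M k A \<Longrightarrow> finite_interval_moment M k B \<Longrightarrow>
    finite_interval_moment M k (\<lambda>\<omega>. isub (A \<omega>) (B \<omega>))"
  by (simp add: finite_interval_moment_def isub_def finite_moment_diff)

lemma (in finite_measure) finite_interval_moment_ilin:
  "(\<And>i. i < p \<Longrightarrow> finite_interval_moment M k (\<lambda>\<omega>. A \<omega> i)) \<Longrightarrow>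
    finite_interval_moment M k (\<lambda>\<omega>. ilin p (A \<omega>) h)"
  by (auto simp: finite_interval_moment_def ilin_def intro!: finite_moment_sum finite_moment_cmult)

lemma finite_moment_innerK:
  assumes "finite_interval_moment M (2 * k) A" "finite_interval_moment M (2 * k) B"
  shows "finite_moment M k (\<lambda>\<omega>. innerK K (A \<omega>) (B \<omega>))"
  using assms unfolding finite_interval_moment_def innerK_expand
  by (intro finite_moment_add finite_moment_diff finite_moment_mult finite_moment_cmult) simp_all

lemma coordinates_bounded_by_normK2:
  assumes "kernel_pd K"
  obtains c where "\<And>A. (fst A)\<^sup>2 \<le> c * normK2 K A" "\<And>A. (snd A)\<^sup>2 \<le> c * normK2 K A"
proof -
  define d where "d = K 1 1 * K (-1) (-1) - (K 1 (-1))\<^sup>2"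
  define c where "c = (K 1 1 + K (-1) (-1)) / d"
  have kernel: "K (-1) 1 = K 1 (-1)" "K 1 1 > 0" "d > 0" using assms by (auto simp: kernel_pd_def d_def)
  have "0 < K 1 1 * K (-1) (-1)"
    using kernel(3) zero_le_power2[of "K 1 (-1)"] unfolding d_def by linarith
  then have pos: "K (-1) (-1) > 0" using kernel(2) by (simp add: zero_less_mult_iff)
  have "K 1 1 * normK2 K A = (K 1 1 * snd A - K 1 (-1) * fst A)\<^sup>2 + d * (fst A)\<^sup>2"
    "K (-1) (-1) * normK2 K A = (K (-1) (-1) * fst A - K 1 (-1) * snd A)\<^sup>2 + d * (snd A)\<^sup>2" for A
    by (simp_all add: normK2_def innerK_expand d_def kernel(1) power2_eq_square algebra_simps)
  then have bound: "d * (fst A)\<^sup>2 \<le> K 1 1 * normK2 K A" "d * (snd A)\<^sup>2 \<le> K (-1) (-1) * normK2 K A" for A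
    by simp_all
  have nonneg: "0 \<le> normK2 K A" for A
    using order_trans[OF mult_nonneg_nonneg[of d "(fst A)\<^sup>2"] bound(1)] kernel by (simp add: zero_le_mult_iff)
  have "d * (fst A)\<^sup>2 \<le> (K 1 1 + K (-1) (-1)) * normK2 K A"
    "d * (snd A)\<^sup>2 \<le> (K 1 1 + K (-1) (-1)) * normK2 K A" for A
    using bound[of A] mult_nonneg_nonneg[OF _ nonneg[of A]] kernel(2) pos
    by (auto simp: distrib_right intro: order_trans)
  then have "(fst A)\<^sup>2 \<le> c * normK2 K A" "(snd A)\<^sup>2 \<le> c * normK2 K A" for A
    using kernel(3) by (simp_all add: c_def field_simps)
  then show thesis by (rule that)
qed

lemma finite_interval_moment_4_if_normK2:
  assumes kern: "kernel_pd K" and integrable_norm: "integrable M (\<lambda>\<omega>. (normK2 K (A \<omega>))\<^sup>2)"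
    and meas: "(\<lambda>\<omega>. fst (A \<omega>)) \<in> borel_measurable M" "(\<lambda>\<omega>. snd (A \<omega>)) \<in> borel_measurable M"
  shows "finite_interval_moment M 4 A"
proof -
  obtain c where c_bound: "\<And>A. (fst A)\<^sup>2 \<le> c * normK2 K A" "\<And>A. (snd A)\<^sup>2 \<le> c * normK2 K A"
    using coordinates_bounded_by_normK2[OF kern] by blast
  have "\<bar>x\<bar> ^ 4 \<le> c\<^sup>2 * (normK2 K A)\<^sup>2" if "x\<^sup>2 \<le> c * normK2 K A" for x A
    using power_mono[OF that, of 2] by (simp add: power_mult_distrib)
  from this[OF c_bound(1)] this[OF c_bound(2)] show ?thesis
    unfolding finite_interval_moment_def using integrable_norm
    by (intro conjI finite_moment_bound[where h="\<lambda>\<omega>. c\<^sup>2 * (normK2 K (A \<omega>))\<^sup>2"] meas) simp_all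
qed

lemma (in prob_space) integrable_if_finite_moment_2: "finite_moment M 2 f \<Longrightarrow> integrable M f"
  using square_integrable_imp_integrable by (auto simp: finite_moment_2_iff)

lemma (in prob_space) real_cond_exp_innerK_eq_zero:
  assumes subalgebra_F: "subalgebra M F"
    and A_moment: "finite_interval_moment M 4 A" and B_moment: "finite_interval_moment M 4 B"
    and A_measurable: "(\<lambda>\<omega>. fst (A \<omega>)) \<in> borel_measurable F" "(\<lambda>\<omega>. snd (A \<omega>)) \<in> borel_measurable F"
    and B_centred: "AE \<omega> in M. real_cond_exp M F (\<lambda>\<omega>. fst (B \<omega>)) \<omega> = 0"
      "AE \<omega> in M. real_cond_exp M F (\<lambda>\<omega>. snd (B \<omega>)) \<omega> = 0"
  shows "AE \<omega> in M. real_cond_exp M F (\<lambda>\<omega>. innerK K (A \<omega>) (B \<omega>)) \<omega> = 0"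
proof -
  interpret sigma_finite_subalgebra M F by (rule sigma_finite_subalgebra_if_subalgebra[OF subalgebra_F])
  define a where "a \<omega> = K (-1) (-1) * fst (A \<omega>) - K 1 (-1) * snd (A \<omega>)" for \<omega>
  define b where "b \<omega> = K 1 1 * snd (A \<omega>) - K (-1) 1 * fst (A \<omega>)" for \<omega>
  have split: "innerK K (A \<omega>) (B \<omega>) = a \<omega> * fst (B \<omega>) + b \<omega> * snd (B \<omega>)" for \<omega>
    by (simp add: innerK_expand a_def b_def algebra_simps)
  note A_coords = A_moment[unfolded finite_interval_moment_def]
    and B_coords = B_moment[unfolded finite_interval_moment_def]
  have coeff_mom: "finite_moment M 4 a" "finite_moment M 4 b"
    using A_coords by (simp_all add: a_def[abs_def] b_def[abs_def] finite_moment_diff finite_moment_cmult)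
  have coeff_meas: "a \<in> borel_measurable F" "b \<in> borel_measurable F"
    using A_measurable unfolding a_def[abs_def] b_def[abs_def] by simp_all
  have integrable_parts: "integrable M (\<lambda>\<omega>. a \<omega> * fst (B \<omega>))" "integrable M (\<lambda>\<omega>. b \<omega> * snd (B \<omega>))"
    using coeff_mom B_coords by (auto intro!: integrable_if_finite_moment_2 finite_moment_mult)
  have "AE \<omega> in M. real_cond_exp M F (\<lambda>\<omega>. a \<omega> * fst (B \<omega>)) \<omega> = a \<omega> * real_cond_exp M F (\<lambda>\<omega>. fst (B \<omega>)) \<omega>"
    "AE \<omega> in M. real_cond_exp M F (\<lambda>\<omega>. b \<omega> * snd (B \<omega>)) \<omega> = b \<omega> * real_cond_exp M F (\<lambda>\<omega>. snd (B \<omega>)) \<omega>"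
    using coeff_meas B_coords integrable_parts by (auto intro!: real_cond_exp_mult finite_moment_measurable)
  with real_cond_exp_add[OF integrable_parts] B_centred show ?thesis
    unfolding split by eventually_elim simp
qed

subsection \<open>The score\<close>

locale interval_regression = stationary_ergodic_process M Y X J
  for M :: "'a measure" and Y X J +
  fixes K :: "int \<Rightarrow> int \<Rightarrow> real" and q s :: nat and \<theta>\<^sub>0 :: "nat \<Rightarrow> real"
  assumes kern: "kernel_pd K"
    and momY: "integrable M (\<lambda>\<omega>. (normK2 K (Y t \<omega>))\<^sup>2)"
    and momX: "j < J \<Longrightarrow> integrable M (\<lambda>\<omega>. (normK2 K (X j t \<omega>))\<^sup>2)"
    and mds_L: "AE \<omega> in M. real_cond_exp M (info M Y X J t) (\<lambda>\<omega>. fst (resid q s J Y X \<theta>\<^sub>0 t \<omega>)) \<omega> = 0"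
    and mds_R: "AE \<omega> in M. real_cond_exp M (info M Y X J t) (\<lambda>\<omega>. snd (resid q s J Y X \<theta>\<^sub>0 t \<omega>)) \<omega> = 0"
begin

abbreviation "p \<equiv> dimZ q s J"
abbreviation "Z \<equiv> Zvec q s J Y X"
abbreviation "u \<equiv> resid q s J Y X \<theta>\<^sub>0"

lemmas measurable_if_info_measurable = measurable_from_subalg[OF info_subalgebra[OF meas]]

lemma Y_moment: "finite_interval_moment M 4 (Y t)"
  by (intro finite_interval_moment_4_if_normK2[OF kern] momY
      Y_info_measurable[where t="t + 1", THEN measurable_if_info_measurable]) simp_all

lemma X_moment: "j < J \<Longrightarrow> finite_interval_moment M 4 (X j t)"
  by (intro finite_interval_moment_4_if_normK2[OF kern] momX
      X_info_measurable[where t=t, THEN measurable_if_info_measurable]) simp_all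

lemma Z_moment:
  assumes "i < p"
  shows "finite_interval_moment M 4 (\<lambda>\<omega>. Z t \<omega> i)"
  using assms
proof (cases rule: Zvec_cases[of i q s J Y X])
  case (deterministic c)
  then show ?thesis by (simp add: finite_interval_moment_def finite_moment_const)
next
  case (lagged_Y l)
  then show ?thesis using Y_moment by simp
next
  case (lagged_X j l)
  then show ?thesis using X_moment by simp
qed

lemma u_moment: "finite_interval_moment M 4 (u t)"
  unfolding resid_def by (intro finite_interval_moment_isub finite_interval_moment_ilin Y_moment Z_moment)

lemma innerK_ZZ_moment: "i < p \<Longrightarrow> k < p \<Longrightarrow> finite_moment M 2 (\<lambda>\<omega>. innerK K (Z t \<omega> i) (Z t \<omega> k))"
  using Z_moment by (intro finite_moment_innerK) simp_all

lemma innerK_Zu_moment: "i < p \<Longrightarrow> finite_moment M 2 (\<lambda>\<omega>. innerK K (Z t \<omega> i) (u t \<omega>))"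
  using Z_moment u_moment by (intro finite_moment_innerK) simp_all

lemma gram_lln:
  assumes "i < p" "k < p"
  shows "tendsto_in_prob (\<lambda>T \<omega>. gram K q s J Y X T \<omega> i k / real T) (Cmat M K q s J Y X 1 i k)"
proof -
  define \<Phi> where "\<Phi> x = innerK K (canonical_Z q s J 1 x i) (canonical_Z q s J 1 x k)" for x
  have pair_eq_\<Phi>: "innerK K (Z (int t + 1) \<omega> i) (Z (int t + 1) \<omega> k) = \<Phi> ((shift1 ^^ t) (path Y X J \<omega>))" for t \<omega>
    using assms by (simp add: \<Phi>_def shift1_funpow Zvec_path add.commute)
  from this[of 0] have \<Phi>_path: "\<Phi> (path Y X J \<omega>) = innerK K (Z 1 \<omega> i) (Z 1 \<omega> k)" for \<omega> by simp
  have "tendsto_in_prob (\<lambda>T \<omega>. (\<Sum>t<T. \<Phi> ((shift1 ^^ t) (path Y X J \<omega>))) / real T)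
      (expectation (\<lambda>\<omega>. \<Phi> (path Y X J \<omega>)))"
  proof (rule process_lln)
    show "\<Phi> \<in> borel_measurable PS" unfolding \<Phi>_def[abs_def] innerK_expand by measurable
    show "integrable M (\<lambda>\<omega>. \<Phi> (path Y X J \<omega>))"
      using innerK_ZZ_moment[OF assms] by (simp add: \<Phi>_path integrable_if_finite_moment_2)
  qed
  moreover have "gram K q s J Y X T \<omega> i k = (\<Sum>t<T. \<Phi> ((shift1 ^^ t) (path Y X J \<omega>)))" for T \<omega>
    by (simp add: gram_def sum.atLeast1_atMost_eq add.commute flip: pair_eq_\<Phi>)
  ultimately show ?thesis by (simp add: \<Phi>_path Cmat_def)
qed

definition score :: "(nat \<Rightarrow> real) \<Rightarrow> nat \<Rightarrow> 'a \<Rightarrow> real" where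
  "score \<xi> t \<omega> = innerK K (ilin p (Z (int t + 1) \<omega>) \<xi>) (u (int t + 1) \<omega>)"

definition canonical_score :: "(nat \<Rightarrow> real) \<Rightarrow> (int \<times> nat \<Rightarrow> real) \<Rightarrow> real" where
  "canonical_score \<xi> x =
    innerK K (ilin p (canonical_Z q s J 1 x) \<xi>) (canonical_resid q s J \<theta>\<^sub>0 1 x)"

lemma canonical_score_measurable[measurable]: "canonical_score \<xi> \<in> borel_measurable PS"
  unfolding canonical_score_def[abs_def] innerK_expand ilin_def fst_conv snd_conv by measurable

lemma score_eq_canonical_score: "score \<xi> t \<omega> = canonical_score \<xi> ((shift1 ^^ t) (path Y X J \<omega>))"
  by (simp add: score_def canonical_score_def innerK_ilin_left shift1_funpow Zvec_path resid_path add.commute)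

lemma inner_on_cross_moment_eq_sum_score:
  "inner_on {..<p} \<xi> (cross_moment K q s J Y X \<theta>\<^sub>0 T \<omega>) = (\<Sum>t<T. score \<xi> t \<omega>)"
proof -
  have "inner_on {..<p} \<xi> (cross_moment K q s J Y X \<theta>\<^sub>0 T \<omega>)
      = (\<Sum>i<p. \<Sum>t<T. \<xi> i * innerK K (Z (int t + 1) \<omega> i) (u (int t + 1) \<omega>))"
    by (simp add: inner_on_def cross_moment_def sum.atLeast1_atMost_eq sum_distrib_left add.commute)
  also have "\<dots> = (\<Sum>t<T. score \<xi> t \<omega>)"
    unfolding score_def innerK_ilin_left by (rule sum.swap)
  finally show ?thesis .
qed

lemma ilin_Z_moment: "finite_interval_moment M 4 (\<lambda>\<omega>. ilin p (Z t \<omega>) \<xi>)"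
  by (intro finite_interval_moment_ilin Z_moment)

lemma score_moment: "finite_moment M 2 (score \<xi> t)"
  unfolding score_def[abs_def] using ilin_Z_moment u_moment by (intro finite_moment_innerK) simp_all

lemma ilin_Z_info_measurable:
  "(\<lambda>\<omega>. fst (ilin p (Z t \<omega>) \<xi>)) \<in> borel_measurable (info M Y X J t)"
  "(\<lambda>\<omega>. snd (ilin p (Z t \<omega>) \<xi>)) \<in> borel_measurable (info M Y X J t)"
  unfolding ilin_def fst_conv snd_conv
  by (auto intro!: borel_measurable_sum borel_measurable_times Zvec_info_measurable)

lemma score_second_moment:
  "expectation (\<lambda>\<omega>. (score \<xi> 0 \<omega>)\<^sup>2) = quad_form {..<p} (Bmat M K q s J Y X \<theta>\<^sub>0 1) \<xi>"
proof -
  define b where "b i k \<omega> = innerK K (Z 1 \<omega> i) (u 1 \<omega>) * innerK K (u 1 \<omega>) (Z 1 \<omega> k)" for i k \<omega>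
  have "finite_moment M 1 (b i k)" if "i < p" "k < p" for i k
    using finite_moment_mult[of M 1] innerK_Zu_moment that
    by (simp add: b_def[abs_def] innerK_commute[OF kern, of "u 1 _"])
  then have integrable_b: "integrable M (\<lambda>\<omega>. \<xi> i * b i k \<omega> * \<xi> k)" if "i < p" "k < p" for i k
    using that by (intro integrable_mult_left integrable_mult_right) (simp flip: finite_moment_1_iff)
  have "expectation (\<lambda>\<omega>. \<Sum>i<p. \<Sum>k<p. \<xi> i * b i k \<omega> * \<xi> k)
      = (\<Sum>i<p. expectation (\<lambda>\<omega>. \<Sum>k<p. \<xi> i * b i k \<omega> * \<xi> k))"
    by (intro Bochner_Integration.integral_sum Bochner_Integration.integrable_sum integrable_b) simp_all
  also have "\<dots> = (\<Sum>i<p. \<Sum>k<p. expectation (\<lambda>\<omega>. \<xi> i * b i k \<omega> * \<xi> k))"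
    by (intro sum.cong refl Bochner_Integration.integral_sum integrable_b) simp_all
  finally have "expectation (\<lambda>\<omega>. \<Sum>i<p. \<Sum>k<p. \<xi> i * b i k \<omega> * \<xi> k)
      = (\<Sum>i<p. \<Sum>k<p. expectation (\<lambda>\<omega>. \<xi> i * b i k \<omega> * \<xi> k))" .
  moreover have "(score \<xi> 0 \<omega>)\<^sup>2 = (\<Sum>i<p. \<Sum>k<p. \<xi> i * b i k \<omega> * \<xi> k)" for \<omega>
    by (simp add: b_def score_def innerK_ilin_left power2_eq_square sum_product
        innerK_commute[OF kern, of "u 1 _"] mult_ac)
  ultimately show ?thesis by (simp add: quad_form_def Bmat_def b_def[abs_def])
qed

lemma stationary_martingale_difference_score:
  "stationary_martingale_difference M (\<lambda>t. info M Y X J (int t + 1)) (score \<xi>)"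
proof
  fix t
  show "subalgebra M (info M Y X J (int t + 1))" by (rule info_subalgebra[OF meas])
  show "sets (info M Y X J (int t + 1)) \<subseteq> sets (info M Y X J (int (Suc t) + 1))" by (rule info_mono) simp
  note lag = measurable_from_subalg[OF info_subalgebra_info[of "int t + 1" "int (Suc t) + 1" M Y X J]]
  show "score \<xi> t \<in> borel_measurable (info M Y X J (int (Suc t) + 1))"
    unfolding score_def[abs_def] innerK_expand
    by (intro borel_measurable_add borel_measurable_diff borel_measurable_times borel_measurable_const
        lag[OF _ ilin_Z_info_measurable(1)] lag[OF _ ilin_Z_info_measurable(2)] resid_info_measurable) simp_all
  show "integrable M (\<lambda>\<omega>. (score \<xi> t \<omega>)\<^sup>2)" using score_moment by (simp add: finite_moment_2_iff)
  show "AE \<omega> in M. real_cond_exp M (info M Y X J (int t + 1)) (score \<xi> t) \<omega> = 0"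
    unfolding score_def[abs_def]
    by (intro real_cond_exp_innerK_eq_zero info_subalgebra[OF meas] ilin_Z_moment ilin_Z_info_measurable
        u_moment mds_L mds_R)
  have score: "score \<xi> t = (\<lambda>\<omega>. canonical_score \<xi> ((shift1 ^^ t) (path Y X J \<omega>)))" for t
    by (simp add: score_eq_canonical_score fun_eq_iff)
  show "distr M borel (score \<xi> t) = distr M borel (score \<xi> 0)"
    using distr_shift1_funpow[OF canonical_score_measurable] by (simp add: score)
  have "integrable M (\<lambda>\<omega>. (canonical_score \<xi> (path Y X J \<omega>))\<^sup>2)"
    using score_moment[of \<xi> 0] by (simp add: score finite_moment_2_iff)
  then show "tendsto_in_prob (\<lambda>n \<omega>. (\<Sum>t<n. (score \<xi> t \<omega>)\<^sup>2) / real n) (expectation (\<lambda>\<omega>. (score \<xi> 0 \<omega>)\<^sup>2))"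
    using process_lln[of "\<lambda>x. (canonical_score \<xi> x)\<^sup>2"] by (simp add: score)
qed

lemma cross_moment_clt:
  "(\<lambda>T. expectation (\<lambda>\<omega>. cis (inner_on {..<p} \<xi> (cross_moment K q s J Y X \<theta>\<^sub>0 T \<omega>) / sqrt (real T))))
    \<longlonglongrightarrow> of_real (exp (- quad_form {..<p} (Bmat M K q s J Y X \<theta>\<^sub>0 1) \<xi> / 2))"
proof -
  interpret score: stationary_martingale_difference M "\<lambda>t. info M Y X J (int t + 1)" "score \<xi>"
    by (rule stationary_martingale_difference_score)
  show ?thesis
    using score.central_limit unfolding score.step_var_def score_second_moment inner_on_cross_moment_eq_sum_score .
qed

lemma cross_moment_measurable: "i < p \<Longrightarrow> (\<lambda>\<omega>. cross_moment K q s J Y X \<theta>\<^sub>0 T \<omega> i) \<in> borel_measurable M"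
  unfolding cross_moment_def using innerK_Zu_moment by (intro borel_measurable_sum finite_moment_measurable)

end

theorem theorem2:
  fixes M :: "'a measure" and K :: "int \<Rightarrow> int \<Rightarrow> real"
    and Y :: "int \<Rightarrow> 'a \<Rightarrow> real \<times> real" and X :: "nat \<Rightarrow> int \<Rightarrow> 'a \<Rightarrow> real \<times> real"
    and q s J :: nat and \<theta>0 :: "nat \<Rightarrow> real" and \<Theta> :: "(nat \<Rightarrow> real) set"
    and \<sigma>2 \<gamma> :: real and lam :: "nat \<Rightarrow> real"
    and \<theta>t \<theta>h :: "nat \<Rightarrow> 'a \<Rightarrow> nat \<Rightarrow> real"
  defines "p \<equiv> dimZ q s J"
    and "S0 \<equiv> {i. i < dimZ q s J \<and> \<theta>0 i \<noteq> 0}"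
  assumes prob: "prob_space M"
    and kern: "kernel_pd K"
    \<comment> \<open>(A1)\<close>
    and meas: "process_measurable M Y X J"
    and stat: "strictly_stationary M Y X J"
    and erg: "ergodic M Y X J"
    and momY: "\<forall>t. integrable M (\<lambda>\<omega>. (normK2 K (Y t \<omega>))\<^sup>2)"
    and momX: "\<forall>j<J. \<forall>t. integrable M (\<lambda>\<omega>. (normK2 K (X j t \<omega>))\<^sup>2)"
    and mds_L: "\<forall>t. AE \<omega> in M. real_cond_exp M (info M Y X J t) (\<lambda>\<omega>. fst (resid q s J Y X \<theta>0 t \<omega>)) \<omega> = 0"
    and mds_R: "\<forall>t. AE \<omega> in M. real_cond_exp M (info M Y X J t) (\<lambda>\<omega>. snd (resid q s J Y X \<theta>0 t \<omega>)) \<omega> = 0"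
    and condvar: "\<forall>t. AE \<omega> in M. real_cond_exp M (info M Y X J t)
                      (\<lambda>\<omega>. normK2 K (resid q s J Y X \<theta>0 t \<omega>)) \<omega> = \<sigma>2"
    \<comment> \<open>(A2)\<close>
    and Theta_sub: "\<Theta> \<subseteq> Rp p"
    and Theta_compact: "compact \<Theta>"
    and interior: "\<exists>U. openin (top_of_set (Rp p)) U \<and> \<theta>0 \<in> U \<and> U \<subseteq> \<Theta>"
    \<comment> \<open>(A3)\<close>
    and pd: "\<exists>U. openin (top_of_set (Rp p)) U \<and> \<theta>0 \<in> U \<and>
               (\<forall>\<theta>\<in>U. \<forall>t.
                  posdef_on {..<p} (Cmat M K q s J Y X t) \<and>
                  posdef_on {..<p} (Bmat M K q s J Y X \<theta> t))"
    \<comment> \<open>(A4) and tuning constants\<close>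
    and gam: "\<gamma> > 0"
    and lam_pos: "\<forall>T. lam T > 0"
    and lam1: "(\<lambda>T. lam T / sqrt (real T)) \<longlonglongrightarrow> 0"
    and lam2: "filterlim (\<lambda>T. lam T * real T powr ((\<gamma> - 1) / 2)) at_top sequentially"
    \<comment> \<open>the minimum D_K-distance estimator\<close>
    and tilde_min: "\<forall>T. \<forall>\<omega>\<in>space M. \<theta>t T \<omega> \<in> \<Theta> \<and>
                       (\<forall>\<theta>\<in>\<Theta>. DKobj K q s J Y X T \<omega> (\<theta>t T \<omega>) \<le> DKobj K q s J Y X T \<omega> \<theta>)"
    \<comment> \<open>the adaptive-lasso estimator (penalty +infinity on coordinates with tilde theta_j = 0)\<close>
    and hat_min: "\<forall>T. \<forall>\<omega>\<in>space M. \<theta>h T \<omega> \<in> \<Theta> \<and>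
                     (\<forall>j<p. \<theta>t T \<omega> j = 0 \<longrightarrow> \<theta>h T \<omega> j = 0) \<and>
                     (\<forall>\<theta>\<in>\<Theta>. (\<forall>j<p. \<theta>t T \<omega> j = 0 \<longrightarrow> \<theta> j = 0) \<longrightarrow>
                        DKobj K q s J Y X T \<omega> (\<theta>h T \<omega>) + lam T * adapt_pen p \<gamma> (\<theta>t T \<omega>) (\<theta>h T \<omega>)
                        \<le> DKobj K q s J Y X T \<omega> \<theta> + lam T * adapt_pen p \<gamma> (\<theta>t T \<omega>) \<theta>)"
    and hat_meas: "\<forall>T i. (\<lambda>\<omega>. \<theta>h T \<omega> i) \<in> borel_measurable M"
  shows "((\<lambda>T. measure M {\<omega> \<in> space M. \<forall>i<p. i \<notin> S0 \<longrightarrow> \<theta>h T \<omega> i = 0}) \<longlonglongrightarrow> 1) \<and>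
         (\<exists>\<mu>. gaussian_on S0 (sandwich S0 (Cmat M K q s J Y X 1) (Bmat M K q s J Y X \<theta>0 1)) \<mu> \<and>
           conv_dist_to M S0 (\<lambda>T \<omega>. \<lambda>i\<in>S0. sqrt (real T) * (\<theta>h T \<omega> i - \<theta>0 i)) \<mu>)"
proof -
  interpret R: interval_regression M Y X J K q s \<theta>0
    using prob kern meas stat erg momY momX mds_L mds_R
    by (intro interval_regression.intro stationary_ergodic_process.intro interval_regression_axioms.intro
        stationary_ergodic_process_axioms.intro) auto
  obtain U where U_open: "openin (top_of_set (Rp p)) U" "\<theta>0 \<in> U" "U \<subseteq> \<Theta>" using interior by blast
  obtain r where r_box: "r > 0" "\<And>\<theta>. \<theta> \<in> Rp p \<Longrightarrow> (\<And>i. i < p \<Longrightarrow> \<bar>\<theta> i - \<theta>0 i\<bar> < r) \<Longrightarrow> \<theta> \<in> \<Theta>"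
    using box_in_relative_neighbourhood[OF U_open(1,2)] U_open(3) by blast
  interpret lasso: adaptive_lasso_asymptotics M p "gram K q s J Y X" "cross_moment K q s J Y X \<theta>0" \<theta>t \<theta>h
    "DKobj K q s J Y X" \<theta>0 "Cmat M K q s J Y X 1" "Bmat M K q s J Y X \<theta>0 1" \<Theta> lam \<gamma> r
  proof (intro adaptive_lasso_asymptotics.intro adaptive_lasso_asymptotics_axioms.intro prob)
    show "quadratic_objective p (gram K q s J Y X T \<omega>) (cross_moment K q s J Y X \<theta>0 T \<omega>) \<theta>0 (DKobj K q s J Y X T \<omega>)"
      for T \<omega> unfolding p_def by (rule quadratic_objective_DKobj[OF kern])
    show "posdef_on {..<p} (Cmat M K q s J Y X 1)" "posdef_on {..<p} (Bmat M K q s J Y X \<theta>0 1)"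
      using pd by blast+
    show "\<theta>0 \<in> Rp p" using U_open Theta_sub by blast
  qed (use r_box gam lam_pos lam1 lam2 Theta_sub hat_meas tilde_min hat_min R.gram_lln R.cross_moment_measurable
      R.cross_moment_clt in \<open>simp_all add: p_def is_arg_min_linorder\<close>)
  have "S0 = lasso.S" unfolding lasso.S_def unfolding S0_def p_def ..
  then show ?thesis using lasso.selection_consistency lasso.asymptotic_normality by simp
qed

end
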